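(* Let $n\ge3$, let $K<0$ and $H>0$ be constants with $\mathfrak D_n:=\sqrt{n(n-1)}\frac{H}{\sqrt{|K|}}>1$, let $\alpha_n=(4n(n-1))^{\frac{n-2}{4}}$, and let $$U(x)=\frac{\alpha_n}{|K|^{\frac{n-2}{4}}}\frac{1}{\left(|\tilde x|^2+(x_n+\mathfrak D_n)^2-1\right)^{\frac{n-2}{2}}},\qquad x=(\tilde x,x_n)\in\mathbb R^n_+ .$$ Let $v\in H^1(\mathbb R^n_+)$ be a solution of $$\begin{cases}-\dfrac{4(n-1)}{n-2}\Delta v+\dfrac{n+2}{n-2}|K|U^{\frac{4}{n-2}}v=0 & \text{in }\mathbb R^n_+,\\[2mm] \dfrac{2}{n-2}\dfrac{\partial v}{\partial\nu}-\dfrac{n}{n-2}H U^{\frac{2}{n-2}}v=0 & \text{on }\partial\mathbb R^n_+.\end{cases}$$ Then $v$ is a linear combination of the functions $$\mathfrak z_i(x)=\frac{\partial U}{\partial x_i}(x)=\frac{\alpha_n}{|K|^{\frac{n-2}{4}}}\frac{(2-n)x_i}{\left(|\tilde x|^2+(x_n+\mathfrak D_n)^2-1\right)^{\frac n2}},\qquad i=1,\dots,n-1,$$ and $$\mathfrak z_n(x)=\frac{2-n}{2}U(x)-\nabla U(x)\cdot(x+\mathfrak D_n\mathfrak e_n)+\mathfrak D_n\frac{\partial U}{\partial x_n}(x)=\frac{\alpha_n}{|K|^{\frac{n-2}{4}}}\,\frac{n-2}{2}\,\frac{|x|^2+1-\mathfrak D_n^2}{\left(|\tilde x|^2+(x_n+\mathfrak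 D_n)^2-1\right)^{\frac n2}}.$$
   Context: $\mathbb R^n_+=\{x=(\tilde x,x_n):\tilde x\in\mathbb R^{n-1},\ x_n>0\}$, $\mathfrak e_n=(0,\dots,0,1)$, and $\nu=-\mathfrak e_n$ is the exterior unit normal to $\partial\mathbb R^n_+$. *)

theory Defs
  imports "HOL-Analysis.Analysis"
begin

text \<open>Points of \<open>\<real>\<^sup>n\<close> are written \<open>x = (x', t)\<close> with \<open>x' \<in> \<real>\<^sup>n\<^sup>-\<^sup>1\<close> the tangential part and \<open>t = x\<^sub>n\<close>;
  the Euclidean structure and Lebesgue measure of the product type are those of \<open>\<real>\<^sup>n\<close>.\<close>

definition half_space :: "((real^'m) \<times> real) set" where
  "half_space = {x. snd x > 0}"

definition e_last :: "(real^'m) \<times> real" where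
  "e_last = (0, 1)"

definition e_tan :: "'m \<Rightarrow> (real^'m) \<times> real" where
  "e_tan i = (axis i 1, 0)"

definition partial :: "('a::euclidean_space \<Rightarrow> real) \<Rightarrow> 'a \<Rightarrow> 'a \<Rightarrow> real" where
  "partial f b x = frechet_derivative f (at x) b"

definition gradient :: "('a::euclidean_space \<Rightarrow> real) \<Rightarrow> 'a \<Rightarrow> 'a" where
  "gradient f x = (\<Sum>b\<in>Basis. partial f b x *\<^sub>R b)"

definition C1_compact :: "('a::euclidean_space \<Rightarrow> real) \<Rightarrow> bool" where
  "C1_compact \<phi> \<longleftrightarrow> (\<forall>x. \<phi> differentiable (at x)) \<and> continuous_on UNIV (gradient \<phi>)
     \<and> compact (closure {x. \<phi> x \<noteq> 0})"

definition square_integrable :: "'a measure \<Rightarrow> ('a \<Rightarrow> 'b::euclidean_space) \<Rightarrow> bool" where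
  "square_integrable M f \<longleftrightarrow> f \<in> borel_measurable M \<and> integrable M (\<lambda>x. (norm (f x))\<^sup>2)"

text \<open>\<open>v\<close> is in \<open>L\<^sup>2\<close> and has the weak gradient \<open>g\<close> in \<open>L\<^sup>2\<close>. Test functions are \<open>C\<^sup>1\<close> with compact
  support in \<open>\<Omega>\<close>, as in Brezis; by mollification this agrees with testing against
  smooth functions. Functions are representatives of their almost-everywhere classes.\<close>

definition H1_gradient ::
    "'a::euclidean_space set \<Rightarrow> ('a \<Rightarrow> real) \<Rightarrow> ('a \<Rightarrow> 'a) \<Rightarrow> bool" where
  "H1_gradient \<Omega> v g \<longleftrightarrow>
     square_integrable (lebesgue_on \<Omega>) v \<and> square_integrable (lebesgue_on \<Omega>) g \<and>
     (\<forall>\<phi>. C1_compact \<phi> \<and> closure {x. \<phi> x \<noteq> 0} \<subseteq> \<Omega> \<longrightarrow>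
        (\<forall>b\<in>Basis. (\<integral>x. v x * partial \<phi> b x \<partial>lebesgue_on \<Omega>)
                  = - (\<integral>x. (g x \<bullet> b) * \<phi> x \<partial>lebesgue_on \<Omega>)))"

definition H1 :: "'a::euclidean_space set \<Rightarrow> ('a \<Rightarrow> real) set" where
  "H1 \<Omega> = {v. \<exists>g. H1_gradient \<Omega> v g}"

text \<open>The trace operator \<open>H\<^sup>1(\<real>\<^sup>n\<^sub>+) \<rightarrow> L\<^sup>2(\<partial>\<real>\<^sup>n\<^sub>+)\<close> is the continuous extension of the restriction map
  \<open>\<phi> \<mapsto> \<phi>(\<cdot>, 0)\<close> from the dense subspace of compactly supported \<open>C\<^sup>1\<close> functions on \<open>\<real>\<^sup>n\<close>.
  The boundary is identified with \<open>\<real>\<^sup>n\<^sup>-\<^sup>1\<close>.\<close>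

definition is_trace :: "((real^'m) \<times> real \<Rightarrow> real) \<Rightarrow> (real^'m \<Rightarrow> real) \<Rightarrow> bool" where
  "is_trace v T \<longleftrightarrow> square_integrable lebesgue T \<and>
     (\<exists>g \<phi>. H1_gradient half_space v g \<and> (\<forall>k::nat. C1_compact (\<phi> k)) \<and>
        (\<lambda>k. \<integral>x. (\<phi> k x - v x)\<^sup>2 \<partial>lebesgue_on half_space) \<longlonglongrightarrow> 0 \<and>
        (\<lambda>k. \<integral>x. (norm (gradient (\<phi> k) x - g x))\<^sup>2 \<partial>lebesgue_on half_space) \<longlonglongrightarrow> 0 \<and>
        (\<lambda>k. \<integral>y. (\<phi> k (y, 0) - T y)\<^sup>2 \<partial>lebesgue) \<longlonglongrightarrow> 0)"

text \<open>Weak solutions \<open>v \<in> H\<^sup>1(\<real>\<^sup>n\<^sub>+)\<close> of the Robin problem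
  \<open>-a \<Delta>v + p v = 0\<close> in \<open>\<real>\<^sup>n\<^sub>+\<close>, \<open>\<beta> \<partial>v/\<partial>\<nu> - q v = 0\<close> on \<open>\<partial>\<real>\<^sup>n\<^sub>+\<close>, with \<open>\<nu> = -e\<^sub>n\<close> the exterior normal.
  Multiplying by \<open>\<phi>\<close> and integrating by parts gives
  \<open>a \<integral> \<nabla>v\<cdot>\<nabla>\<phi> + \<integral> p v \<phi> - a \<integral>\<^sub>\<partial> (\<partial>v/\<partial>\<nu>) \<phi> = 0\<close>, and \<open>\<partial>v/\<partial>\<nu> = q v / \<beta>\<close> on the boundary.
  The test functions need not vanish on the boundary; as they are dense in \<open>H\<^sup>1\<close>, this is the
  same as testing against all of \<open>H\<^sup>1\<close> when \<open>p\<close> and \<open>q\<close> are bounded.\<close>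

definition weak_robin_solution ::
    "real \<Rightarrow> ((real^'m) \<times> real \<Rightarrow> real) \<Rightarrow> real \<Rightarrow> (real^'m \<Rightarrow> real)
      \<Rightarrow> ((real^'m) \<times> real \<Rightarrow> real) \<Rightarrow> bool" where
  "weak_robin_solution a p \<beta> q v \<longleftrightarrow>
     (\<exists>g T. H1_gradient half_space v g \<and> is_trace v T \<and>
        (\<forall>\<phi>. C1_compact \<phi> \<longrightarrow>
           a * (\<integral>x. g x \<bullet> gradient \<phi> x \<partial>lebesgue_on half_space)
         + (\<integral>x. p x * v x * \<phi> x \<partial>lebesgue_on half_space)
         - a / \<beta> * (\<integral>y. q y * T y * \<phi> (y, 0) \<partial>lebesgue) = 0))"

definition frakD :: "nat \<Rightarrow> real \<Rightarrow> real \<Rightarrow> real" where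
  "frakD n K H = sqrt (real n * (real n - 1)) * (H / sqrt \<bar>K\<bar>)"

definition alpha :: "nat \<Rightarrow> real" where
  "alpha n = (4 * real n * (real n - 1)) powr ((real n - 2) / 4)"

definition rho :: "nat \<Rightarrow> real \<Rightarrow> real \<Rightarrow> (real^'m) \<times> real \<Rightarrow> real" where
  "rho n K H x = (norm (fst x))\<^sup>2 + (snd x + frakD n K H)\<^sup>2 - 1"

definition bubble :: "nat \<Rightarrow> real \<Rightarrow> real \<Rightarrow> (real^'m) \<times> real \<Rightarrow> real" where
  "bubble n K H x = alpha n / \<bar>K\<bar> powr ((real n - 2) / 4)
     * (1 / rho n K H x powr ((real n - 2) / 2))"

definition z_tan :: "nat \<Rightarrow> real \<Rightarrow> real \<Rightarrow> 'm \<Rightarrow> (real^'m) \<times> real \<Rightarrow> real" where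
  "z_tan n K H i x = partial (bubble n K H) (e_tan i) x"

definition z_last :: "nat \<Rightarrow> real \<Rightarrow> real \<Rightarrow> (real^'m) \<times> real \<Rightarrow> real" where
  "z_last n K H x = (2 - real n) / 2 * bubble n K H x
     - gradient (bubble n K H) x \<bullet> (x + frakD n K H *\<^sub>R e_last)
     + frakD n K H * partial (bubble n K H) e_last x"

end

theory Submission
  imports Defs
begin

text \<open>
  Put \<open>D = \<DD>\<^sub>n\<close> and \<open>\<rho> = |x'|\<^sup>2 + (x\<^sub>n + D)\<^sup>2 - 1\<close>. With the metric \<open>4|dx|\<^sup>2/\<rho>\<^sup>2\<close> the half-space is a ball in
  hyperbolic space, the problem reads \<open>\<Delta>v = n(n+2)v/\<rho>\<^sup>2\<close>, \<open>\<partial>v/\<partial>\<nu> = nDv/\<rho>\<close>, and in Klein coordinates \<open>y\<close> centred at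
  the centre of the ball, which becomes \<open>|y| < 1/D\<close>, the substitution \<open>v = P f(y)\<close>, \<open>P = \<rho>\<^sup>-\<^sup>n\<^sup>/\<^sup>2(D\<rho> - 2x\<^sub>n)\<close>, turns it into
  \<open>(\<delta>\<^sub>i\<^sub>j - y\<^sub>iy\<^sub>j)\<partial>\<^sub>i\<partial>\<^sub>jf = 0\<close> with the boundary condition \<open>y\<cdot>\<nabla>f = f\<close>. The linear functions of \<open>y\<close> are solutions, and they give
  the \<open>\<zz>\<^sub>i\<close>.

  Testing the weak equation with \<open>P (a\<cdot>y)\<^sup>p |y|\<^sup>2\<^sup>i\<close> relates the moments of \<open>v\<close> in the ball to the moments of its trace.
  On combinations that are harmonic of degree \<open>k\<close>, times \<open>|y|\<^sup>2\<^sup>j\<close>, this is a recursion in \<open>j\<close> whose solutions with a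
  nonzero boundary term are eventually increasing when \<open>k \<ge> 2\<close>, although the moments tend to \<open>0\<close> because \<open>|y| \<le> 1/D < 1\<close>.
  So the trace has no components of degree \<open>k \<noteq> 1\<close>. After subtracting a combination of the \<open>\<zz>\<^sub>i\<close> all moments of the
  trace vanish, hence so does the trace, and the energy identity gives \<open>v = 0\<close>.
\<close>

text \<open>The conformal weight \<open>rho^(-(n-2)/2)\<close> turns the interior equation into
  \<open>Delta_g u = n u\<close> for the hyperbolic metric, and restrictions to the hyperboloid of
  linear functions on Minkowski space solve it. Divided by the time coordinate these become 1 and
  the Klein coordinates. Hence the prefactor \<open>P\<close>, which is the conformal weight times a
  multiple of cosh of the distance to the centre, and hence the affine functions of \<open>y\<close>
  in the kernel of the transformed operator. The boundary condition acts on a homogeneous function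
  by its degree minus one, so it singles out degree one.

  The obstacle is that the boundary term of the quadratic form is negative: energy alone does not
  give uniqueness, and the trace has to be identified first. The weak equation is used only by
  moving all derivatives onto explicit functions, so that \<open>v\<close> enters through integrals.
  Powers of the linear forms \<open>a.y\<close>, over all \<open>a\<close>, play the part of
  spherical harmonics, since together they determine a weighted trace. The powers
  \<open>|y|^(2j)\<close> give infinitely many relations containing one and the same boundary
  number, and their growth in \<open>j\<close> forces it to vanish.\<close>

section \<open>Test functions\<close>

text \<open>A C1 step from 0 to 1 on the unit interval, matching the C1 class of the test functions:
  squares of positive parts are C1, and the two squares in the denominator have no common
  zero.\<close>

definition smooth_step :: "real \<Rightarrow> real" where
  "smooth_step r = (max 0 r)\<^sup>2 / ((max 0 r)\<^sup>2 + (max 0 (1 - r))\<^sup>2)"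

lemma pos_part_square_derivative:
  "((\<lambda>r::real. (max 0 r)\<^sup>2) has_real_derivative 2 * max 0 r) (at r)"
proof (cases r "0::real" rule: linorder_cases)
  case less
  have "((\<lambda>r::real. (max 0 r)\<^sup>2) has_real_derivative 0) (at r)"
    by (rule DERIV_cong_ev[THEN iffD1, OF refl _ refl DERIV_const[of 0]])
       (use less eventually_nhds_in_open[of "{..<0}" r] in \<open>auto elim!: eventually_mono\<close>)
  then show ?thesis using less by simp
next
  case equal
  have "((\<lambda>h. (max 0 (h::real))\<^sup>2 / h) \<longlongrightarrow> 0) (at 0)"
  proof (rule Lim_null_comparison)
    show "\<forall>\<^sub>F h in at 0. norm ((max 0 (h::real))\<^sup>2 / h) \<le> \<bar>h\<bar>"
      by (rule always_eventually) (auto simp: max_def power2_eq_square)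
    show "((\<lambda>h::real. \<bar>h\<bar>) \<longlongrightarrow> 0) (at 0)" by (rule tendsto_eq_intros refl)+ simp
  qed
  then show ?thesis using equal by (simp add: DERIV_def)
next
  case greater
  have "((\<lambda>r::real. r\<^sup>2) has_real_derivative 2 * r) (at r)"
    by (auto intro!: derivative_eq_intros)
  then have "((\<lambda>r::real. (max 0 r)\<^sup>2) has_real_derivative 2 * r) (at r)"
    by (rule DERIV_cong_ev[THEN iffD1, OF refl _ refl, rotated])
       (use greater eventually_nhds_in_open[of "{0<..}" r] in \<open>auto elim!: eventually_mono\<close>)
  then show ?thesis using greater by simp
qed

lemma smooth_step_denom_pos: "(max 0 r)\<^sup>2 + (max 0 (1 - r))\<^sup>2 > (0::real)"
  by (cases "r > 0") (auto simp: max_def intro: add_pos_nonneg add_nonneg_pos)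

definition smooth_step' :: "real \<Rightarrow> real" where
  "smooth_step' r = 2 * max 0 r * max 0 (1 - r) * (max 0 r + max 0 (1 - r))
     / ((max 0 r)\<^sup>2 + (max 0 (1 - r))\<^sup>2)\<^sup>2"

lemma smooth_step_derivative [derivative_intros]:
  assumes "(f has_real_derivative f') (at x within S)"
  shows "((\<lambda>x. smooth_step (f x)) has_real_derivative smooth_step' (f x) * f') (at x within S)"
proof -
  have "(smooth_step has_real_derivative smooth_step' r) (at r)" for r
  proof -
    have 1: "((\<lambda>r::real. (max 0 (1 - r))\<^sup>2) has_real_derivative (2 * max 0 (1 - r)) * (- 1)) (at r)"
      by (rule DERIV_chain2[OF pos_part_square_derivative]) (auto intro!: derivative_eq_intros)
    have "((\<lambda>r. (max 0 r)\<^sup>2 / ((max 0 r)\<^sup>2 + (max 0 (1 - r))\<^sup>2)) has_real_derivative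
       (2 * max 0 r * ((max 0 r)\<^sup>2 + (max 0 (1 - r))\<^sup>2) - (max 0 r)\<^sup>2 * (2 * max 0 r + (2 * max 0 (1 - r)) * (- 1)))
        / (((max 0 r)\<^sup>2 + (max 0 (1 - r))\<^sup>2) * ((max 0 r)\<^sup>2 + (max 0 (1 - r))\<^sup>2))) (at r)"
      using smooth_step_denom_pos[of r]
      by (intro DERIV_divide DERIV_add pos_part_square_derivative 1) linarith
    then show ?thesis
      unfolding smooth_step_def[abs_def] smooth_step'_def
      by (rule DERIV_cong) (simp add: power2_eq_square algebra_simps)
  qed
  from DERIV_chain2[OF this assms] show ?thesis .
qed

lemma continuous_on_smooth_step' [continuous_intros]:
  assumes "continuous_on S f"
  shows "continuous_on S (\<lambda>x. smooth_step' (f x))"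
  unfolding smooth_step'_def
  by (intro continuous_intros assms) (use smooth_step_denom_pos in \<open>auto simp: less_imp_neq[symmetric]\<close>)

lemma continuous_on_smooth_step [continuous_intros]:
  assumes "continuous_on S f"
  shows "continuous_on S (\<lambda>x. smooth_step (f x))"
  unfolding smooth_step_def
  by (intro continuous_intros assms) (use smooth_step_denom_pos in \<open>auto simp: less_imp_neq[symmetric]\<close>)

lemma smooth_step_eq_0: "r \<le> 0 \<Longrightarrow> smooth_step r = 0"
  and smooth_step_eq_1: "r \<ge> 1 \<Longrightarrow> smooth_step r = 1"
  and smooth_step'_eq_0: "r \<le> 0 \<or> r \<ge> 1 \<Longrightarrow> smooth_step' r = 0"
  by (auto simp: smooth_step_def smooth_step'_def max_def)

lemma smooth_step_bounds: "0 \<le> smooth_step r" "smooth_step r \<le> 1"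
  using smooth_step_denom_pos[of r] by (auto simp: smooth_step_def divide_simps)

lemma smooth_step'_bound: obtains C where "C > 0" "\<And>r. \<bar>smooth_step' r\<bar> \<le> C"
proof -
  have "compact (smooth_step' ` {0..1})"
    by (intro compact_continuous_image continuous_on_smooth_step' continuous_on_id) simp
  then obtain C where C: "C > 0" "\<forall>y\<in>smooth_step' ` {0..1}. norm y \<le> C"
    using compact_imp_bounded bounded_pos by metis
  have "\<bar>smooth_step' r\<bar> \<le> C" for r
    using C smooth_step'_eq_0[of r] by (cases "0 \<le> r \<and> r \<le> 1") auto
  with C(1) that show ?thesis by blast
qed

section \<open>Gradients and compactly supported C1 functions\<close>

lemma gradient_eqI:
  assumes "(f has_derivative (\<lambda>h. G \<bullet> h)) (at x)"
  shows "gradient f x = G"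
  unfolding gradient_def partial_def frechet_derivative_at[OF assms, symmetric]
  by (simp add: euclidean_representation)

lemma partial_eqI:
  assumes "(f has_derivative (\<lambda>h. G \<bullet> h)) (at x)"
  shows "partial f b x = G \<bullet> b"
  unfolding partial_def frechet_derivative_at[OF assms, symmetric] by simp

lemma differentiable_imp_has_gradient:
  assumes "f differentiable (at x)"
  shows "(f has_derivative (\<lambda>h. gradient f x \<bullet> h)) (at x)"
proof -
  have d: "(f has_derivative frechet_derivative f (at x)) (at x)"
    using assms frechet_derivative_works by blast
  then interpret l: linear "frechet_derivative f (at x)" by (rule has_derivative_linear)
  have "gradient f x \<bullet> h = frechet_derivative f (at x) h" for h
    unfolding gradient_def partial_def inner_sum_left inner_scaleR_left
    by (subst (2) euclidean_representation[of h, symmetric], subst l.sum)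
       (auto simp: l.scaleR inner_commute intro!: sum.cong)
  with d show ?thesis by (simp add: fun_eq_iff[symmetric])
qed

lemma C1_compactI:
  fixes f :: "'a::euclidean_space \<Rightarrow> real"
  assumes d: "\<And>x. (f has_derivative (\<lambda>h. G x \<bullet> h)) (at x)" and c: "continuous_on UNIV G"
    and B: "\<And>x. f x \<noteq> 0 \<Longrightarrow> norm x \<le> B"
  shows "C1_compact f"
proof -
  have "gradient f = G" using gradient_eqI[OF d] by auto
  moreover have "compact (closure {x. f x \<noteq> 0})"
    unfolding compact_closure bounded_iff using B by auto
  moreover have "f differentiable at x" for x using d differentiableI by blast
  ultimately show ?thesis unfolding C1_compact_def using c by auto
qed

lemma C1_compactD:
  fixes f :: "'a::euclidean_space \<Rightarrow> real"
  assumes "C1_compact f"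
  shows C1_compact_has_derivative: "(f has_derivative (\<lambda>h. gradient f x \<bullet> h)) (at x)"
    and C1_compact_continuous_gradient: "continuous_on S (gradient f)"
    and C1_compact_continuous: "continuous_on S f"
proof -
  show *: "(f has_derivative (\<lambda>h. gradient f x \<bullet> h)) (at x)" for x
    using assms differentiable_imp_has_gradient unfolding C1_compact_def by blast
  show "continuous_on S (gradient f)"
    using assms continuous_on_subset unfolding C1_compact_def by blast
  show "continuous_on S f"
    by (intro continuous_at_imp_continuous_on ballI has_derivative_continuous[OF *])
qed

lemma C1_compact_bounded_support:
  fixes f :: "'a::euclidean_space \<Rightarrow> real"
  assumes "C1_compact f"
  obtains B where "B > 0" "\<And>x. norm x > B \<Longrightarrow> f x = 0" "\<And>x. norm x > B \<Longrightarrow> gradient f x = 0"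
proof -
  have "bounded {x. f x \<noteq> 0}"
    using assms unfolding C1_compact_def compact_closure by blast
  then obtain B where B: "B > 0" "\<And>x. f x \<noteq> 0 \<Longrightarrow> norm x \<le> B"
    unfolding bounded_pos by auto
  have z: "f x = 0" if "norm x > B" for x using B(2)[of x] that by fastforce
  have "gradient f x = 0" if "norm x > B" for x
  proof -
    have o: "open {x::'a. norm x > B}" by (intro open_Collect_less continuous_intros)
    have "((\<lambda>_. 0) has_derivative (\<lambda>h. 0 \<bullet> h)) (at x)" by simp
    then have "(f has_derivative (\<lambda>h. 0 \<bullet> h)) (at x)"
      by (rule has_derivative_transform_within_open[OF _ o]) (use that z in auto)
    then show ?thesis by (rule gradient_eqI)
  qed
  with B(1) z that show ?thesis by blast
qed

lemma C1_compact_diff: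
  fixes f g :: "'a::euclidean_space \<Rightarrow> real"
  assumes "C1_compact f" "C1_compact g"
  shows "C1_compact (\<lambda>x. f x - g x)" and "gradient (\<lambda>x. f x - g x) x = gradient f x - gradient g x"
proof -
  have d: "((\<lambda>x. f x - g x) has_derivative (\<lambda>h. (gradient f x - gradient g x) \<bullet> h)) (at x)" for x
    unfolding inner_diff_left
    by (rule has_derivative_diff[OF C1_compact_has_derivative[OF assms(1)] C1_compact_has_derivative[OF assms(2)]])
  show "gradient (\<lambda>x. f x - g x) x = gradient f x - gradient g x" by (rule gradient_eqI[OF d])
  obtain B1 where B1: "\<And>x. norm x > B1 \<Longrightarrow> f x = 0" by (rule C1_compact_bounded_support[OF assms(1)]) blast
  obtain B2 where B2: "\<And>x. norm x > B2 \<Longrightarrow> g x = 0" by (rule C1_compact_bounded_support[OF assms(2)]) blast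
  have "norm x \<le> max B1 B2" if "f x - g x \<noteq> 0" for x
    using B1[of x] B2[of x] that by fastforce
  then show "C1_compact (\<lambda>x. f x - g x)"
    using C1_compactI[OF d continuous_on_diff[OF C1_compact_continuous_gradient[OF assms(1)]
      C1_compact_continuous_gradient[OF assms(2)]]] by blast
qed

section \<open>Integration over the half-space\<close>

text \<open>Dyadic comparison: on the shell \<open>2^(j-1) <= |x| < 2^j\<close> the function is at
  most \<open>4^q * r^j\<close> with \<open>r = 4^(-q)\<close>, while the ball of radius
  \<open>2^j\<close> has volume of order \<open>2^(j*d)\<close> in dimension \<open>d\<close>. The
  geometric series has ratio \<open>r * 2^d\<close>, which is below 1 exactly when
  \<open>2 * q > d\<close>.\<close>

lemma integrable_powr_decay:
  assumes c: "c > 0" and q: "2 * q > real (DIM('a::euclidean_space))"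
  shows "integrable lborel (\<lambda>x::'a. (c + (norm x)\<^sup>2) powr (- q))"
proof (rule integrableI_bounded)
  let ?f = "\<lambda>x::'a. (c + (norm x)\<^sup>2) powr (- q)"
  have [measurable]: "?f \<in> borel_measurable borel"
    by (intro borel_measurable_continuous_onI continuous_intros)
       (use c in \<open>auto simp: add_pos_nonneg less_imp_neq[symmetric] pos_add_strict\<close>)
  then show "?f \<in> borel_measurable lborel" by simp
  have q0: "q > 0" using q by (smt (verit) of_nat_0_le_iff)
  define r where "r = (4::real) powr (- q)"
  \<comment> \<open>\<open>c powr (- q)\<close> serves the unit ball; \<open>4 powr q\<close> pays
    for passing from the inner radius \<open>2^(j-1)\<close> of a shell to its index
    \<open>j\<close>.\<close>
  define M where "M = max (c powr (- q)) (4 powr q)"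
  define a where "a = (\<lambda>j. M * r ^ j)"
  have r: "0 < r" by (simp add: r_def)
  have M: "0 < M" "c powr (-q) \<le> M" "4 powr q \<le> M" using c by (auto simp: M_def less_max_iff_disj)
  have le: "ennreal (?f x) \<le> (\<Sum>j. ennreal (a j) * indicator (ball 0 (2 ^ j)) x)" for x
  proof -
    have "\<exists>j. ennreal (?f x) \<le> ennreal (a j) * indicator (ball 0 (2 ^ j)) x"
    proof (cases "norm x < 1")
      case True
      have "?f x \<le> c powr (- q)" using c q0 by (intro powr_mono2') auto
      then have "?f x \<le> a 0" using M by (simp add: a_def)
      then show ?thesis using True by (intro exI[of _ 0]) (simp add: ennreal_leI)
    next
      case False
      have "\<exists>j. norm x < 2 ^ j" using real_arch_pow[of 2 "norm x"] by auto
      then obtain j where j: "norm x < 2 ^ j" "\<And>i. i < j \<Longrightarrow> \<not> norm x < 2 ^ i"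
        using exists_least_iff[of "\<lambda>j. norm x < 2 ^ j"] by auto
      have "j \<noteq> 0" using j(1) False by (cases j) auto
      then obtain i where i: "j = Suc i" using not0_implies_Suc by auto
      have "2 ^ i \<le> norm x" using j(2)[of i] i by simp
      then have "(2 ^ i)\<^sup>2 \<le> (norm x)\<^sup>2" by (rule power_mono) simp
      then have "4 ^ i \<le> (norm x)\<^sup>2" by (simp add: power2_eq_square power_mult_distrib[symmetric])
      then have "?f x \<le> (4 ^ i) powr (- q)" using c q0 by (intro powr_mono2') auto
      also have "\<dots> = r ^ i" unfolding r_def by (simp add: powr_realpow[symmetric] powr_powr mult.commute)
      also have "\<dots> = 4 powr q * r ^ j" using i by (simp add: r_def powr_minus)
      also have "\<dots> \<le> a j" unfolding a_def using M r by (intro mult_right_mono) auto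
      finally show ?thesis using j(1) by (intro exI[of _ j]) (simp add: ennreal_leI)
    qed
    then obtain j where "ennreal (?f x) \<le> ennreal (a j) * indicator (ball 0 (2 ^ j)) x" by blast
    also have "\<dots> \<le> (\<Sum>i. ennreal (a i) * indicator (ball 0 (2 ^ i)) x)"
      using sum_le_suminf[of "\<lambda>i. ennreal (a i) * indicator (ball 0 (2 ^ i)) x" "{j}"]
      by (simp del: sum_mult_indicator)
    finally show ?thesis .
  qed
  have rho: "r * 2 ^ DIM('a) < 1"
  proof -
    have "(4::real) powr q = 2 powr q * 2 powr q" by (subst powr_mult[symmetric]) auto
    also have "\<dots> = 2 powr (2 * q)" by (simp flip: powr_add)
    finally have "r * 2 ^ DIM('a) = 2 powr (real DIM('a) - 2 * q)"
      by (simp add: r_def powr_diff powr_realpow powr_minus field_simps)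
    also have "\<dots> < 2 powr 0" using q by (intro powr_less_mono) auto
    finally show ?thesis by simp
  qed
  let ?V = "unit_ball_vol (real DIM('a))"
  have em: "emeasure lborel (ball (0::'a) (2 ^ j)) = ennreal (?V * (2 ^ DIM('a)) ^ j)" for j :: nat
  proof -
    have "emeasure lborel (ball (0::'a) (2 ^ j)) = ennreal (measure lborel (ball (0::'a) (2 ^ j)))"
      using emeasure_bounded_finite[OF bounded_ball, of "0::'a" "2 ^ j"] by (simp add: emeasure_eq_ennreal_measure)
    also have "measure lborel (ball (0::'a) (2 ^ j)) = ?V * (2 ^ DIM('a)) ^ j"
      by (subst content_ball) (simp_all add: power_mult[symmetric] mult.commute)
    finally show ?thesis .
  qed
  have "(\<integral>\<^sup>+ x. ennreal (norm (?f x)) \<partial>lborel) \<le> (\<integral>\<^sup>+ x. (\<Sum>j. ennreal (a j) * indicator (ball (0::'a) (2 ^ j)) x) \<partial>lborel)"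
    using le by (intro nn_integral_mono) simp
  also have "\<dots> = (\<Sum>j. \<integral>\<^sup>+ x. ennreal (a j) * indicator (ball (0::'a) (2 ^ j)) x \<partial>lborel)"
    by (intro nn_integral_suminf borel_measurable_times_ennreal measurable_const borel_measurable_indicator) auto
  also have "\<dots> = (\<Sum>j. ennreal (a j) * emeasure lborel (ball (0::'a) (2 ^ j)))"
    by (subst nn_integral_cmult_indicator) auto
  also have "\<dots> = (\<Sum>j. ennreal (M * ?V * (r * 2 ^ DIM('a)) ^ j))"
    unfolding em a_def using M r
    by (intro suminf_cong) (simp add: ennreal_mult[symmetric] power_mult_distrib mult_ac)
  also have "\<dots> < \<infinity>"
  proof -
    have "summable (\<lambda>j. M * ?V * (r * 2 ^ DIM('a)) ^ j)"
      using rho r by (intro summable_mult summable_geometric) simp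
    then have "(\<Sum>j. ennreal (M * ?V * (r * 2 ^ DIM('a)) ^ j)) \<noteq> top"
      by (subst suminf_ennreal_eq[OF _ summable_sums]) (use M r in auto)
    then show ?thesis by (simp add: less_top)
  qed
  finally show "(\<integral>\<^sup>+ x. ennreal (norm (?f x)) \<partial>lborel) < \<infinity>" .
qed

text \<open>Open boxes form an intersection-stable generator of the Borel sets, so vanishing
  integrals spread to all Borel sets by Dynkin induction. The complement step needs the integral
  over the whole space, obtained as a limit over growing boxes. The induction runs on a Borel
  representative \<open>g\<close> of \<open>f\<close>.\<close>

lemma AE_eq_0_if_box_integrals_0:
  fixes f :: "'a::euclidean_space \<Rightarrow> real"
  assumes f: "integrable lebesgue f"
    and box: "\<And>a b. (\<integral>x. indicator (box a b) x * f x \<partial>lebesgue) = 0"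
  shows "AE x in lebesgue. f x = 0"
proof -
  obtain g where g[measurable]: "g \<in> borel_measurable lborel" and fg: "AE x in lborel. f x = g x"
    using completion_ex_borel_measurable_real[of f lborel] f by auto
  have fg': "AE x in lebesgue. f x = g x" using fg by (rule AE_completion)
  have "integrable lebesgue g"
    by (rule integrable_cong_AE_imp[OF f _ fg']) (use g in \<open>auto intro: measurable_completion\<close>)
  then have gi: "integrable lborel g" using g by (simp add: integrable_completion)
  have gA: "integrable lborel (\<lambda>x. indicator A x * g x)" if "A \<in> sets borel" for A
    using integrable_mult_indicator[OF _ gi, of A] that by simp
  have gbox: "(\<integral>x. indicator (box a b) x * g x \<partial>lborel) = 0" for a b
  proof -
    have "(\<integral>x. indicator (box a b) x * g x \<partial>lborel) = (\<integral>x. indicator (box a b) x * g x \<partial>lebesgue)"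
      by (rule integral_completion[symmetric]) simp
    also have "\<dots> = (\<integral>x. indicator (box a b) x * f x \<partial>lebesgue)"
    proof (rule integral_cong_AE)
      show "(\<lambda>x. indicator (box a b) x * g x) \<in> borel_measurable lebesgue"
        by (rule measurable_completion) simp
      show "(\<lambda>x. indicator (box a b) x * f x) \<in> borel_measurable lebesgue"
        by (intro borel_measurable_times borel_measurable_indicator borel_measurable_integrable[OF f]) simp
    qed (use fg' in eventually_elim, simp)
    finally show ?thesis using box by simp
  qed
  have gU: "(\<integral>x. g x \<partial>lborel) = 0"
  proof -
    let ?B = "\<lambda>n::nat. box (- (real n *\<^sub>R One)) (real n *\<^sub>R One) :: 'a set"
    have "(\<lambda>n. \<integral>x. indicator (?B n) x * g x \<partial>lborel) \<longlonglongrightarrow> (\<integral>x. g x \<partial>lborel)"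
    proof (rule integral_dominated_convergence[where w="\<lambda>x. norm (g x)"])
      show "AE x in lborel. (\<lambda>n. indicator (?B n) x * g x) \<longlonglongrightarrow> g x"
      proof (intro AE_I2 tendsto_eventually)
        fix x :: 'a
        obtain N :: nat where N: "norm x < real N" using reals_Archimedean2 by blast
        show "\<forall>\<^sub>F n in sequentially. indicator (?B n) x * g x = g x"
          using eventually_ge_at_top[of N]
        proof eventually_elim
          case (elim n)
          have "\<bar>x \<bullet> b\<bar> < real n" if "b \<in> Basis" for b
            using Basis_le_norm[OF that, of x] N elim by simp
          then have "x \<in> ?B n" by (auto simp: mem_box abs_less_iff) (smt (verit))+
          then show ?case by simp
        qed
      qed
    qed (use gi in \<open>auto simp: indicator_def\<close>)
    then show ?thesis unfolding gbox using LIMSEQ_unique tendsto_const by blast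
  qed
  have "(\<integral>x. indicator A x * g x \<partial>lborel) = 0" if "A \<in> sets borel" for A
  proof -
    have "sets borel = sigma_sets UNIV (range (\<lambda>(a, b). box a b :: 'a set))"
      by (subst borel_eq_box) (simp add: sets_measure_of_conv)
    have "Int_stable (range (\<lambda>(a, b). box a b :: 'a set))" by (auto simp: Int_stable_def box_Int_box)
    moreover have "range (\<lambda>(a, b). box a b :: 'a set) \<subseteq> Pow UNIV" by simp
    moreover have "A \<in> sigma_sets UNIV (range (\<lambda>(a, b). box a b))"
      using that \<open>sets borel = _\<close> by simp
    ultimately show ?thesis
    proof (induct rule: sigma_sets_induct_disjoint)
      case (basic A)
      then show ?case using gbox by auto
    next
      case empty
      show ?case by simp
    next
      case (compl A)
      then have A: "A \<in> sets borel" by (simp add: \<open>sets borel = _\<close>)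
      have "(\<integral>x. indicator (UNIV - A) x * g x \<partial>lborel) = (\<integral>x. g x - indicator A x * g x \<partial>lborel)"
        by (intro Bochner_Integration.integral_cong) (auto simp: indicator_def)
      also have "\<dots> = 0" using gi gA[OF A] compl gU by simp
      finally show ?case .
    next
      case (union A)
      then have A: "A i \<in> sets borel" for i by (auto simp: \<open>sets borel = _\<close>)
      have "(LINT x:(\<Union>i. A i)|lborel. g x) = (\<Sum>i. (LINT x:(A i)|lborel. g x))"
        using union(1) A gA by (intro lebesgue_integral_countable_add)
          (auto simp: disjoint_family_on_def set_integrable_def intro!: gA sets.countable_UN)
      then show ?case using union by (simp add: set_lebesgue_integral_def)
    qed
  qed
  then have "AE x in lborel. g x = 0"
    using density_unique_real[OF gi, of "\<lambda>_. 0"] by (simp add: set_lebesgue_integral_def)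
  then have "AE x in lebesgue. g x = 0" by (rule AE_completion)
  with fg' show ?thesis by eventually_elim simp
qed

section \<open>Half-space integrals and integration of derivatives in one direction\<close>

lemma open_half_space: "open (half_space :: ((real^'m) \<times> real) set)"
  unfolding half_space_def by (intro open_Collect_less continuous_intros)

lemma half_space_borel [measurable, simp]: "(half_space :: ((real^'m) \<times> real) set) \<in> sets borel"
  by (rule borel_open[OF open_half_space])

lemma integral_half_space:
  fixes f :: "(real^'m) \<times> real \<Rightarrow> 'b::{banach, second_countable_topology}"
  shows "(\<integral>x. f x \<partial>lebesgue_on half_space) = (\<integral>x. indicator half_space x *\<^sub>R f x \<partial>lebesgue)"
    and "integrable (lebesgue_on half_space) f \<longleftrightarrow> integrable lebesgue (\<lambda>x. indicator half_space x *\<^sub>R f x)"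
  by (auto simp: integral_restrict_space integrable_restrict_space)

lemma integral_half_space_lborel:
  fixes f :: "(real^'m) \<times> real \<Rightarrow> 'b::euclidean_space"
  assumes "continuous_on half_space f"
  shows "(\<integral>x. f x \<partial>lebesgue_on half_space) = (\<integral>x. indicator half_space x *\<^sub>R f x \<partial>lborel)"
    and "integrable (lebesgue_on half_space) f \<longleftrightarrow> integrable lborel (\<lambda>x. indicator half_space x *\<^sub>R f x)"
proof -
  have m: "(\<lambda>x. indicator half_space x *\<^sub>R f x) \<in> borel_measurable lborel"
    using assms by (simp add: borel_measurable_continuous_on_indicator)
  show "(\<integral>x. f x \<partial>lebesgue_on half_space) = (\<integral>x. indicator half_space x *\<^sub>R f x \<partial>lborel)"
    unfolding integral_half_space by (rule integral_completion[OF m])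
  show "integrable (lebesgue_on half_space) f \<longleftrightarrow> integrable lborel (\<lambda>x. indicator half_space x *\<^sub>R f x)"
    unfolding integral_half_space by (rule integrable_completion[OF m])
qed

abbreviation closed_half_space :: "((real^'m) \<times> real) set" where
  "closed_half_space \<equiv> {x. snd x \<ge> 0}"

lemma half_space_subset: "half_space \<subseteq> closed_half_space"
  by (auto simp: half_space_def)

lemma integrable_compact_support_half_space:
  fixes f :: "(real^'m) \<times> real \<Rightarrow> 'b::euclidean_space"
  assumes c: "continuous_on closed_half_space f" and B: "\<And>x. norm x > B \<Longrightarrow> f x = 0"
  shows "integrable lborel (\<lambda>x. indicator half_space x *\<^sub>R f x)"
    and "integrable (lebesgue_on half_space) f"
proof -
  let ?S = "closed_half_space \<inter> cball 0 B :: ((real^'m) \<times> real) set"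
  have "closed (closed_half_space :: ((real^'m) \<times> real) set)" by (intro closed_Collect_le continuous_intros)
  then have "compact ?S" by (intro closed_Int_compact) auto
  then have "integrable lborel (\<lambda>x. indicator ?S x *\<^sub>R f x)"
    by (rule borel_integrable_compact) (rule continuous_on_subset[OF c], auto)
  then have "integrable lborel (\<lambda>x. indicator half_space x *\<^sub>R (indicator ?S x *\<^sub>R f x))"
    by (rule integrable_mult_indicator[rotated]) simp
  also have "(\<lambda>x. indicator half_space x *\<^sub>R (indicator ?S x *\<^sub>R f x)) = (\<lambda>x. indicator half_space x *\<^sub>R f x)"
    using B half_space_subset by (force simp: indicator_def fun_eq_iff not_le)
  finally show "integrable lborel (\<lambda>x. indicator half_space x *\<^sub>R f x)" .
  then show "integrable (lebesgue_on half_space) f"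
    by (subst integral_half_space_lborel) (auto intro: continuous_on_subset[OF c half_space_subset])
qed

text \<open>Translations along \<open>b\<close> preserve the half-space, so every difference
  quotient of the function extended by 0 has integral 0, and dominated convergence passes this to
  the derivative. This treats all tangential directions alike, without splitting the measure into
  coordinates.\<close>

lemma integral_tangential_derivative:
  fixes f f' :: "(real^'m) \<times> real \<Rightarrow> real"
  assumes der: "\<And>x. x \<in> half_space \<Longrightarrow> ((\<lambda>s. f (x + s *\<^sub>R b)) has_real_derivative f' x) (at 0)"
    and b: "snd b = 0"
    and c: "continuous_on closed_half_space f" "continuous_on closed_half_space f'"
    and B: "\<And>x. norm x > B \<Longrightarrow> f x = 0" "\<And>x. norm x > B \<Longrightarrow> f' x = 0"
  shows "(\<integral>x. f' x \<partial>lebesgue_on half_space) = 0"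
proof -
  define F where "F = (\<lambda>x. indicator half_space x * f x)"
  define F' where "F' = (\<lambda>x. indicator half_space x * f' x)"
  have iF: "integrable lborel F" and iF': "integrable lborel F'"
    unfolding F_def F'_def
    using integrable_compact_support_half_space(1)[OF c(1) B(1)]
      integrable_compact_support_half_space(1)[OF c(2) B(2)] by simp_all
  have hs: "x + s *\<^sub>R b \<in> half_space \<longleftrightarrow> x \<in> half_space" for x s
    using b by (simp add: half_space_def)
  have dF: "((\<lambda>s. F (x + s *\<^sub>R b)) has_real_derivative F' (x + s *\<^sub>R b)) (at s)" for x s
  proof (cases "x \<in> half_space")
    case True
    have "((\<lambda>h. f ((x + s *\<^sub>R b) + h *\<^sub>R b)) has_real_derivative f' (x + s *\<^sub>R b)) (at 0)"
      using True by (intro der) (simp add: hs)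
    then have "((\<lambda>h. f ((x + s *\<^sub>R b) + (h - s) *\<^sub>R b)) has_real_derivative f' (x + s *\<^sub>R b)) (at s)"
      using DERIV_shift[of "\<lambda>h. f ((x + s *\<^sub>R b) + (h - s) *\<^sub>R b)" "f' (x + s *\<^sub>R b)" 0 s] by simp
    then show ?thesis using True by (simp add: F_def F'_def hs algebra_simps)
  next
    case False
    then show ?thesis by (simp add: F_def F'_def hs)
  qed
  obtain M where M: "M \<ge> 0" "\<And>x. \<bar>F' x\<bar> \<le> M"
  proof -
    let ?S = "closed_half_space \<inter> cball 0 B :: ((real^'m) \<times> real) set"
    have "closed (closed_half_space :: ((real^'m) \<times> real) set)" by (intro closed_Collect_le continuous_intros)
    then have "compact ?S" by (intro closed_Int_compact) auto
    then have "compact (f' ` ?S)" by (intro compact_continuous_image continuous_on_subset[OF c(2)]) auto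
    then obtain M where M: "M > 0" "\<forall>y\<in>f' ` ?S. norm y \<le> M"
      using compact_imp_bounded bounded_pos by metis
    have "\<bar>F' x\<bar> \<le> M" for x
      using M B(2)[of x] half_space_subset unfolding F'_def
      by (cases "x \<in> half_space"; cases "norm x \<le> B") (auto simp: not_le)
    with M(1) show thesis by (intro that[of M]) auto
  qed
  define q where "q = (\<lambda>k x. real (Suc k) * (F (x + (1 / real (Suc k)) *\<^sub>R b) - F x))"
  have lim: "(\<lambda>k. q k x) \<longlonglongrightarrow> F' x" for x
  proof -
    have "((\<lambda>h. (F (x + h *\<^sub>R b) - F x) / h) \<longlongrightarrow> F' x) (at 0)"
      using dF[of x 0] by (simp add: DERIV_def)
    moreover have "filterlim (\<lambda>k. 1 / real (Suc k)) (at 0) sequentially"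
      by (intro filterlim_atI lim_inverse_n'[THEN LIMSEQ_Suc]) auto
    ultimately have "(\<lambda>k. (F (x + (1 / real (Suc k)) *\<^sub>R b) - F x) / (1 / real (Suc k))) \<longlonglongrightarrow> F' x"
      by (rule filterlim_compose)
    then show ?thesis by (simp add: q_def mult.commute)
  qed
  have F0: "F x = 0" if "norm x > B" for x using B(1)[OF that] by (simp add: F_def)
  have bound: "\<bar>q k x\<bar> \<le> M * indicator (cball 0 (B + norm b)) x" for k x
  proof (cases "norm x \<le> B + norm b")
    case True
    \<comment> \<open>The mean value theorem bounds the quotient by the supremum of the derivative;
      since the step is at most 1, the quotient is supported within \<open>norm b\<close> of the
      support of \<open>F\<close>.\<close>
    have "\<exists>s. 0 < s \<and> s < 1 / real (Suc k) \<and>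
       F (x + (1 / real (Suc k)) *\<^sub>R b) - F (x + 0 *\<^sub>R b) = (1 / real (Suc k) - 0) * F' (x + s *\<^sub>R b)"
      by (rule MVT2) (use dF in auto)
    then obtain s where "F (x + (1 / real (Suc k)) *\<^sub>R b) - F x = 1 / real (Suc k) * F' (x + s *\<^sub>R b)"
      by auto
    then have "q k x = F' (x + s *\<^sub>R b)" by (simp add: q_def)
    then show ?thesis using True M(2) by simp
  next
    case False
    have "norm ((1 / real (Suc k)) *\<^sub>R b) \<le> norm b"
      by (simp add: divide_simps) (simp add: algebra_simps)
    then have "norm (x + (1 / real (Suc k)) *\<^sub>R b) > B"
      using False norm_diff_ineq[of x "(1 / real (Suc k)) *\<^sub>R b"] by linarith
    moreover have "norm x > B" using False norm_ge_zero[of b] by linarith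
    ultimately show ?thesis using F0 False by (simp add: q_def)
  qed
  have int0: "(\<integral>x. q k x \<partial>lborel) = 0" for k
  proof -
    let ?c = "(1 / real (Suc k)) *\<^sub>R b"
    have i: "integrable lborel (\<lambda>x. F (?c + x))" and e: "(\<integral>x. F (?c + x) \<partial>lborel) = (\<integral>x. F x \<partial>lborel)"
    proof -
      have d: "distr lborel borel ((+) ?c) = lborel" by (rule lborel_distr_plus)
      have m: "F \<in> borel_measurable borel" using iF by auto
      show "integrable lborel (\<lambda>x. F (?c + x))"
        using iF by (subst (asm) d[symmetric], subst (asm) integrable_distr_eq) (auto simp: m)
      have "(\<integral>x. F x \<partial>lborel) = (\<integral>x. F x \<partial>(distr lborel borel ((+) ?c)))" by (simp only: d)
      also have "\<dots> = (\<integral>x. F (?c + x) \<partial>lborel)" by (rule integral_distr[OF _ m]) simp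
      finally show "(\<integral>x. F (?c + x) \<partial>lborel) = (\<integral>x. F x \<partial>lborel)" by (rule sym)
    qed
    have "(\<integral>x. q k x \<partial>lborel) = real (Suc k) * (\<integral>x. F (?c + x) - F x \<partial>lborel)"
      unfolding q_def by (subst integral_mult_right_zero) (simp add: add.commute)
    also have "\<dots> = 0" by (subst Bochner_Integration.integral_diff[OF i iF]) (simp only: e, simp)
    finally show ?thesis .
  qed
  have mF: "F \<in> borel_measurable borel" using iF by auto
  have "(\<lambda>k. \<integral>x. q k x \<partial>lborel) \<longlonglongrightarrow> (\<integral>x. F' x \<partial>lborel)"
  proof (rule integral_dominated_convergence[where w="\<lambda>x. M * indicator (cball 0 (B + norm b)) x"])
    show "q k \<in> borel_measurable lborel" for k
      unfolding q_def using mF by simp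
    show "integrable lborel (\<lambda>x::(real^'m) \<times> real. M * indicator (cball 0 (B + norm b)) x)"
      using emeasure_bounded_finite[OF bounded_cball, of "0 :: (real^'m) \<times> real" "B + norm b"]
      by (intro integrable_mult_right integrable_real_indicator) auto
  qed (use lim bound iF' in auto)
  then have "(\<integral>x. F' x \<partial>lborel) = 0" unfolding int0 using LIMSEQ_unique tendsto_const by blast
  then show ?thesis
    by (subst integral_half_space_lborel) (auto intro: continuous_on_subset[OF c(2) half_space_subset] simp: F'_def)
qed

text \<open>Fubini splits off the last coordinate, and on each vertical line the fundamental theorem
  is applied on \<open>{0..b}\<close> with \<open>b\<close> beyond the support. Only the lower
  endpoint contributes, hence the minus sign.\<close>

lemma integral_normal_derivative:
  fixes f f' :: "(real^'m) \<times> real \<Rightarrow> real"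
  assumes der: "\<And>x. snd x \<ge> 0 \<Longrightarrow> ((\<lambda>s. f (x + s *\<^sub>R (0, 1))) has_real_derivative f' x) (at 0)"
    and c: "continuous_on closed_half_space f'"
    and B: "\<And>x. norm x > B \<Longrightarrow> f x = 0" "\<And>x. norm x > B \<Longrightarrow> f' x = 0"
  shows "(\<integral>x. f' x \<partial>lebesgue_on half_space) = - (\<integral>y. f (y, 0) \<partial>lborel)"
proof -
  let ?F = "\<lambda>x. indicator half_space x * f' x"
  have iF: "integrable lborel ?F"
    using integrable_compact_support_half_space(1)[OF c B(2)] by simp
  have inner: "(\<integral>t. ?F (y, t) \<partial>lborel) = - f (y, 0)" for y :: "real^'m"
  proof -
    define b where "b = max 0 B + 1"
    have b: "b > 0" "b > B" by (auto simp: b_def)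
    have nt: "norm (y, t) > B" if "t \<ge> b" for t
      using b that norm_snd_le[of t y] by simp
    have d: "((\<lambda>t. f (y, t)) has_real_derivative f' (y, t)) (at t)" if "t \<ge> 0" for t
      using der[of "(y, t)"] that DERIV_shift[of "\<lambda>h. f (y, h)" "f' (y, t)" 0 t] by (simp add: add.commute)
    have "has_bochner_integral lborel (\<lambda>t. indicator {0..b} t *\<^sub>R f' (y, t)) (f (y, b) - f (y, 0))"
    proof (rule has_bochner_integral_FTC_Icc)
      show "((\<lambda>t. f (y, t)) has_vector_derivative f' (y, t)) (at t within {0..b})" if "0 \<le> t" "t \<le> b" for t
        using d[OF that(1)] has_field_derivative_at_within has_real_derivative_iff_has_vector_derivative by blast
      show "continuous_on {0..b} (\<lambda>t. f' (y, t))"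
        by (rule continuous_on_compose2[OF c]) (auto intro!: continuous_intros)
    qed (use b in auto)
    then have "(\<integral>t. indicator {0..b} t *\<^sub>R f' (y, t) \<partial>lborel) = f (y, b) - f (y, 0)"
      by (rule has_bochner_integral_integral_eq)
    also have "f (y, b) = 0" using B(1)[OF nt] by simp
    also have "(\<integral>t. indicator {0..b} t *\<^sub>R f' (y, t) \<partial>lborel) = (\<integral>t. ?F (y, t) \<partial>lborel)"
    proof (rule integral_cong_AE)
      show "(\<lambda>t. ?F (y, t)) \<in> borel_measurable lborel"
        using borel_measurable_integrable[OF iF] by simp
      have "continuous_on {0..b} (\<lambda>t. f' (y, t))"
        by (rule continuous_on_compose2[OF c]) (auto intro!: continuous_intros)
      then show "(\<lambda>t. indicator {0..b} t *\<^sub>R f' (y, t)) \<in> borel_measurable lborel"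
        using borel_measurable_continuous_on_indicator[of "{0..b}" "\<lambda>t. f' (y, t)"] by simp
      show "AE t in lborel. indicator {0..b} t *\<^sub>R f' (y, t) = ?F (y, t)"
        using AE_lborel_singleton[of 0]
      proof eventually_elim
        case (elim t)
        then show ?case using B(2)[OF nt, of t] by (auto simp: indicator_def half_space_def)
      qed
    qed
    finally show ?thesis by simp
  qed
  have "(\<integral>x. f' x \<partial>lebesgue_on half_space) = (\<integral>x. ?F x \<partial>lborel)"
    by (subst integral_half_space_lborel) (auto intro: continuous_on_subset[OF c half_space_subset])
  also have "\<dots> = (\<integral>x. ?F x \<partial>(lborel \<Otimes>\<^sub>M lborel))" by (simp add: lborel_prod)
  also have "\<dots> = (\<integral>y. (\<integral>t. ?F (y, t) \<partial>lborel) \<partial>lborel)"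
    using lborel_pair.integral_fst'[of ?F] iF by (simp add: lborel_prod)
  also have "\<dots> = - (\<integral>y. f (y, 0) \<partial>lborel)" by (simp add: inner)
  finally show ?thesis .
qed

section \<open>Green's formula\<close>

text \<open>Gradient and Laplacian are carried along as explicit functions, so that product and
  chain rules compute both by formula. Continuity is imposed on the diagonal second derivatives, the
  ones that the divergence theorem integrates.\<close>

definition lap_on :: "'a::euclidean_space set \<Rightarrow> ('a \<Rightarrow> real) \<Rightarrow> ('a \<Rightarrow> 'a) \<Rightarrow> ('a \<Rightarrow> real) \<Rightarrow> bool" where
  "lap_on S f G l \<longleftrightarrow> (\<forall>x\<in>S. (f has_derivative (\<lambda>h. G x \<bullet> h)) (at x)) \<and>
     (\<exists>G'. (\<forall>x\<in>S. (G has_derivative G' x) (at x)) \<and> (\<forall>b\<in>Basis. continuous_on S (\<lambda>x. G' x b \<bullet> b))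
       \<and> (\<forall>x\<in>S. l x = (\<Sum>b\<in>Basis. G' x b \<bullet> b)))"

lemma lap_onD:
  assumes "lap_on S f G l"
  shows lap_on_has_derivative: "x \<in> S \<Longrightarrow> (f has_derivative (\<lambda>h. G x \<bullet> h)) (at x)"
    and lap_on_continuous: "continuous_on S f"
    and lap_on_continuous_gradient: "continuous_on S G"
    and lap_on_continuous_laplacian: "continuous_on S l"
proof -
  obtain G' where *: "\<forall>x\<in>S. (f has_derivative (\<lambda>h. G x \<bullet> h)) (at x)" "\<forall>x\<in>S. (G has_derivative G' x) (at x)"
     "\<forall>b\<in>Basis. continuous_on S (\<lambda>x. G' x b \<bullet> b)" "\<forall>x\<in>S. l x = (\<Sum>b\<in>Basis. G' x b \<bullet> b)"
    using assms unfolding lap_on_def by blast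
  show "x \<in> S \<Longrightarrow> (f has_derivative (\<lambda>h. G x \<bullet> h)) (at x)" using * by blast
  show "continuous_on S f" "continuous_on S G"
    using * has_derivative_continuous by (blast intro: continuous_at_imp_continuous_on)+
  have "continuous_on S (\<lambda>x. \<Sum>b\<in>Basis. G' x b \<bullet> b)" using * by (intro continuous_on_sum) auto
  then show "continuous_on S l" using *(4) by (subst continuous_on_cong[OF refl]) auto
qed

lemma lap_on_cong:
  assumes "lap_on S f G l" "open S"
    and "\<And>x. x \<in> S \<Longrightarrow> f x = f2 x" "\<And>x. x \<in> S \<Longrightarrow> G x = G2 x" "\<And>x. x \<in> S \<Longrightarrow> l x = l2 x"
  shows "lap_on S f2 G2 l2"
proof -
  obtain G' where *: "\<forall>x\<in>S. (f has_derivative (\<lambda>h. G x \<bullet> h)) (at x)" "\<forall>x\<in>S. (G has_derivative G' x) (at x)"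
     "\<forall>b\<in>Basis. continuous_on S (\<lambda>x. G' x b \<bullet> b)" "\<forall>x\<in>S. l x = (\<Sum>b\<in>Basis. G' x b \<bullet> b)"
    using assms(1) unfolding lap_on_def by blast
  have "(f2 has_derivative (\<lambda>h. G2 x \<bullet> h)) (at x)" if "x \<in> S" for x
    using has_derivative_transform_within_open[OF _ assms(2) that, of f "\<lambda>h. G2 x \<bullet> h" UNIV f2]
      *(1) assms(3,4) that by simp
  moreover have "(G2 has_derivative G' x) (at x)" if "x \<in> S" for x
    using has_derivative_transform_within_open[OF _ assms(2) that, of G "G' x" UNIV G2]
      *(2) assms(4) that by simp
  ultimately show ?thesis
    unfolding lap_on_def using *(3,4) assms(5) by (intro conjI exI[of _ G']) auto
qed

lemma lap_on_mult:
  assumes "lap_on S f F lf" "lap_on S g G lg"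
  shows "lap_on S (\<lambda>x. f x * g x) (\<lambda>x. f x *\<^sub>R G x + g x *\<^sub>R F x)
    (\<lambda>x. f x * lg x + g x * lf x + 2 * (F x \<bullet> G x))"
proof -
  obtain F' where F: "\<forall>x\<in>S. (f has_derivative (\<lambda>h. F x \<bullet> h)) (at x)" "\<forall>x\<in>S. (F has_derivative F' x) (at x)"
     "\<forall>b\<in>Basis. continuous_on S (\<lambda>x. F' x b \<bullet> b)" "\<forall>x\<in>S. lf x = (\<Sum>b\<in>Basis. F' x b \<bullet> b)"
    using assms(1) unfolding lap_on_def by blast
  obtain G' where G: "\<forall>x\<in>S. (g has_derivative (\<lambda>h. G x \<bullet> h)) (at x)" "\<forall>x\<in>S. (G has_derivative G' x) (at x)"
     "\<forall>b\<in>Basis. continuous_on S (\<lambda>x. G' x b \<bullet> b)" "\<forall>x\<in>S. lg x = (\<Sum>b\<in>Basis. G' x b \<bullet> b)"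
    using assms(2) unfolding lap_on_def by blast
  note c = lap_on_continuous[OF assms(1)] lap_on_continuous[OF assms(2)]
    lap_on_continuous_gradient[OF assms(1)] lap_on_continuous_gradient[OF assms(2)]
  define H' where "H' = (\<lambda>x h. f x *\<^sub>R G' x h + (F x \<bullet> h) *\<^sub>R G x + (g x *\<^sub>R F' x h + (G x \<bullet> h) *\<^sub>R F x))"
  have diag: "H' x b \<bullet> b = f x * (G' x b \<bullet> b) + g x * (F' x b \<bullet> b) + 2 * ((F x \<bullet> b) * (G x \<bullet> b))" for x b
    unfolding H'_def by (simp add: inner_add_left)
  show ?thesis unfolding lap_on_def
  proof (intro conjI exI[of _ H'] ballI)
    fix x assume x: "x \<in> S"
    have f: "(f has_derivative (\<lambda>h. F x \<bullet> h)) (at x)" and g: "(g has_derivative (\<lambda>h. G x \<bullet> h)) (at x)"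
      and F': "(F has_derivative F' x) (at x)" and G': "(G has_derivative G' x) (at x)"
      using F G x by auto
    show "((\<lambda>x. f x * g x) has_derivative (\<lambda>h. (f x *\<^sub>R G x + g x *\<^sub>R F x) \<bullet> h)) (at x)"
      using has_derivative_mult[OF f g] by (simp add: inner_add_left mult.commute)
    show "((\<lambda>x. f x *\<^sub>R G x + g x *\<^sub>R F x) has_derivative H' x) (at x)"
      unfolding H'_def
      by (intro has_derivative_add has_derivative_scaleR f g F' G')
    show "f x * lg x + g x * lf x + 2 * (F x \<bullet> G x) = (\<Sum>b\<in>Basis. H' x b \<bullet> b)"
      unfolding diag using F(4) G(4) x
      by (simp add: sum.distrib sum_distrib_left euclidean_inner[of "F x" "G x"])
  next
    fix b :: 'a assume "b \<in> Basis"
    then have "continuous_on S (\<lambda>x. F' x b \<bullet> b)" "continuous_on S (\<lambda>x. G' x b \<bullet> b)"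
      using F(3) G(3) by auto
    moreover have "continuous_on S (\<lambda>x. F x \<bullet> b)" "continuous_on S (\<lambda>x. G x \<bullet> b)"
      by (intro continuous_intros c)+
    ultimately show "continuous_on S (\<lambda>x. H' x b \<bullet> b)"
      unfolding diag by (intro continuous_on_add continuous_on_mult continuous_on_const c)
  qed
qed

lemma lap_on_chain:
  fixes h h' h'' :: "real \<Rightarrow> real"
  assumes "lap_on S f F lf"
    and h: "\<And>x. x \<in> S \<Longrightarrow> (h has_real_derivative h' (f x)) (at (f x))"
    and h': "\<And>x. x \<in> S \<Longrightarrow> (h' has_real_derivative h'' (f x)) (at (f x))"
    and h'': "continuous_on (f ` S) h''"
  shows "lap_on S (\<lambda>x. h (f x)) (\<lambda>x. h' (f x) *\<^sub>R F x) (\<lambda>x. h' (f x) * lf x + h'' (f x) * (F x \<bullet> F x))"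
proof -
  obtain F' where F: "\<forall>x\<in>S. (f has_derivative (\<lambda>h. F x \<bullet> h)) (at x)" "\<forall>x\<in>S. (F has_derivative F' x) (at x)"
     "\<forall>b\<in>Basis. continuous_on S (\<lambda>x. F' x b \<bullet> b)" "\<forall>x\<in>S. lf x = (\<Sum>b\<in>Basis. F' x b \<bullet> b)"
    using assms(1) unfolding lap_on_def by blast
  note c = lap_on_continuous[OF assms(1)] lap_on_continuous_gradient[OF assms(1)]
  define H' where "H' = (\<lambda>x k. h' (f x) *\<^sub>R F' x k + (h'' (f x) * (F x \<bullet> k)) *\<^sub>R F x)"
  have diag: "H' x b \<bullet> b = h' (f x) * (F' x b \<bullet> b) + h'' (f x) * ((F x \<bullet> b) * (F x \<bullet> b))" for x b
    unfolding H'_def by (simp add: inner_add_left)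
  have ch': "continuous_on (f ` S) h'"
    using h' DERIV_isCont by (auto intro!: continuous_at_imp_continuous_on)
  have d: "((\<lambda>x. k (f x)) has_derivative (\<lambda>y. k' * (F x \<bullet> y))) (at x)"
    if "x \<in> S" "(k has_real_derivative k') (at (f x))" for x k k'
    using has_derivative_compose[of f "\<lambda>y. F x \<bullet> y" x UNIV k "(*) k'"] F(1) that
    by (simp add: has_field_derivative_def)
  show ?thesis unfolding lap_on_def
  proof (intro conjI exI[of _ H'] ballI)
    fix x assume x: "x \<in> S"
    show "((\<lambda>x. h (f x)) has_derivative (\<lambda>k. (h' (f x) *\<^sub>R F x) \<bullet> k)) (at x)"
      using d[OF x h[OF x]] by simp
    show "((\<lambda>x. h' (f x) *\<^sub>R F x) has_derivative H' x) (at x)"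
      unfolding H'_def using F(2) x by (intro has_derivative_scaleR d[OF x h'[OF x]]) auto
    show "h' (f x) * lf x + h'' (f x) * (F x \<bullet> F x) = (\<Sum>b\<in>Basis. H' x b \<bullet> b)"
      unfolding diag using F(4) x
      by (simp add: sum.distrib sum_distrib_left euclidean_inner[of "F x" "F x"])
  next
    fix b :: 'a assume "b \<in> Basis"
    then have "continuous_on S (\<lambda>x. F' x b \<bullet> b)" using F(3) by auto
    moreover have "continuous_on S (\<lambda>x. F x \<bullet> b)" by (intro continuous_intros c)
    moreover have "continuous_on S (\<lambda>x. h' (f x))" "continuous_on S (\<lambda>x. h'' (f x))"
      by (rule continuous_on_compose2[OF _ c(1)], use ch' h'' in auto)+
    ultimately show "continuous_on S (\<lambda>x. H' x b \<bullet> b)"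
      unfolding diag by (intro continuous_on_add continuous_on_mult)
  qed
qed

lemma lap_on_quadratic:
  fixes w :: "'a::euclidean_space"
  shows "lap_on S (\<lambda>x. \<alpha> * (norm x)\<^sup>2 + w \<bullet> x + \<gamma>) (\<lambda>x. (2 * \<alpha>) *\<^sub>R x + w) (\<lambda>_. 2 * \<alpha> * real DIM('a))"
  unfolding lap_on_def
  by (intro conjI exI[of _ "\<lambda>_ h. (2 * \<alpha>) *\<^sub>R h"] ballI)
     (auto intro!: derivative_eq_intros simp: power2_norm_eq_inner inner_add_left inner_commute algebra_simps)

lemma lap_on_power:
  assumes "lap_on S f F lf"
  shows "lap_on S (\<lambda>x. f x ^ p) (\<lambda>x. (real p * f x ^ (p - 1)) *\<^sub>R F x)
    (\<lambda>x. real p * f x ^ (p - 1) * lf x + real p * real (p - 1) * f x ^ (p - 2) * (F x \<bullet> F x))"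
  by (rule lap_on_chain[OF assms, where h="\<lambda>x. x ^ p" and h'="\<lambda>x. real p * x ^ (p - 1)"
        and h''="\<lambda>x. real p * real (p - 1) * x ^ (p - 2)"])
     (auto intro!: derivative_eq_intros continuous_intros simp: numeral_2_eq_2)

lemma Basis_half_space_split:
  "sum h (Basis :: ((real^'m) \<times> real) set) = (\<Sum>u\<in>Basis. h (u, 0)) + h (0, 1)"
  by (subst Basis_prod_def, subst sum.union_disjoint)
     (auto simp: sum.reindex inj_on_def)

text \<open>The vector field \<open>\<psi> * G\<close> has compact support because
  \<open>\<psi>\<close> has, so each of its components can be differentiated and integrated in its
  own basis direction. Tangential directions give 0, and the last one gives the boundary integral
  with the interior normal \<open>(0, 1)\<close>.\<close>

lemma green_half_space:
  fixes \<psi> :: "(real^'m) \<times> real \<Rightarrow> real"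
  assumes \<psi>: "C1_compact \<psi>" and \<phi>: "lap_on S \<phi> G l" and S: "closed_half_space \<subseteq> S"
  shows "(\<integral>x. gradient \<psi> x \<bullet> G x \<partial>lebesgue_on half_space)
    = - (\<integral>x. \<psi> x * l x \<partial>lebesgue_on half_space) - (\<integral>y. \<psi> (y, 0) * (G (y, 0) \<bullet> (0, 1)) \<partial>lborel)"
proof -
  obtain G' where G: "\<forall>x\<in>S. (G has_derivative G' x) (at x)"
     "\<forall>b\<in>Basis. continuous_on S (\<lambda>x. G' x b \<bullet> b)" "\<forall>x\<in>S. l x = (\<Sum>b\<in>Basis. G' x b \<bullet> b)"
    using \<phi> unfolding lap_on_def by blast
  obtain B where B: "\<And>x. norm x > B \<Longrightarrow> \<psi> x = 0" "\<And>x. norm x > B \<Longrightarrow> gradient \<psi> x = 0"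
    by (rule C1_compact_bounded_support[OF \<psi>]) blast
  note cont = C1_compact_continuous[OF \<psi>] C1_compact_continuous_gradient[OF \<psi>]
    continuous_on_subset[OF lap_on_continuous_gradient[OF \<phi>] S]
    continuous_on_subset[OF lap_on_continuous_laplacian[OF \<phi>] S]
  define f where "f = (\<lambda>b x. \<psi> x * (G x \<bullet> b))"
  define f' where "f' = (\<lambda>b x. (gradient \<psi> x \<bullet> b) * (G x \<bullet> b) + \<psi> x * (G' x b \<bullet> b))"
  have der: "((\<lambda>s. f b (x + s *\<^sub>R b)) has_real_derivative f' b x) (at 0)" if x: "snd x \<ge> 0" for b x
  proof -
    have "x \<in> S" using S x by auto
    then have Gd: "(G has_derivative G' x) (at x)" using G by blast
    have "(f b has_derivative (\<lambda>h. (gradient \<psi> x \<bullet> h) * (G x \<bullet> b) + \<psi> x * (G' x h \<bullet> b))) (at x)"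
      unfolding f_def
      using has_derivative_mult[OF C1_compact_has_derivative[OF \<psi>, of x] has_derivative_inner_left[OF Gd, of b]]
      by (simp add: add.commute mult.commute)
    moreover have "((\<lambda>s. x + s *\<^sub>R b) has_derivative (\<lambda>s. s *\<^sub>R b)) (at (0::real))"
      by (auto intro!: derivative_eq_intros)
    ultimately have "((\<lambda>s. f b (x + s *\<^sub>R b)) has_derivative
        (\<lambda>s. (gradient \<psi> x \<bullet> (s *\<^sub>R b)) * (G x \<bullet> b) + \<psi> x * (G' x (s *\<^sub>R b) \<bullet> b))) (at 0)"
      using has_derivative_compose[of "\<lambda>s. x + s *\<^sub>R b" "\<lambda>s. s *\<^sub>R b" 0 UNIV "f b"
        "\<lambda>h. (gradient \<psi> x \<bullet> h) * (G x \<bullet> b) + \<psi> x * (G' x h \<bullet> b)"] by simp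
    moreover have "G' x (s *\<^sub>R b) = s *\<^sub>R G' x b" for s
      using Gd has_derivative_linear linear_scale by blast
    ultimately show ?thesis
      unfolding has_field_derivative_def f'_def
      by (elim has_derivative_eq_rhs) (simp add: fun_eq_iff algebra_simps)
  qed
  have supp: "f b x = 0" "f' b x = 0" if "norm x > B" for b x
    using B[OF that] by (auto simp: f_def f'_def)
  have cf: "continuous_on closed_half_space (f b)" for b
    unfolding f_def by (intro continuous_intros cont)
  have cf': "continuous_on closed_half_space (f' b)" if "b \<in> Basis" for b
  proof -
    have "continuous_on closed_half_space (\<lambda>x. G' x b \<bullet> b)"
      using G(2) that continuous_on_subset[OF _ S] by blast
    moreover have "continuous_on closed_half_space (\<lambda>x. gradient \<psi> x \<bullet> b)"
        "continuous_on closed_half_space (\<lambda>x. G x \<bullet> b)"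
      by (intro continuous_intros cont)+
    ultimately show ?thesis unfolding f'_def by (intro continuous_on_add continuous_on_mult cont)
  qed
  have int: "integrable (lebesgue_on half_space) (f' b)" if "b \<in> Basis" for b
    by (rule integrable_compact_support_half_space(2)[OF cf'[OF that] supp(2)])
  have e1: "(0, 1) \<in> (Basis :: ((real^'m) \<times> real) set)" by (simp add: Basis_prod_def)
  have tan: "(\<integral>x. f' (u, 0) x \<partial>lebesgue_on half_space) = 0" if "u \<in> Basis" for u :: "real^'m"
    by (rule integral_tangential_derivative[OF der _ cf cf' supp])
       (use that in \<open>auto simp: half_space_def Basis_prod_def\<close>)
  have nor: "(\<integral>x. f' (0, 1) x \<partial>lebesgue_on half_space) = - (\<integral>y. f (0, 1) (y, 0) \<partial>lborel)"
    by (rule integral_normal_derivative[OF der cf'[OF e1] supp]) auto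
  have "(\<integral>x. gradient \<psi> x \<bullet> G x + \<psi> x * l x \<partial>lebesgue_on half_space)
     = (\<integral>x. (\<Sum>b\<in>Basis. f' b x) \<partial>lebesgue_on half_space)"
  proof (rule Bochner_Integration.integral_cong[OF refl])
    fix x :: "(real^'m) \<times> real" assume "x \<in> space (lebesgue_on half_space)"
    then have "x \<in> S" using S by (auto simp: half_space_def)
    then show "gradient \<psi> x \<bullet> G x + \<psi> x * l x = (\<Sum>b\<in>Basis. f' b x)"
      using G(3) by (simp add: f'_def sum.distrib sum_distrib_left euclidean_inner[of "gradient \<psi> x" "G x"])
  qed
  also have "\<dots> = (\<Sum>b\<in>Basis. \<integral>x. f' b x \<partial>lebesgue_on half_space)"
    by (rule Bochner_Integration.integral_sum) (rule int)
  also have "\<dots> = - (\<integral>y. f (0, 1) (y, 0) \<partial>lborel)"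
    unfolding Basis_half_space_split using tan nor by simp
  finally have "(\<integral>x. gradient \<psi> x \<bullet> G x + \<psi> x * l x \<partial>lebesgue_on half_space) = - (\<integral>y. f (0, 1) (y, 0) \<partial>lborel)" .
  moreover have "integrable (lebesgue_on half_space) (\<lambda>x. gradient \<psi> x \<bullet> G x)"
    by (rule integrable_compact_support_half_space(2)[where B=B]) (auto intro!: continuous_intros cont simp: B)
  moreover have "integrable (lebesgue_on half_space) (\<lambda>x. \<psi> x * l x)"
    by (rule integrable_compact_support_half_space(2)[where B=B]) (auto intro!: continuous_intros cont simp: B)
  ultimately show ?thesis by (simp add: f_def)
qed

section \<open>Convergence in the mean\<close>

lemma square_integrable_measurable: "square_integrable M f \<Longrightarrow> f \<in> borel_measurable M"
  and square_integrable_integrable: "square_integrable M f \<Longrightarrow> integrable M (\<lambda>x. (norm (f x))\<^sup>2)"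
  unfolding square_integrable_def by auto

lemma square_integrable_bound:
  fixes f :: "'a \<Rightarrow> 'b::euclidean_space"
  assumes "f \<in> borel_measurable M" "integrable M w" "AE x in M. (norm (f x))\<^sup>2 \<le> w x"
  shows "square_integrable M f"
  unfolding square_integrable_def
proof
  show "integrable M (\<lambda>x. (norm (f x))\<^sup>2)"
    by (rule Bochner_Integration.integrable_bound[OF assms(2)]) (use assms in \<open>auto elim: eventually_mono\<close>)
qed (rule assms)

lemma square_integrable_inner:
  fixes f g :: "'a \<Rightarrow> 'b::euclidean_space"
  assumes f: "square_integrable M f" and g: "square_integrable M g"
  shows "integrable M (\<lambda>x. f x \<bullet> g x)"
proof (rule Bochner_Integration.integrable_bound)
  show "integrable M (\<lambda>x. (norm (f x))\<^sup>2 + (norm (g x))\<^sup>2)"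
    using f g by (auto simp: square_integrable_def)
  show "(\<lambda>x. f x \<bullet> g x) \<in> borel_measurable M"
    using f g by (auto simp: square_integrable_def)
  show "AE x in M. norm (f x \<bullet> g x) \<le> norm ((norm (f x))\<^sup>2 + (norm (g x))\<^sup>2)"
  proof (rule AE_I2)
    fix x
    have "norm (f x \<bullet> g x) \<le> norm (f x) * norm (g x)" using Cauchy_Schwarz_ineq2 by simp
    also have "\<dots> \<le> (norm (f x))\<^sup>2 + (norm (g x))\<^sup>2"
      using sum_squares_bound[of "norm (f x)" "norm (g x)"]
        mult_nonneg_nonneg[OF norm_ge_zero[of "f x"] norm_ge_zero[of "g x"]] by linarith
    finally show "norm (f x \<bullet> g x) \<le> norm ((norm (f x))\<^sup>2 + (norm (g x))\<^sup>2)" by simp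
  qed
qed

lemma norm_diff_square_le: "(norm (a - b))\<^sup>2 \<le> 2 * (norm a)\<^sup>2 + 2 * (norm (b::'b::real_normed_vector))\<^sup>2"
proof -
  have "(norm (a - b))\<^sup>2 \<le> (norm a + norm b)\<^sup>2"
    by (intro power_mono norm_triangle_ineq4) simp
  also have "\<dots> \<le> 2 * (norm a)\<^sup>2 + 2 * (norm b)\<^sup>2"
    using sum_squares_bound[of "norm a" "norm b"] by (simp add: power2_sum)
  finally show ?thesis .
qed

lemma square_integrable_diff:
  fixes f g :: "'a \<Rightarrow> 'b::euclidean_space"
  assumes f: "square_integrable M f" and g: "square_integrable M g"
  shows "square_integrable M (\<lambda>x. f x - g x)"
proof (rule square_integrable_bound)
  show "integrable M (\<lambda>x. 2 * (norm (f x))\<^sup>2 + 2 * (norm (g x))\<^sup>2)"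
    using f g by (auto simp: square_integrable_def)
qed (use f g norm_diff_square_le in \<open>auto simp: square_integrable_def\<close>)

lemma square_integrable_bounded_mult:
  fixes f :: "'a \<Rightarrow> real"
  assumes f: "square_integrable M f" and c: "c \<in> borel_measurable M" "AE x in M. \<bar>c x\<bar> \<le> C"
  shows "square_integrable M (\<lambda>x. c x * f x)"
proof (rule square_integrable_bound)
  show "integrable M (\<lambda>x. C\<^sup>2 * (norm (f x))\<^sup>2)" using f by (auto simp: square_integrable_def)
  show "AE x in M. (norm (c x * f x))\<^sup>2 \<le> C\<^sup>2 * (norm (f x))\<^sup>2"
    using c(2)
  proof eventually_elim
    case (elim x)
    have "(c x)\<^sup>2 \<le> C\<^sup>2" using elim by (rule abs_le_square_iff[THEN iffD1, OF order_trans]) simp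
    then show ?case by (simp add: abs_mult power_mult_distrib mult_right_mono)
  qed
qed (use f c in \<open>auto simp: square_integrable_def\<close>)

definition L2_lim :: "'a measure \<Rightarrow> (nat \<Rightarrow> 'a \<Rightarrow> 'b::euclidean_space) \<Rightarrow> ('a \<Rightarrow> 'b) \<Rightarrow> bool" where
  "L2_lim M F f \<longleftrightarrow> (\<lambda>k. \<integral>x. (norm (F k x - f x))\<^sup>2 \<partial>M) \<longlonglongrightarrow> 0"

lemma L2_lim_inner:
  fixes F :: "nat \<Rightarrow> 'a \<Rightarrow> 'b::euclidean_space"
  assumes F: "\<And>k. square_integrable M (F k)" and f: "square_integrable M f" and g: "square_integrable M g"
    and lim: "L2_lim M F f"
  shows "(\<lambda>k. \<integral>x. g x \<bullet> F k x \<partial>M) \<longlonglongrightarrow> (\<integral>x. g x \<bullet> f x \<partial>M)"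
proof (rule LIMSEQ_I)
  fix e :: real assume e: "e > 0"
  define G where "G = (\<integral>x. (norm (g x))\<^sup>2 \<partial>M)"
  have G0: "G \<ge> 0" unfolding G_def by (intro integral_nonneg_AE) auto
  \<comment> \<open>Weight for Young's inequality, which stands in for the integral form of
    Cauchy-Schwarz: \<open>e / (G + 1)\<close> keeps the share of the fixed factor below
    \<open>e / 2\<close>, and the threshold \<open>e * d\<close> on the squared distance does the
    same for the other share.\<close>
  define d where "d = e / (G + 1)"
  have d: "d > 0" using e G0 by (simp add: d_def)
  have "\<forall>\<^sub>F k in sequentially. (\<integral>x. (norm (F k x - f x))\<^sup>2 \<partial>M) < e * d"
    using lim d e unfolding L2_lim_def by (intro order_tendstoD(2)) auto
  then obtain N where N: "\<And>k. k \<ge> N \<Longrightarrow> (\<integral>x. (norm (F k x - f x))\<^sup>2 \<partial>M) < e * d"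
    by (auto simp: eventually_sequentially)
  have "norm ((\<integral>x. g x \<bullet> F k x \<partial>M) - (\<integral>x. g x \<bullet> f x \<partial>M)) < e" if "k \<ge> N" for k
  proof -
    have i: "square_integrable M (\<lambda>x. F k x - f x)" by (rule square_integrable_diff[OF F f])
    have "(\<integral>x. g x \<bullet> F k x \<partial>M) - (\<integral>x. g x \<bullet> f x \<partial>M) = (\<integral>x. g x \<bullet> (F k x - f x) \<partial>M)"
      unfolding inner_diff_right
      by (rule Bochner_Integration.integral_diff[symmetric]) (intro square_integrable_inner g F f)+
    moreover have "norm (\<integral>x. g x \<bullet> (F k x - f x) \<partial>M)
        \<le> (\<integral>x. d / 2 * (norm (g x))\<^sup>2 + 1 / (2 * d) * (norm (F k x - f x))\<^sup>2 \<partial>M)"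
    proof (rule order_trans[OF integral_norm_bound integral_mono])
      fix x
      have "norm (g x \<bullet> (F k x - f x)) \<le> norm (g x) * norm (F k x - f x)"
        using Cauchy_Schwarz_ineq2 by simp
      also have "\<dots> \<le> d / 2 * (norm (g x))\<^sup>2 + 1 / (2 * d) * (norm (F k x - f x))\<^sup>2"
      proof -
        have "0 \<le> (d * norm (g x) - norm (F k x - f x))\<^sup>2 / (2 * d)" using d by simp
        also have "\<dots> = d / 2 * (norm (g x))\<^sup>2 + 1 / (2 * d) * (norm (F k x - f x))\<^sup>2 - norm (g x) * norm (F k x - f x)"
          using d by (simp add: power2_diff power_mult_distrib field_simps power2_eq_square)
        finally show ?thesis by simp
      qed
      finally show "norm (g x \<bullet> (F k x - f x)) \<le> d / 2 * (norm (g x))\<^sup>2 + 1 / (2 * d) * (norm (F k x - f x))\<^sup>2" .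
    qed (use i g in \<open>auto intro!: integrable_norm square_integrable_inner simp: square_integrable_integrable\<close>)
    moreover have "(\<integral>x. d / 2 * (norm (g x))\<^sup>2 + 1 / (2 * d) * (norm (F k x - f x))\<^sup>2 \<partial>M)
        = d / 2 * G + 1 / (2 * d) * (\<integral>x. (norm (F k x - f x))\<^sup>2 \<partial>M)"
      using i g by (subst Bochner_Integration.integral_add) (auto simp: square_integrable_integrable G_def)
    moreover have "d / 2 * G < e / 2" using e G0 by (simp add: d_def field_simps)
    moreover have "1 / (2 * d) * (\<integral>x. (norm (F k x - f x))\<^sup>2 \<partial>M) < e / 2"
      using N[OF that] d by (simp add: field_simps)
    ultimately show ?thesis by simp
  qed
  then show "\<exists>no. \<forall>n\<ge>no. norm ((\<integral>x. g x \<bullet> F n x \<partial>M) - (\<integral>x. g x \<bullet> f x \<partial>M)) < e" by blast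
qed

lemma L2_lim_diff:
  fixes F G :: "nat \<Rightarrow> 'a \<Rightarrow> 'b::euclidean_space"
  assumes F: "\<And>k. square_integrable M (F k)" "square_integrable M f" "L2_lim M F f"
    and G: "\<And>k. square_integrable M (G k)" "square_integrable M g" "L2_lim M G g"
  shows "L2_lim M (\<lambda>k x. F k x - G k x) (\<lambda>x. f x - g x)"
  unfolding L2_lim_def
proof (rule tendsto_sandwich[OF _ _ tendsto_const])
  show "(\<lambda>k. 2 * (\<integral>x. (norm (F k x - f x))\<^sup>2 \<partial>M) + 2 * (\<integral>x. (norm (G k x - g x))\<^sup>2 \<partial>M)) \<longlonglongrightarrow> 0"
    using F(3) G(3) unfolding L2_lim_def by (auto intro!: tendsto_eq_intros)
  show "\<forall>\<^sub>F k in sequentially. 0 \<le> (\<integral>x. (norm (F k x - G k x - (f x - g x)))\<^sup>2 \<partial>M)"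
    by (intro always_eventually allI integral_nonneg_AE) auto
  show "\<forall>\<^sub>F k in sequentially. (\<integral>x. (norm (F k x - G k x - (f x - g x)))\<^sup>2 \<partial>M)
      \<le> 2 * (\<integral>x. (norm (F k x - f x))\<^sup>2 \<partial>M) + 2 * (\<integral>x. (norm (G k x - g x))\<^sup>2 \<partial>M)"
  proof (intro always_eventually allI)
    fix k
    have iF: "square_integrable M (\<lambda>x. F k x - f x)" and iG: "square_integrable M (\<lambda>x. G k x - g x)"
      by (intro square_integrable_diff F G)+
    have "square_integrable M (\<lambda>x. (F k x - f x) - (G k x - g x))"
      by (rule square_integrable_diff[OF iF iG])
    then have i: "integrable M (\<lambda>x. (norm (F k x - G k x - (f x - g x)))\<^sup>2)"
      by (auto dest!: square_integrable_integrable simp: algebra_simps)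
    have "(\<integral>x. (norm (F k x - G k x - (f x - g x)))\<^sup>2 \<partial>M)
        \<le> (\<integral>x. 2 * (norm (F k x - f x))\<^sup>2 + 2 * (norm (G k x - g x))\<^sup>2 \<partial>M)"
    proof (rule integral_mono[OF i])
      show "integrable M (\<lambda>x. 2 * (norm (F k x - f x))\<^sup>2 + 2 * (norm (G k x - g x))\<^sup>2)"
        using iF iG by (auto simp: square_integrable_integrable)
      show "(norm (F k x - G k x - (f x - g x)))\<^sup>2 \<le> 2 * (norm (F k x - f x))\<^sup>2 + 2 * (norm (G k x - g x))\<^sup>2" for x
        using norm_diff_square_le[of "F k x - f x" "G k x - g x"] by (simp add: algebra_simps)
    qed
    also have "\<dots> = 2 * (\<integral>x. (norm (F k x - f x))\<^sup>2 \<partial>M) + 2 * (\<integral>x. (norm (G k x - g x))\<^sup>2 \<partial>M)"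
      using iF iG by (subst Bochner_Integration.integral_add) (auto simp: square_integrable_integrable)
    finally show "(\<integral>x. (norm (F k x - G k x - (f x - g x)))\<^sup>2 \<partial>M)
      \<le> 2 * (\<integral>x. (norm (F k x - f x))\<^sup>2 \<partial>M) + 2 * (\<integral>x. (norm (G k x - g x))\<^sup>2 \<partial>M)" .
  qed
qed

lemma L2_lim_bounded_mult:
  fixes F :: "nat \<Rightarrow> 'a \<Rightarrow> real"
  assumes F: "\<And>k. square_integrable M (F k)" "square_integrable M f" "L2_lim M F f"
    and c: "c \<in> borel_measurable M" "AE x in M. \<bar>c x\<bar> \<le> C"
  shows "L2_lim M (\<lambda>k x. c x * F k x) (\<lambda>x. c x * f x)"
  unfolding L2_lim_def
proof (rule tendsto_sandwich[OF _ _ tendsto_const])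
  show "(\<lambda>k. C\<^sup>2 * (\<integral>x. (norm (F k x - f x))\<^sup>2 \<partial>M)) \<longlonglongrightarrow> 0"
    using F(3) unfolding L2_lim_def by (auto intro!: tendsto_eq_intros)
  show "\<forall>\<^sub>F k in sequentially. 0 \<le> (\<integral>x. (norm (c x * F k x - c x * f x))\<^sup>2 \<partial>M)"
    by (intro always_eventually allI integral_nonneg_AE) auto
  show "\<forall>\<^sub>F k in sequentially. (\<integral>x. (norm (c x * F k x - c x * f x))\<^sup>2 \<partial>M)
      \<le> C\<^sup>2 * (\<integral>x. (norm (F k x - f x))\<^sup>2 \<partial>M)"
  proof (intro always_eventually allI)
    fix k
    have iF: "square_integrable M (\<lambda>x. F k x - f x)" by (intro square_integrable_diff F)
    have "(\<integral>x. (norm (c x * F k x - c x * f x))\<^sup>2 \<partial>M) \<le> (\<integral>x. C\<^sup>2 * (norm (F k x - f x))\<^sup>2 \<partial>M)"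
    proof (rule integral_mono_AE)
      show "integrable M (\<lambda>x. (norm (c x * F k x - c x * f x))\<^sup>2)"
        using square_integrable_bounded_mult[OF iF c] by (auto dest!: square_integrable_integrable simp: algebra_simps)
      show "integrable M (\<lambda>x. C\<^sup>2 * (norm (F k x - f x))\<^sup>2)"
        using square_integrable_integrable[OF iF] by simp
      show "AE x in M. (norm (c x * F k x - c x * f x))\<^sup>2 \<le> C\<^sup>2 * (norm (F k x - f x))\<^sup>2"
        using c(2)
      proof eventually_elim
        case (elim x)
        have "(c x)\<^sup>2 \<le> C\<^sup>2" using elim by (rule abs_le_square_iff[THEN iffD1, OF order_trans]) simp
        then have "(c x)\<^sup>2 * (F k x - f x)\<^sup>2 \<le> C\<^sup>2 * (F k x - f x)\<^sup>2" by (simp add: mult_right_mono)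
        then show ?case by (simp add: power_mult_distrib[symmetric] right_diff_distrib)
      qed
    qed
    then show "(\<integral>x. (norm (c x * F k x - c x * f x))\<^sup>2 \<partial>M) \<le> C\<^sup>2 * (\<integral>x. (norm (F k x - f x))\<^sup>2 \<partial>M)" by simp
  qed
qed

text \<open>Tailored to cutoffs, which at each fixed point eventually equal 1: pointwise convergence
  then means that the sequence becomes stationary.\<close>

lemma L2_lim_dominated:
  fixes F :: "nat \<Rightarrow> 'a \<Rightarrow> 'b::euclidean_space"
  assumes m: "\<And>k. F k \<in> borel_measurable M" "f \<in> borel_measurable M"
    and W: "integrable M (\<lambda>x. (W x)\<^sup>2)"
    and b: "\<And>k x. x \<in> space M \<Longrightarrow> norm (F k x) \<le> W x" "\<And>x. x \<in> space M \<Longrightarrow> norm (f x) \<le> W x"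
    and ev: "\<And>x. x \<in> space M \<Longrightarrow> \<forall>\<^sub>F k in sequentially. F k x = f x"
  shows "L2_lim M F f"
proof -
  have "(\<lambda>k. \<integral>x. (norm (F k x - f x))\<^sup>2 \<partial>M) \<longlonglongrightarrow> (\<integral>x. 0 \<partial>M)"
  proof (rule integral_dominated_convergence[where w="\<lambda>x. 4 * (W x)\<^sup>2"])
    show "AE x in M. (\<lambda>k. (norm (F k x - f x))\<^sup>2) \<longlonglongrightarrow> 0"
    proof (rule AE_I2)
      fix x assume "x \<in> space M"
      from ev[OF this] show "(\<lambda>k. (norm (F k x - f x))\<^sup>2) \<longlonglongrightarrow> 0"
        by (intro tendsto_eventually) (auto elim!: eventually_mono)
    qed
    show "AE x in M. norm ((norm (F k x - f x))\<^sup>2) \<le> 4 * (W x)\<^sup>2" for k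
    proof (rule AE_I2)
      fix x assume x: "x \<in> space M"
      have "(norm (F k x))\<^sup>2 \<le> (W x)\<^sup>2" "(norm (f x))\<^sup>2 \<le> (W x)\<^sup>2"
        using b[OF x] by (auto intro!: power_mono)
      then show "norm ((norm (F k x - f x))\<^sup>2) \<le> 4 * (W x)\<^sup>2"
        using norm_diff_square_le[of "F k x" "f x"] by simp
    qed
  qed (use m W in auto)
  then show ?thesis by (simp add: L2_lim_def)
qed

lemma C1_compact_square_integrable_half_space:
  fixes \<psi> :: "(real^'m) \<times> real \<Rightarrow> real"
  assumes \<psi>: "C1_compact \<psi>"
  shows "square_integrable (lebesgue_on half_space) \<psi>"
    and "square_integrable lebesgue (\<lambda>y. \<psi> (y, 0))"
proof -
  obtain B where B: "\<And>x. norm x > B \<Longrightarrow> \<psi> x = 0"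
    by (rule C1_compact_bounded_support[OF \<psi>]) blast
  have c: "continuous_on closed_half_space \<psi>" by (rule C1_compact_continuous[OF \<psi>])
  have "integrable (lebesgue_on half_space) (\<lambda>x. (norm (\<psi> x))\<^sup>2)"
    by (rule integrable_compact_support_half_space(2)[where B=B]) (auto intro!: continuous_intros c simp: B)
  moreover have "\<psi> \<in> borel_measurable (lebesgue_on half_space)"
    by (rule continuous_imp_measurable_on_sets_lebesgue)
       (auto intro: C1_compact_continuous[OF \<psi>])
  ultimately show "square_integrable (lebesgue_on half_space) \<psi>" unfolding square_integrable_def by blast
  let ?h = "\<lambda>y::real^'m. \<psi> (y, 0)"
  have c3: "continuous_on UNIV ?h"
    by (rule continuous_on_compose2[OF C1_compact_continuous[OF \<psi>, of UNIV]]) (auto intro!: continuous_intros)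
  then have m: "?h \<in> borel_measurable lborel" by (simp add: borel_measurable_continuous_onI)
  have "integrable lborel (\<lambda>y. indicator (cball 0 B) y *\<^sub>R (norm (?h y))\<^sup>2)"
    by (intro borel_integrable_compact continuous_intros continuous_on_subset[OF c3]) auto
  also have "(\<lambda>y. indicator (cball 0 B) y *\<^sub>R (norm (?h y))\<^sup>2) = (\<lambda>y. (norm (?h y))\<^sup>2)"
    using B by (auto simp: fun_eq_iff indicator_def norm_Pair)
  finally have "integrable lebesgue (\<lambda>y. (norm (?h y))\<^sup>2)"
    by (subst integrable_completion) (use m in measurable)
  then show "square_integrable lebesgue ?h"
    unfolding square_integrable_def using m measurable_completion by blast
qed

section \<open>A moment recursion\<close>

text \<open>To be read with \<open>A p i\<close> as the interior moment of
  \<open>(a.y)^p |y|^(2i)\<close> for a unit vector \<open>a\<close>, \<open>B p\<close> as the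
  boundary moment of \<open>(a.y)^p\<close>, and \<open>\<theta>\<close> as the value of
  \<open>|y|^2\<close> on the boundary. In strong induction on the degree, lower boundary moments
  vanish, so the harmonic combination of degree \<open>k\<close> sees \<open>B k\<close> alone. The
  resulting recursion in \<open>j\<close> forbids convergence to 0 unless
  \<open>B k = 0\<close>.\<close>

lemma moment_recursion:
  fixes A :: "nat \<Rightarrow> nat \<Rightarrow> real" and B :: "nat \<Rightarrow> real" and N \<theta> :: real
  assumes N: "N \<ge> 2"
    and rec: "\<And>p i. real p * (real p - 1) * A (p - 2) i
        + 2 * real i * (N + 2 * real i - 2 + 2 * real p) * A p (i - 1)
        - (real p + 2 * real i) * (real p + 2 * real i - 1) * A p i
        = (real p + 2 * real i - 1) * \<theta> ^ i * B p"
    and \<theta>: "\<theta> \<ge> 0"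
    and lim: "\<And>p. A p \<longlonglongrightarrow> 0"
    and B1: "B 1 = 0"
  shows "B k = 0"
proof (induction k rule: less_induct)
  case (less k)
  have B0: "B 0 = 0" using rec[of 0 0] by simp
  show ?case
  proof (cases "k < 2")
    case True
    then have "k = 0 \<or> k = 1" by auto
    with B0 B1 show ?thesis by auto
  next
    case False
    then have k2: "k \<ge> 2" by simp
    \<comment> \<open>The coefficients for which \<open>\<Sum>\<^sub>i e\<^sub>i s\<^sup>k\<^sup>-\<^sup>2\<^sup>i r\<^sup>2\<^sup>i\<close>, with \<open>s = a\<cdot>y\<close> and \<open>r = |y|\<close>, is harmonic.\<close>
    define e :: "nat \<Rightarrow> real" where
      "e = rec_nat 1 (\<lambda>i r. - r * ((real k - 2 * real i) * (real k - 2 * real i - 1))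
             / ((2 * real i + 2) * (N - 4 + 2 * real k - 2 * real i)))"
    have e0: "e 0 = 1" by (simp add: e_def)
    have eS: "e i * ((real k - 2 * real i) * (real k - 2 * real i - 1))
        = - e (Suc i) * ((2 * real i + 2) * (N - 4 + 2 * real k - 2 * real i))"
      if "2 * i + 2 \<le> k" for i
    proof -
      have "real (2 * i + 2) \<le> real k" using that of_nat_le_iff by blast
      then have "N - 4 + 2 * real k - 2 * real i > 0" using N by simp
      then show ?thesis by (simp add: e_def)
    qed
    \<comment> \<open>The last power \<open>k - 2 * m\<close> of the linear form is 0 or 1, so its
      second derivative vanishes and the sum closes.\<close>
    define m where "m = k div 2"
    define h where "h = (\<lambda>j. \<Sum>i\<le>m. e i * A (k - 2 * i) (i + j))"
    have key: "2 * real j * (N - 2 + 2 * real k + 2 * real j) * h (j - 1)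
        - (real k + 2 * real j) * (real k + 2 * real j - 1) * h j
        = (real k + 2 * real j - 1) * \<theta> ^ j * B k" for j
    proof -
      let ?d = "real k + 2 * real j"
      have r: "real (k - 2 * i) = real k - 2 * real i" if "i \<le> m" for i
        using that unfolding m_def by (simp add: of_nat_diff)
      define X where "X = (\<lambda>i. e i * ((real k - 2 * real i) * (real k - 2 * real i - 1)) * A (k - 2 * i - 2) (i + j))"
      define Z where "Z = (\<lambda>i. e i * (2 * real (i + j) * (N - 2 + 2 * real j + 2 * real k - 2 * real i)) * A (k - 2 * i) (i + j - 1))"
      have each: "X i + Z i - ?d * (?d - 1) * (e i * A (k - 2 * i) (i + j))
          = (?d - 1) * \<theta> ^ (i + j) * e i * B (k - 2 * i)" if "i \<le> m" for i
      proof -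
        have "real (k - 2 * i) + 2 * real (i + j) = ?d" using r[OF that] by simp
        moreover have "N + 2 * real (i + j) - 2 + 2 * real (k - 2 * i) = N - 2 + 2 * real j + 2 * real k - 2 * real i"
          using r[OF that] by simp
        ultimately have "(real k - 2 * real i) * (real k - 2 * real i - 1) * A (k - 2 * i - 2) (i + j)
           + 2 * real (i + j) * (N - 2 + 2 * real j + 2 * real k - 2 * real i) * A (k - 2 * i) (i + j - 1)
           - ?d * (?d - 1) * A (k - 2 * i) (i + j) = (?d - 1) * \<theta> ^ (i + j) * B (k - 2 * i)"
          using rec[of "k - 2 * i" "i + j"] r[OF that] by (simp only:)
        from arg_cong[OF this, of "\<lambda>z. e i * z"] show ?thesis
          unfolding X_def Z_def by (simp add: algebra_simps)
      qed
      have sum: "(\<Sum>i\<le>m. X i) + (\<Sum>i\<le>m. Z i) - ?d * (?d - 1) * h j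
          = (\<Sum>i\<le>m. (?d - 1) * \<theta> ^ (i + j) * e i * B (k - 2 * i))"
        unfolding h_def sum_distrib_left sum.distrib[symmetric] sum_subtractf[symmetric]
        by (rule sum.cong) (use each in auto)
      \<comment> \<open>By the induction hypothesis every term with \<open>i > 0\<close> has a
        vanishing boundary moment; the leading coefficient is \<open>e 0 = 1\<close>.\<close>
      have rhs: "(\<Sum>i\<le>m. (?d - 1) * \<theta> ^ (i + j) * e i * B (k - 2 * i)) = (?d - 1) * \<theta> ^ j * B k"
      proof -
        have "(\<Sum>i\<le>m. (?d - 1) * \<theta> ^ (i + j) * e i * B (k - 2 * i))
            = (\<Sum>i\<le>m. if i = 0 then (?d - 1) * \<theta> ^ j * B k else 0)"
          using less k2 by (intro sum.cong) (auto simp: e0)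
        then show ?thesis by simp
      qed
      \<comment> \<open>Shifting the index by one, the choice of \<open>e\<close> makes
        \<open>X\<close> cancel the \<open>j\<close>-free part of \<open>Z\<close>; this is
        harmonicity. What remains of the coefficient is \<open>2*(i+j)*(N-2+2*j+2*k-2*i) -
        2*i*(N-2+2*k-2*i) = 2*j*(N-2+2*k+2*j)\<close>, which no longer depends on
        \<open>i\<close>.\<close>
      have XZ: "(\<Sum>i\<le>m. X i) + (\<Sum>i\<le>m. Z i) = 2 * real j * (N - 2 + 2 * real k + 2 * real j) * h (j - 1)"
      proof -
        have Xm: "X m = 0"
        proof -
          have "k = 2 * m \<or> k = 2 * m + 1" unfolding m_def by auto
          then show ?thesis unfolding X_def by auto
        qed
        have "(\<Sum>i\<le>m. X i) = (\<Sum>i<m. X i)"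
          using Xm by (simp add: lessThan_Suc_atMost[symmetric])
        also have "\<dots> = (\<Sum>i<m. - e (Suc i) * ((2 * real i + 2) * (N - 4 + 2 * real k - 2 * real i)) * A (k - 2 * Suc i) (i + j))"
        proof (rule sum.cong)
          fix i assume "i \<in> {..<m}"
          then have "2 * i + 2 \<le> k" unfolding m_def by auto
          from eS[OF this] show "X i = - e (Suc i) * ((2 * real i + 2) * (N - 4 + 2 * real k - 2 * real i)) * A (k - 2 * Suc i) (i + j)"
            unfolding X_def by simp
        qed simp
        also have "\<dots> = (\<Sum>i\<in>{1..m}. - e i * (2 * real i * (N - 2 + 2 * real k - 2 * real i)) * A (k - 2 * i) (i + j - 1))"
          by (rule sum.reindex_bij_witness[of _ "\<lambda>i. i - 1" Suc]) (auto simp: algebra_simps)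
        also have "\<dots> = (\<Sum>i\<le>m. - e i * (2 * real i * (N - 2 + 2 * real k - 2 * real i)) * A (k - 2 * i) (i + j - 1))"
          by (rule sum.mono_neutral_left) auto
        finally have "(\<Sum>i\<le>m. X i) + (\<Sum>i\<le>m. Z i)
            = (\<Sum>i\<le>m. - e i * (2 * real i * (N - 2 + 2 * real k - 2 * real i)) * A (k - 2 * i) (i + j - 1) + Z i)"
          by (simp only: sum.distrib)
        also have "\<dots> = (\<Sum>i\<le>m. 2 * real j * (N - 2 + 2 * real k + 2 * real j) * (e i * A (k - 2 * i) (i + j - 1)))"
          by (rule sum.cong) (auto simp: Z_def algebra_simps)
        \<comment> \<open>For \<open>j = 0\<close> the subtraction in \<open>j - 1\<close>
          truncates, but the factor \<open>2 * real j\<close> is 0 on both sides.\<close>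
        also have "\<dots> = 2 * real j * (N - 2 + 2 * real k + 2 * real j) * h (j - 1)"
          by (cases j) (auto simp: h_def sum_distrib_left)
        finally show ?thesis .
      qed
      show ?thesis using sum rhs XZ by simp
    qed
    have hlim: "h \<longlonglongrightarrow> 0"
    proof -
      have "(\<lambda>j. \<Sum>i\<le>m. e i * A (k - 2 * i) (i + j)) \<longlonglongrightarrow> (\<Sum>i\<le>m. e i * 0)"
      proof (intro tendsto_sum tendsto_mult tendsto_const)
        fix i
        show "(\<lambda>j. A (k - 2 * i) (i + j)) \<longlonglongrightarrow> 0"
          using LIMSEQ_ignore_initial_segment[OF lim, of "k - 2 * i" i] by (simp add: add.commute)
      qed
      then show ?thesis by (simp add: h_def)
    qed
    show ?thesis
    proof (rule ccontr)
      assume Bk: "B k \<noteq> 0"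
      \<comment> \<open>With this sign and scale the inhomogeneous term is nonnegative and
        \<open>G 0 = 1 / k\<close>, so positivity propagates through the recursion.\<close>
      define G where "G = (\<lambda>j. - h j / B k)"
      have Glim: "G \<longlonglongrightarrow> 0" unfolding G_def
        using tendsto_divide[OF tendsto_minus[OF hlim] tendsto_const[of "B k"]] Bk by simp
      have Grec: "(real k + 2 * real j) * (real k + 2 * real j - 1) * G j
         = 2 * real j * (N - 2 + 2 * real k + 2 * real j) * G (j - 1) + (real k + 2 * real j - 1) * \<theta> ^ j" for j
      proof -
        have *: "b * (- x / B k) = a * (- y / B k) + c" if "a * y - b * x = c * B k" for a b c x y
          using that Bk by (simp add: field_simps)
        show ?thesis unfolding G_def by (rule *[OF key])
      qed
      have dpos: "(real k + 2 * real j) * (real k + 2 * real j - 1) > 0" for j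
        using k2 by (intro mult_pos_pos) auto
      have Gpos: "G j > 0" for j
      proof (induction j)
        case 0
        have "real k * (real k - 1) * G 0 = real k - 1" using Grec[of 0] by (simp del: mult_cancel_right mult_cancel_left)
        then have "real k * (real k - 1) * G 0 > 0" using k2 by linarith
        then show ?case using dpos[of 0] zero_less_mult_pos by simp
      next
        case (Suc j)
        have "2 * real (Suc j) * (N - 2 + 2 * real k + 2 * real (Suc j)) * G j > 0"
          using Suc N by (intro mult_pos_pos) auto
        moreover have "(real k + 2 * real (Suc j) - 1) * \<theta> ^ (Suc j) \<ge> 0"
          using \<theta> k2 by (intro mult_nonneg_nonneg) auto
        ultimately have "(real k + 2 * real (Suc j)) * (real k + 2 * real (Suc j) - 1) * G (Suc j) > 0"
          using Grec[of "Suc j"] by simp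
        then show ?case using dpos[of "Suc j"] zero_less_mult_pos by blast
      qed
      \<comment> \<open>With \<open>J = j + 1\<close>, the coefficient of \<open>G J\<close> exceeds
        \<open>2*J*(2*k+2*J)\<close> by \<open>k^2 - k - 2*J\<close>, which is negative once
        \<open>j >= k^2\<close>; \<open>N >= 2\<close> puts the coefficient of \<open>G j\<close>
        above that comparison value.\<close>
      have klein_mono: "G (Suc j) \<ge> G j" if "j \<ge> k * k" for j
      proof -
        have "real k * real k \<le> real j" using that by (metis of_nat_le_iff of_nat_mult)
        then have "(real k + 2 * real (Suc j)) * (real k + 2 * real (Suc j) - 1)
            \<le> 2 * real (Suc j) * (2 * real k + 2 * real (Suc j))"
          by (simp add: algebra_simps)
        also have "\<dots> \<le> 2 * real (Suc j) * (N - 2 + 2 * real k + 2 * real (Suc j))"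
          using N by (intro mult_left_mono) auto
        finally have "(real k + 2 * real (Suc j)) * (real k + 2 * real (Suc j) - 1) * G j
            \<le> 2 * real (Suc j) * (N - 2 + 2 * real k + 2 * real (Suc j)) * G j"
          using Gpos[of j] by (intro mult_right_mono) auto
        also have "\<dots> \<le> (real k + 2 * real (Suc j)) * (real k + 2 * real (Suc j) - 1) * G (Suc j)"
          using Grec[of "Suc j"] \<theta> k2 by simp
        finally show ?thesis using dpos[of "Suc j"] by (simp only: mult_le_cancel_left_pos)
      qed
      have "incseq (\<lambda>j. G (j + k * k))" using klein_mono by (intro incseq_SucI) simp
      moreover have "(\<lambda>j. G (j + k * k)) \<longlonglongrightarrow> 0" using Glim by (rule LIMSEQ_ignore_initial_segment)
      ultimately have "G (0 + k * k) \<le> 0" by (rule incseq_le)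
      then show False using Gpos[of "k * k"] by simp
    qed
  qed
qed

section \<open>Weak solutions in the weighted energy space\<close>

locale exterior_bubble =
  fixes D :: real
  assumes D_gt_1: "D > 1"
begin

text \<open>The minimum of \<open>wt\<close> on the closed half-space, attained at the origin. Its
  positivity is the meaning of \<open>D > 1\<close>: all weights below are bounded there.\<close>

definition kk :: real where "kk = D\<^sup>2 - 1"

lemma kk_pos: "kk > 0"
  using D_gt_1 by (simp add: kk_def)

definition wt :: "(real^'m) \<times> real \<Rightarrow> real" where
  "wt x = (norm x)\<^sup>2 + 2 * D * snd x + kk"

lemma wt_eq: "wt x = (norm (x + (0, D)))\<^sup>2 - 1"
  unfolding power2_norm_eq_inner wt_def kk_def
  by (cases x) (simp add: inner_add_left inner_add_right power2_eq_square algebra_simps)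

lemma wt_ge: "snd x \<ge> 0 \<Longrightarrow> wt x \<ge> kk + (norm x)\<^sup>2"
  using D_gt_1 by (simp add: wt_def)

lemma wt_ge_kk: "snd x \<ge> 0 \<Longrightarrow> wt x \<ge> kk"
  using wt_ge[of x] by (smt (verit) zero_le_power2)

lemma wt_pos: "snd x \<ge> 0 \<Longrightarrow> wt x > 0"
  using wt_ge_kk[of x] kk_pos by linarith

lemma wt_nonzero: "snd x \<ge> 0 \<Longrightarrow> wt x \<noteq> 0"
  using wt_pos[of x] by linarith

lemma wt_boundary: "wt (y, 0) = (norm y)\<^sup>2 + kk"
  by (simp add: wt_def norm_Pair)

lemma closed_half_space_subset_wt: "closed_half_space \<subseteq> {x. wt x > 0}"
  using wt_pos by auto

lemma continuous_on_wt [continuous_intros]: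
  "continuous_on S f \<Longrightarrow> continuous_on S (\<lambda>x. wt (f x))"
  unfolding wt_def by (intro continuous_intros)

lemma open_wt_pos: "open {x. wt x > 0}"
  by (intro open_Collect_less continuous_intros continuous_on_id)

lemma wt_powr_le:
  assumes "snd x \<ge> 0" "a \<le> b"
  shows "wt x powr a \<le> kk powr (a - b) * wt x powr b"
proof -
  have "wt x powr a = wt x powr (a - b) * wt x powr b" by (simp flip: powr_add)
  also have "\<dots> \<le> kk powr (a - b) * wt x powr b"
    using wt_ge_kk[OF assms(1)] kk_pos assms(2) by (intro mult_right_mono powr_mono2') auto
  finally show ?thesis .
qed

text \<open>Here \<open>CARD('m)\<close> is \<open>n - 1\<close>, and \<open>wt\<close> dominates
  \<open>kk + |x|^2\<close>. The power is integrable in dimension \<open>n\<close> because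
  \<open>2 * (n - 1) > n\<close>, that is, because \<open>n >= 3\<close>.\<close>

lemma integrable_wt_half_space:
  assumes "CARD('m) \<ge> 2"
  shows "integrable (lebesgue_on half_space) (\<lambda>x::(real^'m) \<times> real. wt x powr (- real CARD('m)))"
proof -
  have c: "continuous_on half_space (\<lambda>x::(real^'m) \<times> real. wt x powr (- real CARD('m)))"
    by (intro continuous_intros continuous_on_id) (auto simp: half_space_def wt_nonzero)
  have "integrable lborel (\<lambda>x::(real^'m) \<times> real. (kk + (norm x)\<^sup>2) powr (- real CARD('m)))"
    using assms by (intro integrable_powr_decay kk_pos) simp
  then have "integrable lborel (\<lambda>x::(real^'m) \<times> real. indicator half_space x *\<^sub>R wt x powr (- real CARD('m)))"
  proof (rule Bochner_Integration.integrable_bound)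
    show "(\<lambda>x::(real^'m) \<times> real. indicator half_space x *\<^sub>R wt x powr (- real CARD('m))) \<in> borel_measurable lborel"
      using borel_measurable_continuous_on_indicator[OF _ c] by simp
    show "AE x in lborel. norm (indicator half_space x *\<^sub>R wt (x::(real^'m) \<times> real) powr (- real CARD('m)))
        \<le> norm ((kk + (norm x)\<^sup>2) powr (- real CARD('m)))"
    proof (rule AE_I2)
      fix x :: "(real^'m) \<times> real"
      have "wt x powr (- real CARD('m)) \<le> (kk + (norm x)\<^sup>2) powr (- real CARD('m))" if "x \<in> half_space"
        using that wt_ge[of x] kk_pos half_space_subset
        by (intro powr_mono2') (auto intro: add_pos_nonneg)
      then show "norm (indicator half_space x *\<^sub>R wt x powr (- real CARD('m))) \<le> norm ((kk + (norm x)\<^sup>2) powr (- real CARD('m)))"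
        by (auto simp: indicator_def)
    qed
  qed
  then show ?thesis using integral_half_space_lborel(2)[OF c] by blast
qed

lemma integrable_wt_boundary:
  "integrable lebesgue (\<lambda>y::real^'m. wt (y, 0) powr (- real CARD('m)))"
proof -
  have "integrable lborel (\<lambda>y::real^'m. (kk + (norm y)\<^sup>2) powr (- real CARD('m)))"
    by (intro integrable_powr_decay kk_pos) simp
  moreover have "(\<lambda>y::real^'m. wt (y, 0) powr (- real CARD('m))) \<in> borel_measurable lborel"
    unfolding wt_boundary using kk_pos
    by (auto intro!: borel_measurable_continuous_onI continuous_intros simp: add_nonneg_eq_0_iff)
  ultimately show ?thesis by (simp add: integrable_completion wt_boundary add.commute)
qed

lemma borel_measurable_half_space:
  assumes "continuous_on closed_half_space h"
  shows "h \<in> borel_measurable (lebesgue_on half_space)"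
  by (rule continuous_imp_measurable_on_sets_lebesgue)
     (auto intro: continuous_on_subset[OF assms half_space_subset])

lemma square_bound_powr:
  assumes "norm z \<le> C * a powr (- M / 2)"
  shows "(norm z)\<^sup>2 \<le> C\<^sup>2 * a powr (- M)"
proof -
  have "(norm z)\<^sup>2 \<le> (C * a powr (- M / 2))\<^sup>2" using assms by (intro power_mono) auto
  also have "\<dots> = C\<^sup>2 * a powr (- M)"
    by (simp add: power_mult_distrib power2_eq_square[of "_ powr _"] flip: powr_add)
  finally show ?thesis .
qed

text \<open>Decay of order \<open>wt powr (- (n - 1) / 2)\<close> is the yardstick of all estimates:
  it is square integrable on the half-space as well as on the boundary, and the solutions and test
  functions below meet it after weighting.\<close>

lemma square_integrable_half_space:
  fixes h :: "(real^'m) \<times> real \<Rightarrow> 'b::euclidean_space"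
  assumes "CARD('m) \<ge> 2" and c: "continuous_on closed_half_space h"
    and b: "\<And>x. snd x \<ge> 0 \<Longrightarrow> norm (h x) \<le> C * wt x powr (- real CARD('m) / 2)"
  shows "square_integrable (lebesgue_on half_space) h"
proof (rule square_integrable_bound[OF borel_measurable_half_space[OF c]])
  show "integrable (lebesgue_on half_space) (\<lambda>x::(real^'m) \<times> real. C\<^sup>2 * wt x powr (- real CARD('m)))"
    by (intro integrable_mult_right integrable_wt_half_space assms(1))
  show "AE x in lebesgue_on half_space. (norm (h x))\<^sup>2 \<le> C\<^sup>2 * wt x powr (- real CARD('m))"
    using b by (intro AE_I2 square_bound_powr) (simp add: half_space_def)
qed

lemma square_integrable_boundary:
  fixes h :: "real^'m \<Rightarrow> 'b::euclidean_space"
  assumes c: "continuous_on UNIV h"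
    and b: "\<And>y. norm (h y) \<le> C * wt (y, 0) powr (- real CARD('m) / 2)"
  shows "square_integrable lebesgue h"
proof (rule square_integrable_bound)
  show "h \<in> borel_measurable lebesgue"
    using c by (intro measurable_completion) (simp add: borel_measurable_continuous_onI)
  show "integrable lebesgue (\<lambda>y::real^'m. C\<^sup>2 * wt (y, 0) powr (- real CARD('m)))"
    by (intro integrable_mult_right integrable_wt_boundary)
  show "AE y in lebesgue. (norm (h y))\<^sup>2 \<le> C\<^sup>2 * wt (y, 0) powr (- real CARD('m))"
    using b by (intro AE_I2 square_bound_powr)
qed

text \<open>The weights replace \<open>H\<^sup>1\<close> because \<open>\<zz>\<^sub>n\<close> is not in \<open>L\<^sup>2\<close> for \<open>n = 3, 4\<close>: subtracting it from
  \<open>v\<close> would leave \<open>H\<^sup>1\<close>.\<close>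

definition admissible ::
  "((real^'m) \<times> real \<Rightarrow> real) \<Rightarrow> ((real^'m) \<times> real \<Rightarrow> (real^'m) \<times> real) \<Rightarrow> (real^'m \<Rightarrow> real) \<Rightarrow> bool" where
  "admissible v g T \<longleftrightarrow> square_integrable (lebesgue_on half_space) (\<lambda>x. v x / wt x)
     \<and> square_integrable (lebesgue_on half_space) g
     \<and> square_integrable lebesgue (\<lambda>y. T y / sqrt (wt (y, 0)))
     \<and> (\<exists>\<phi>. (\<forall>k. C1_compact (\<phi> k))
        \<and> L2_lim (lebesgue_on half_space) (\<lambda>k x. \<phi> k x / wt x) (\<lambda>x. v x / wt x)
        \<and> L2_lim (lebesgue_on half_space) (\<lambda>k. gradient (\<phi> k)) g
        \<and> L2_lim lebesgue (\<lambda>k y. \<phi> k (y, 0) / sqrt (wt (y, 0))) (\<lambda>y. T y / sqrt (wt (y, 0))))"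

text \<open>With \<open>n = CARD('m) + 1\<close> the coefficients are \<open>n * (n + 2)\<close> and
  \<open>n * D\<close>. The weights \<open>1 / wt^2\<close> and \<open>1 / wt\<close> are shared
  evenly between the two factors, so that each integrand is a product of functions that
  \<open>admissible\<close> makes square integrable.\<close>

definition robin_form ::
  "((real^'m) \<times> real \<Rightarrow> real) \<Rightarrow> ((real^'m) \<times> real \<Rightarrow> (real^'m) \<times> real) \<Rightarrow> (real^'m \<Rightarrow> real)
    \<Rightarrow> ((real^'m) \<times> real \<Rightarrow> real) \<Rightarrow> ((real^'m) \<times> real \<Rightarrow> (real^'m) \<times> real) \<Rightarrow> (real^'m \<Rightarrow> real) \<Rightarrow> real" where
  "robin_form v g T w h U =
     (\<integral>x. g x \<bullet> h x \<partial>lebesgue_on half_space)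
     + (real CARD('m) + 1) * (real CARD('m) + 3) * (\<integral>x. (v x / wt x) * (w x / wt x) \<partial>lebesgue_on half_space)
     - (real CARD('m) + 1) * D * (\<integral>y. (T y / sqrt (wt (y, 0))) * (U y / sqrt (wt (y, 0))) \<partial>lebesgue)"

definition robin_solution ::
  "((real^'m) \<times> real \<Rightarrow> real) \<Rightarrow> ((real^'m) \<times> real \<Rightarrow> (real^'m) \<times> real) \<Rightarrow> (real^'m \<Rightarrow> real) \<Rightarrow> bool" where
  "robin_solution v g T \<longleftrightarrow> admissible v g T
     \<and> (\<forall>\<psi>. C1_compact \<psi> \<longrightarrow> robin_form v g T \<psi> (gradient \<psi>) (\<lambda>y. \<psi> (y, 0)) = 0)"

lemma inverse_wt:
  shows inverse_wt_measurable: "(\<lambda>x::(real^'m) \<times> real. 1 / wt x) \<in> borel_measurable (lebesgue_on half_space)"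
    and inverse_wt_bounded: "AE x::(real^'m) \<times> real in lebesgue_on half_space. \<bar>1 / wt x\<bar> \<le> 1 / kk"
    and inverse_wt_boundary_measurable: "(\<lambda>y::real^'m. 1 / sqrt (wt (y, 0))) \<in> borel_measurable lebesgue"
    and inverse_wt_boundary_bounded: "AE y::real^'m in lebesgue. \<bar>1 / sqrt (wt (y, 0))\<bar> \<le> 1 / sqrt kk"
proof -
  show "(\<lambda>x::(real^'m) \<times> real. 1 / wt x) \<in> borel_measurable (lebesgue_on half_space)"
    by (rule borel_measurable_half_space) (auto intro!: continuous_intros simp: wt_nonzero)
  show "AE x::(real^'m) \<times> real in lebesgue_on half_space. \<bar>1 / wt x\<bar> \<le> 1 / kk"
  proof (rule AE_I2)
    fix x :: "(real^'m) \<times> real" assume "x \<in> space (lebesgue_on half_space)"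
    then have "snd x \<ge> 0" by (simp add: half_space_def)
    then show "\<bar>1 / wt x\<bar> \<le> 1 / kk" using wt_ge_kk[of x] kk_pos by (simp add: frac_le)
  qed
  have "continuous_on UNIV (\<lambda>y::real^'m. 1 / sqrt (wt (y, 0)))"
    by (intro continuous_on_divide continuous_on_const continuous_on_real_sqrt continuous_on_wt continuous_on_Pair continuous_on_id)
      (simp add: wt_nonzero)
  then show "(\<lambda>y::real^'m. 1 / sqrt (wt (y, 0))) \<in> borel_measurable lebesgue"
    by (intro measurable_completion) (simp add: borel_measurable_continuous_onI)
  show "AE y::real^'m in lebesgue. \<bar>1 / sqrt (wt (y, 0))\<bar> \<le> 1 / sqrt kk"
  proof (rule AE_I2)
    fix y :: "real^'m"
    show "\<bar>1 / sqrt (wt (y, 0))\<bar> \<le> 1 / sqrt kk"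
      using wt_ge_kk[of "(y, 0)"] kk_pos by (simp add: frac_le)
  qed
qed

lemma C1_compact_square_integrable:
  fixes \<psi> :: "(real^'m) \<times> real \<Rightarrow> real"
  assumes \<psi>: "C1_compact \<psi>"
  shows "square_integrable (lebesgue_on half_space) (\<lambda>x. \<psi> x / wt x)"
    and "square_integrable (lebesgue_on half_space) (gradient \<psi>)"
    and "square_integrable lebesgue (\<lambda>y. \<psi> (y, 0) / sqrt (wt (y, 0)))"
proof -
  note s = C1_compact_square_integrable_half_space[OF \<psi>]
  show "square_integrable (lebesgue_on half_space) (\<lambda>x. \<psi> x / wt x)"
    using square_integrable_bounded_mult[OF s(1) inverse_wt_measurable inverse_wt_bounded] by simp
  show "square_integrable lebesgue (\<lambda>y. \<psi> (y, 0) / sqrt (wt (y, 0)))"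
    using square_integrable_bounded_mult[OF s(2) inverse_wt_boundary_measurable inverse_wt_boundary_bounded] by simp
  obtain B where B: "\<And>x. norm x > B \<Longrightarrow> gradient \<psi> x = 0"
    by (rule C1_compact_bounded_support[OF \<psi>]) blast
  have c2: "continuous_on closed_half_space (gradient \<psi>)" by (rule C1_compact_continuous_gradient[OF \<psi>])
  show "square_integrable (lebesgue_on half_space) (gradient \<psi>)"
    unfolding square_integrable_def
    by (intro conjI borel_measurable_half_space c2 integrable_compact_support_half_space(2)[where B=B]
        continuous_intros) (auto simp: B)
qed

text \<open>The form is continuous in its second argument for the three weighted norms, and
  \<open>admissible\<close> supplies an approximation by compactly supported test functions in
  exactly these norms.\<close>

lemma robin_solution_admissible:
  assumes v: "robin_solution v g T" and w: "admissible w h U"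
  shows "robin_form v g T w h U = 0"
proof -
  obtain \<phi> where \<phi>: "\<And>k. C1_compact (\<phi> k)"
    "L2_lim (lebesgue_on half_space) (\<lambda>k x. \<phi> k x / wt x) (\<lambda>x. w x / wt x)"
    "L2_lim (lebesgue_on half_space) (\<lambda>k. gradient (\<phi> k)) h"
    "L2_lim lebesgue (\<lambda>k y. \<phi> k (y, 0) / sqrt (wt (y, 0))) (\<lambda>y. U y / sqrt (wt (y, 0)))"
    using w unfolding admissible_def by blast
  have sv: "square_integrable (lebesgue_on half_space) (\<lambda>x. v x / wt x)" "square_integrable (lebesgue_on half_space) g"
    "square_integrable lebesgue (\<lambda>y. T y / sqrt (wt (y, 0)))"
    using v unfolding robin_solution_def admissible_def by auto
  have sw: "square_integrable (lebesgue_on half_space) (\<lambda>x. w x / wt x)" "square_integrable (lebesgue_on half_space) h"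
    "square_integrable lebesgue (\<lambda>y. U y / sqrt (wt (y, 0)))"
    using w unfolding admissible_def by auto
  note s\<phi> = C1_compact_square_integrable[OF \<phi>(1)]
  have "(\<lambda>k. robin_form v g T (\<phi> k) (gradient (\<phi> k)) (\<lambda>y. \<phi> k (y, 0))) \<longlonglongrightarrow> robin_form v g T w h U"
    unfolding robin_form_def
    by (intro tendsto_diff tendsto_add tendsto_mult_left
      L2_lim_inner[OF s\<phi>(1) sw(1) sv(1) \<phi>(2), unfolded inner_real_def]
      L2_lim_inner[OF s\<phi>(2) sw(2) sv(2) \<phi>(3)]
      L2_lim_inner[OF s\<phi>(3) sw(3) sv(3) \<phi>(4), unfolded inner_real_def])
  moreover have "robin_form v g T (\<phi> k) (gradient (\<phi> k)) (\<lambda>y. \<phi> k (y, 0)) = 0" for k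
    using v \<phi>(1) unfolding robin_solution_def by blast
  ultimately have "(\<lambda>k::nat. 0) \<longlonglongrightarrow> robin_form v g T w h U" by simp
  then show ?thesis by (simp only: tendsto_const_iff trivial_limit_sequentially simp_thms)
qed

lemma admissible_diff:
  fixes v w :: "(real^'m) \<times> real \<Rightarrow> real"
  assumes v: "admissible v g T" and w: "admissible w h U"
  shows "admissible (\<lambda>x. v x - w x) (\<lambda>x. g x - h x) (\<lambda>y. T y - U y)"
proof -
  obtain \<phi> where \<phi>: "\<And>k. C1_compact (\<phi> k)"
    "L2_lim (lebesgue_on half_space) (\<lambda>k x. \<phi> k x / wt x) (\<lambda>x. v x / wt x)"
    "L2_lim (lebesgue_on half_space) (\<lambda>k. gradient (\<phi> k)) g"
    "L2_lim lebesgue (\<lambda>k y. \<phi> k (y, 0) / sqrt (wt (y, 0))) (\<lambda>y. T y / sqrt (wt (y, 0)))"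
    using v unfolding admissible_def by blast
  obtain \<psi> where \<psi>: "\<And>k. C1_compact (\<psi> k)"
    "L2_lim (lebesgue_on half_space) (\<lambda>k x. \<psi> k x / wt x) (\<lambda>x. w x / wt x)"
    "L2_lim (lebesgue_on half_space) (\<lambda>k. gradient (\<psi> k)) h"
    "L2_lim lebesgue (\<lambda>k y. \<psi> k (y, 0) / sqrt (wt (y, 0))) (\<lambda>y. U y / sqrt (wt (y, 0)))"
    using w unfolding admissible_def by blast
  have sv: "square_integrable (lebesgue_on half_space) (\<lambda>x. v x / wt x)" "square_integrable (lebesgue_on half_space) g"
    "square_integrable lebesgue (\<lambda>y. T y / sqrt (wt (y, 0)))"
    using v unfolding admissible_def by auto
  have sw: "square_integrable (lebesgue_on half_space) (\<lambda>x. w x / wt x)" "square_integrable (lebesgue_on half_space) h"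
    "square_integrable lebesgue (\<lambda>y. U y / sqrt (wt (y, 0)))"
    using w unfolding admissible_def by auto
  note s\<phi> = C1_compact_square_integrable[OF \<phi>(1)] and s\<psi> = C1_compact_square_integrable[OF \<psi>(1)]
  show ?thesis
    unfolding admissible_def
  proof (intro conjI exI[of _ "\<lambda>k x. \<phi> k x - \<psi> k x"] allI)
    show "C1_compact (\<lambda>x. \<phi> k x - \<psi> k x)" for k by (rule C1_compact_diff(1)[OF \<phi>(1) \<psi>(1)])
    show "L2_lim (lebesgue_on half_space) (\<lambda>k x. (\<phi> k x - \<psi> k x) / wt x) (\<lambda>x. (v x - w x) / wt x)"
      unfolding diff_divide_distrib by (rule L2_lim_diff[OF s\<phi>(1) sv(1) \<phi>(2) s\<psi>(1) sw(1) \<psi>(2)])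
    have "gradient (\<lambda>x. \<phi> k x - \<psi> k x) = (\<lambda>x. gradient (\<phi> k) x - gradient (\<psi> k) x)" for k
      by (rule ext, rule C1_compact_diff(2)[OF \<phi>(1) \<psi>(1)])
    then show "L2_lim (lebesgue_on half_space) (\<lambda>k. gradient (\<lambda>x. \<phi> k x - \<psi> k x)) (\<lambda>x. g x - h x)"
      using L2_lim_diff[OF s\<phi>(2) sv(2) \<phi>(3) s\<psi>(2) sw(2) \<psi>(3)] by (simp only:)
    show "L2_lim lebesgue (\<lambda>k y. (\<phi> k (y, 0) - \<psi> k (y, 0)) / sqrt (wt (y, 0))) (\<lambda>y. (T y - U y) / sqrt (wt (y, 0)))"
      unfolding diff_divide_distrib by (rule L2_lim_diff[OF s\<phi>(3) sv(3) \<phi>(4) s\<psi>(3) sw(3) \<psi>(4)])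
    show "square_integrable (lebesgue_on half_space) (\<lambda>x. (v x - w x) / wt x)"
      unfolding diff_divide_distrib by (rule square_integrable_diff[OF sv(1) sw(1)])
    show "square_integrable (lebesgue_on half_space) (\<lambda>x. g x - h x)"
      by (rule square_integrable_diff[OF sv(2) sw(2)])
    show "square_integrable lebesgue (\<lambda>y. (T y - U y) / sqrt (wt (y, 0)))"
      unfolding diff_divide_distrib by (rule square_integrable_diff[OF sv(3) sw(3)])
  qed
qed

lemma robin_solution_diff:
  fixes v w :: "(real^'m) \<times> real \<Rightarrow> real"
  assumes v: "robin_solution v g T" and w: "robin_solution w h U"
  shows "robin_solution (\<lambda>x. v x - w x) (\<lambda>x. g x - h x) (\<lambda>y. T y - U y)"
  unfolding robin_solution_def
proof (intro conjI allI impI)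
  show "admissible (\<lambda>x. v x - w x) (\<lambda>x. g x - h x) (\<lambda>y. T y - U y)"
    using v w unfolding robin_solution_def by (blast intro: admissible_diff)
  fix \<psi> :: "(real^'m) \<times> real \<Rightarrow> real" assume \<psi>: "C1_compact \<psi>"
  have sv: "square_integrable (lebesgue_on half_space) (\<lambda>x. v x / wt x)" "square_integrable (lebesgue_on half_space) g"
    "square_integrable lebesgue (\<lambda>y. T y / sqrt (wt (y, 0)))"
    using v unfolding robin_solution_def admissible_def by auto
  have sw: "square_integrable (lebesgue_on half_space) (\<lambda>x. w x / wt x)" "square_integrable (lebesgue_on half_space) h"
    "square_integrable lebesgue (\<lambda>y. U y / sqrt (wt (y, 0)))"
    using w unfolding robin_solution_def admissible_def by auto
  note s = C1_compact_square_integrable[OF \<psi>]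
  have "robin_form (\<lambda>x. v x - w x) (\<lambda>x. g x - h x) (\<lambda>y. T y - U y) \<psi> (gradient \<psi>) (\<lambda>y. \<psi> (y, 0))
      = robin_form v g T \<psi> (gradient \<psi>) (\<lambda>y. \<psi> (y, 0)) - robin_form w h U \<psi> (gradient \<psi>) (\<lambda>y. \<psi> (y, 0))"
  proof -
    have 1: "(\<integral>x. (g x - h x) \<bullet> gradient \<psi> x \<partial>lebesgue_on half_space)
        = (\<integral>x. g x \<bullet> gradient \<psi> x \<partial>lebesgue_on half_space) - (\<integral>x. h x \<bullet> gradient \<psi> x \<partial>lebesgue_on half_space)"
      unfolding inner_diff_left
      by (rule Bochner_Integration.integral_diff[OF square_integrable_inner[OF sv(2) s(2)] square_integrable_inner[OF sw(2) s(2)]])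
    have 2: "(\<integral>x. ((v x - w x) / wt x) * (\<psi> x / wt x) \<partial>lebesgue_on half_space)
        = (\<integral>x. (v x / wt x) * (\<psi> x / wt x) \<partial>lebesgue_on half_space) - (\<integral>x. (w x / wt x) * (\<psi> x / wt x) \<partial>lebesgue_on half_space)"
      unfolding diff_divide_distrib left_diff_distrib
      by (rule Bochner_Integration.integral_diff[OF square_integrable_inner[OF sv(1) s(1), unfolded inner_real_def]
            square_integrable_inner[OF sw(1) s(1), unfolded inner_real_def]])
    have 3: "(\<integral>y. ((T y - U y) / sqrt (wt (y, 0))) * (\<psi> (y, 0) / sqrt (wt (y, 0))) \<partial>lebesgue)
        = (\<integral>y. (T y / sqrt (wt (y, 0))) * (\<psi> (y, 0) / sqrt (wt (y, 0))) \<partial>lebesgue)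
          - (\<integral>y. (U y / sqrt (wt (y, 0))) * (\<psi> (y, 0) / sqrt (wt (y, 0))) \<partial>lebesgue)"
      unfolding diff_divide_distrib left_diff_distrib
      by (rule Bochner_Integration.integral_diff[OF square_integrable_inner[OF sv(3) s(3), unfolded inner_real_def]
            square_integrable_inner[OF sw(3) s(3), unfolded inner_real_def]])
    show ?thesis unfolding robin_form_def 1 2 3 by (simp only: right_diff_distrib)
  qed
  also have "\<dots> = 0" using v w \<psi> unfolding robin_solution_def by simp
  finally show "robin_form (\<lambda>x. v x - w x) (\<lambda>x. g x - h x) (\<lambda>y. T y - U y) \<psi> (gradient \<psi>) (\<lambda>y. \<psi> (y, 0)) = 0" .
qed

text \<open>The boundary integral is the one term of the form with a negative sign. With zero trace
  it disappears, and testing \<open>v\<close> with itself leaves two nonnegative terms with sum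
  0.\<close>

lemma robin_solution_zero_trace:
  fixes v :: "(real^'m) \<times> real \<Rightarrow> real"
  assumes v: "robin_solution v g T" and T: "AE y in lebesgue. T y = 0"
  shows "AE x in lebesgue_on half_space. v x = 0"
proof -
  have a: "admissible v g T" using v unfolding robin_solution_def by blast
  have sv: "square_integrable (lebesgue_on half_space) (\<lambda>x. v x / wt x)" "square_integrable (lebesgue_on half_space) g"
    using a unfolding admissible_def by auto
  have T0: "(\<integral>y. (T y / sqrt (wt (y, 0))) * (T y / sqrt (wt (y, 0))) \<partial>lebesgue) = 0"
    by (rule integral_eq_zero_AE) (use T in eventually_elim, simp)
  have "robin_form v g T v g T = 0" by (rule robin_solution_admissible[OF v a])
  then have e: "(\<integral>x. g x \<bullet> g x \<partial>lebesgue_on half_space)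
     + (real CARD('m) + 1) * (real CARD('m) + 3) * (\<integral>x. (v x / wt x) * (v x / wt x) \<partial>lebesgue_on half_space) = 0"
    unfolding robin_form_def T0 by simp
  define X where "X = (\<integral>x. (v x / wt x) * (v x / wt x) \<partial>lebesgue_on half_space)"
  define c where "c = (real CARD('m) + 1) * (real CARD('m) + 3)"
  have "0 \<le> (\<integral>x. g x \<bullet> g x \<partial>lebesgue_on half_space)"
    by (rule integral_nonneg_AE, rule AE_I2, rule inner_ge_zero)
  moreover have X: "0 \<le> X" unfolding X_def by (rule integral_nonneg_AE, rule AE_I2, rule zero_le_square)
  moreover have c: "c > 0" unfolding c_def by (intro mult_pos_pos) auto
  moreover have "0 \<le> c * X" using X c by simp
  ultimately have "c * X = 0" using e unfolding X_def c_def by linarith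
  with c have "X = 0" by simp
  then have "(\<integral>x. (v x / wt x) * (v x / wt x) \<partial>lebesgue_on half_space) = 0" unfolding X_def .
  moreover have "integrable (lebesgue_on half_space) (\<lambda>x. (v x / wt x) * (v x / wt x))"
    using square_integrable_inner[OF sv(1) sv(1)] by (simp only: inner_real_def)
  ultimately have "AE x in lebesgue_on half_space. (v x / wt x) * (v x / wt x) = 0"
    using integral_nonneg_eq_0_iff_AE[of "lebesgue_on half_space" "\<lambda>x. (v x / wt x) * (v x / wt x)"]
    by (simp only: zero_le_square AE_I2 simp_thms)
  moreover have "AE x::(real^'m) \<times> real in lebesgue_on half_space. wt x \<noteq> 0"
    by (rule AE_I2) (auto simp: half_space_def wt_nonzero)
  ultimately show ?thesis by eventually_elim simp
qed

section \<open>Cutoffs and test functions without compact support\<close>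

text \<open>On the closed half-space \<open>wt \<ge> kk\<close>, so there only the second factor matters; the first one removes the zero set of
  \<open>wt\<close> below the boundary.\<close>

definition cut :: "nat \<Rightarrow> real \<Rightarrow> real" where
  "cut k r = smooth_step (2 * r / kk - 1) * smooth_step (2 - r / real (Suc k))"

definition cut' :: "nat \<Rightarrow> real \<Rightarrow> real" where
  "cut' k r = smooth_step' (2 * r / kk - 1) * (2 / kk) * smooth_step (2 - r / real (Suc k))
    + smooth_step' (2 - r / real (Suc k)) * (- 1 / real (Suc k)) * smooth_step (2 * r / kk - 1)"

lemma cut_derivative: "(cut k has_real_derivative cut' k r) (at r)"
proof -
  have 1: "((\<lambda>r. 2 * r / kk - 1) has_real_derivative 2 / kk) (at r)"
    using kk_pos by (auto intro!: derivative_eq_intros)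
  have 2: "((\<lambda>r. 2 - r / real (Suc k)) has_real_derivative - 1 / real (Suc k)) (at r)"
    using kk_pos by (auto intro!: derivative_eq_intros)
  show ?thesis unfolding cut_def[abs_def] cut'_def
    by (rule DERIV_mult[OF smooth_step_derivative[OF 1] smooth_step_derivative[OF 2]])
qed

lemma continuous_on_cut: "continuous_on S (cut k)"
  using cut_derivative DERIV_isCont by (blast intro: continuous_at_imp_continuous_on)

lemma continuous_on_cut': "continuous_on S (cut' k)"
  unfolding cut'_def[abs_def] using kk_pos by (intro continuous_intros) auto

lemma cut_eq_0: "r \<le> kk / 2 \<or> r \<ge> 2 * real (Suc k) \<Longrightarrow> cut k r = 0"
  and cut'_eq_0: "r \<le> kk / 2 \<Longrightarrow> cut' k r = 0"
  using kk_pos by (auto simp: cut_def cut'_def smooth_step_eq_0 smooth_step'_eq_0 field_simps)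

lemma cut_bounds: "0 \<le> cut k r" "cut k r \<le> 1"
  unfolding cut_def using smooth_step_bounds by (auto intro: mult_le_one)

lemma cut_eventually:
  assumes "kk \<le> r" "r \<le> real (Suc k)"
  shows "cut k r = 1" "cut' k r = 0"
proof -
  have "2 * r / kk - 1 \<ge> 1" "2 - r / real (Suc k) \<ge> 1" using assms kk_pos by (auto simp: field_simps)
  then show "cut k r = 1" "cut' k r = 0" by (auto simp: cut_def cut'_def smooth_step_eq_1 smooth_step'_eq_0)
qed

text \<open>Above \<open>kk\<close> the derivative lives between \<open>k + 1\<close> and
  \<open>2 * (k + 1)\<close>, where \<open>1 / (k + 1) <= 2 / r\<close>. This trades the factor
  \<open>1 / (k + 1)\<close> for a bound independent of \<open>k\<close>.\<close>

lemma cut'_bound: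
  assumes C: "\<And>r. \<bar>smooth_step' r\<bar> \<le> C" and r: "kk \<le> r"
  shows "\<bar>cut' k r\<bar> \<le> 2 * C / r"
proof -
  have r0: "r > 0" using r kk_pos by linarith
  have C0: "C \<ge> 0" using C[of 0] by linarith
  have "2 * r / kk - 1 \<ge> 1" using r kk_pos by (auto simp: field_simps)
  then have e: "cut' k r = smooth_step' (2 - r / real (Suc k)) * (- 1 / real (Suc k))"
    by (simp add: cut'_def smooth_step'_eq_0 smooth_step_eq_1)
  show ?thesis
  proof (cases "r \<ge> 2 * real (Suc k)")
    case True
    then have "2 - r / real (Suc k) \<le> 0" by (simp add: field_simps)
    then show ?thesis using e r0 C0 by (simp add: smooth_step'_eq_0)
  next
    case False
    have "\<bar>cut' k r\<bar> = \<bar>smooth_step' (2 - r / real (Suc k))\<bar> * (1 / real (Suc k))"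
      unfolding e abs_mult by simp
    also have "\<dots> \<le> C * (2 / r)"
      using False r0 C0 by (intro mult_mono C) (auto simp: field_simps)
    finally show ?thesis by (simp add: mult.commute)
  qed
qed

lemma wt_has_derivative:
  fixes x :: "(real^'m) \<times> real"
  shows "(wt has_derivative (\<lambda>h. (2 *\<^sub>R x + (0, 2 * D)) \<bullet> h)) (at x)"
proof -
  have "(wt :: (real^'m) \<times> real \<Rightarrow> real) = (\<lambda>x. 1 * (norm x)\<^sup>2 + (0, 2 * D) \<bullet> x + kk)"
    by (auto simp: wt_def fun_eq_iff inner_prod_def)
  then show ?thesis
    using lap_on_has_derivative[OF lap_on_quadratic[of UNIV 1 "(0, 2 * D)" kk], of x] by simp
qed

lemma norm_wt_gradient:
  assumes "snd x \<ge> 0"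
  shows "norm (2 *\<^sub>R x + (0, 2 * D)) \<le> 2 * sqrt (1 + 1 / kk) * wt x powr (1 / 2)"
proof -
  have "norm (2 *\<^sub>R x + (0, 2 * D)) = 2 * norm (x + (0, D))"
  proof -
    have "2 *\<^sub>R x + (0, 2 * D) = 2 *\<^sub>R (x + (0, D))" by (simp add: scaleR_add_right)
    then show ?thesis by (metis abs_numeral norm_scaleR)
  qed
  also have "norm (x + (0, D)) = sqrt (wt x + 1)" by (simp add: wt_eq)
  also have "\<dots> \<le> sqrt ((1 + 1 / kk) * wt x)"
    using wt_ge_kk[OF assms] kk_pos by (simp add: field_simps)
  also have "\<dots> = sqrt (1 + 1 / kk) * wt x powr (1 / 2)"
    using wt_pos[OF assms] by (simp add: real_sqrt_mult powr_half_sqrt)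
  finally show ?thesis by simp
qed

text \<open>The function is truncated by \<open>cut k (wt x)\<close>. The extra gradient term is at
  most a constant times \<open>wt powr ((1 - M) / 2)\<close> for the function, \<open>1 / wt\<close>
  for the cutoff and \<open>wt powr (1 / 2)\<close> for the gradient of \<open>wt\<close>, with
  \<open>M = CARD('m)\<close>; the product has the same order \<open>wt powr (- M / 2)\<close> as
  \<open>G\<close>. Hence one square-integrable majorant works for all \<open>k\<close>.\<close>

lemma decay_admissible:
  fixes \<phi> :: "(real^'m) \<times> real \<Rightarrow> real"
  assumes m: "CARD('m) \<ge> 2"
    and d: "\<And>x. wt x > 0 \<Longrightarrow> (\<phi> has_derivative (\<lambda>h. G x \<bullet> h)) (at x)"
    and cG: "continuous_on {x. wt x > 0} G"
    and b1: "\<And>x. snd x \<ge> 0 \<Longrightarrow> \<bar>\<phi> x\<bar> \<le> C * wt x powr ((1 - real CARD('m)) / 2)"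
    and b2: "\<And>x. snd x \<ge> 0 \<Longrightarrow> norm (G x) \<le> C * wt x powr (- real CARD('m) / 2)"
  shows "admissible \<phi> G (\<lambda>y. \<phi> (y, 0))"
proof -
  let ?M = "real CARD('m)"
  let ?H = "lebesgue_on half_space :: ((real^'m) \<times> real) measure"
  have C: "C \<ge> 0"
  proof -
    have "0 \<le> C * wt (0::(real^'m) \<times> real) powr (- ?M / 2)" using b2[of 0] norm_ge_zero[of "G 0"] by (simp del: norm_ge_zero)
    moreover have "wt (0::(real^'m) \<times> real) powr (- ?M / 2) > 0" using wt_pos[of "0::(real^'m) \<times> real"] by simp
    ultimately show ?thesis by (simp add: zero_le_mult_iff)
  qed
  obtain C0 where C0: "C0 > 0" "\<And>r. \<bar>smooth_step' r\<bar> \<le> C0" using smooth_step'_bound by blast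
  define C1 where "C1 = 2 * sqrt (1 + 1 / kk)"
  have C1: "C1 \<ge> 0" using kk_pos by (simp add: C1_def)
  define nw where "nw = (\<lambda>x::(real^'m) \<times> real. 2 *\<^sub>R x + (0, 2 * D))"
  define \<phi>k where "\<phi>k = (\<lambda>k x. cut k (wt x) * \<phi> x)"
  \<comment> \<open>Nothing is known about \<open>G\<close> where \<open>wt\<close> is not positive.
    There the cutoff vanishes identically, already on the open set \<open>wt < kk / 2\<close>
    overlapping \<open>wt > 0\<close>, so the value 0 glues smoothly.\<close>
  define Gk where "Gk = (\<lambda>k x. if wt x > 0 then cut k (wt x) *\<^sub>R G x + (\<phi> x * cut' k (wt x)) *\<^sub>R nw x else 0)"
  have c\<phi>: "continuous_on {x. wt x > 0} \<phi>"
    using d has_derivative_continuous by (blast intro: continuous_at_imp_continuous_on)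
  have ccut: "continuous_on S (\<lambda>x. cut k (wt x))" "continuous_on S (\<lambda>x. cut' k (wt x))" for S :: "((real^'m) \<times> real) set" and k
    by (rule continuous_on_compose2[OF _ continuous_on_wt[OF continuous_on_id], of UNIV];
        simp add: continuous_on_cut continuous_on_cut')+
  have op: "open {x::(real^'m) \<times> real. wt x < kk / 2}"
    by (intro open_Collect_less continuous_intros continuous_on_id)
  have small: "wt x < kk / 2" if "\<not> wt x > 0" for x :: "(real^'m) \<times> real" using that kk_pos by linarith
  have dk: "(\<phi>k k has_derivative (\<lambda>h. Gk k x \<bullet> h)) (at x)" for k x
  proof (cases "wt x > 0")
    case True
    have dc: "((\<lambda>x. cut k (wt x)) has_derivative (\<lambda>h. cut' k (wt x) * (nw x \<bullet> h))) (at x)"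
      using has_derivative_compose[OF wt_has_derivative[of x] cut_derivative[of k "wt x", unfolded has_field_derivative_def]]
      by (simp add: nw_def)
    show ?thesis
      using has_derivative_mult[OF dc d[OF True]] True
      unfolding \<phi>k_def Gk_def by (simp add: inner_add_left mult_ac)
  next
    case False
    have "((\<lambda>_. 0) has_derivative (\<lambda>h. Gk k x \<bullet> h)) (at x)" using False by (simp add: Gk_def)
    then show ?thesis
      by (rule has_derivative_transform_within_open[OF _ op])
        (use small[OF False] in \<open>auto simp: \<phi>k_def cut_eq_0\<close>)
  qed
  have cGk: "continuous_on UNIV (Gk k)" for k
  proof -
    have "continuous_on {x. wt x > 0} (\<lambda>x. cut k (wt x) *\<^sub>R G x + (\<phi> x * cut' k (wt x)) *\<^sub>R nw x)"
      unfolding nw_def by (intro continuous_intros ccut cG c\<phi>)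
    then have 1: "continuous_on {x. wt x > 0} (Gk k)"
      by (subst continuous_on_cong[OF refl]) (auto simp: Gk_def)
    have 2: "continuous_on {x. wt x < kk / 2} (Gk k)"
      by (subst continuous_on_cong[OF refl, of _ _ "\<lambda>_. 0"]) (auto simp: Gk_def cut_eq_0 cut'_eq_0)
    have "{x::(real^'m) \<times> real. wt x > 0} \<union> {x. wt x < kk / 2} = UNIV" using small by blast
    with continuous_on_open_Un[OF open_wt_pos op 1 2] show ?thesis by simp
  qed
  have C1c: "C1_compact (\<phi>k k)" for k
  proof (rule C1_compactI[OF dk cGk])
    fix x assume "\<phi>k k x \<noteq> 0"
    then have "wt x < 2 * real (Suc k)" using cut_eq_0[of "wt x" k] unfolding \<phi>k_def by force
    then have "(norm (x + (0, D)))\<^sup>2 \<le> 2 * real (Suc k) + 1" unfolding wt_eq by simp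
    then have "norm (x + (0, D)) \<le> sqrt (2 * real (Suc k) + 1)" using real_le_rsqrt by blast
    moreover have "norm x \<le> norm (x + (0, D)) + norm ((0, D) :: (real^'m) \<times> real)"
      using norm_triangle_ineq4[of "x + (0, D)" "(0, D)"] by simp
    ultimately show "norm x \<le> sqrt (2 * real (Suc k) + 1) + norm ((0, D) :: (real^'m) \<times> real)" by linarith
  qed
  have grad: "gradient (\<phi>k k) = Gk k" for k using gradient_eqI[OF dk] by blast
  have ev: "\<forall>\<^sub>F k in sequentially. cut k (wt x) = 1 \<and> cut' k (wt x) = 0" if "snd x \<ge> 0" for x :: "(real^'m) \<times> real"
  proof -
    obtain N :: nat where N: "wt x < real N" using reals_Archimedean2 by blast
    show ?thesis using eventually_ge_at_top[of N]
    proof eventually_elim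
      case (elim k)
      then show ?case using N wt_ge_kk[OF that] by (intro conjI cut_eventually) auto
    qed
  qed
  define W where "W = (\<lambda>x::(real^'m) \<times> real. (C + 2 * C0 * C1 * C) * wt x powr (- ?M / 2))"
  have W2: "integrable ?H (\<lambda>x. (W x)\<^sup>2)"
  proof -
    have "(\<lambda>x. (W x)\<^sup>2) = (\<lambda>x. (C + 2 * C0 * C1 * C)\<^sup>2 * wt x powr (- ?M))"
      unfolding W_def by (simp add: power_mult_distrib power2_eq_square[of "_ powr _"] flip: powr_add)
    then show ?thesis using integrable_wt_half_space[OF m] by simp
  qed
  have CW: "C * wt x powr (- ?M / 2) \<le> W x" for x :: "(real^'m) \<times> real"
    unfolding W_def using C C0 C1 by (intro mult_right_mono) auto
  have GkW: "norm (Gk k x) \<le> W x" if x: "snd x \<ge> 0" for k x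
  proof -
    have p: "wt x > 0" by (rule wt_pos[OF x])
    have "norm (Gk k x) \<le> norm (cut k (wt x) *\<^sub>R G x) + norm ((\<phi> x * cut' k (wt x)) *\<^sub>R nw x)"
      unfolding Gk_def by (simp only: p if_True norm_triangle_ineq)
    also have "norm (cut k (wt x) *\<^sub>R G x) \<le> 1 * (C * wt x powr (- ?M / 2))"
      unfolding norm_scaleR using cut_bounds[of k "wt x"] b2[OF x] by (intro mult_mono) auto
    also have "norm ((\<phi> x * cut' k (wt x)) *\<^sub>R nw x)
        \<le> ((C * wt x powr ((1 - ?M) / 2)) * (2 * C0 / wt x)) * (C1 * wt x powr (1 / 2))"
      unfolding norm_scaleR real_norm_def abs_mult
      using b1[OF x] cut'_bound[OF C0(2) wt_ge_kk[OF x]] norm_wt_gradient[OF x] C C0(1) p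
      unfolding nw_def C1_def by (intro mult_mono) auto
    also have "\<dots> = 2 * C0 * C1 * C * wt x powr (- ?M / 2)"
    proof -
      have "(1 - ?M) / 2 + 1 / 2 = - ?M / 2 + 1" by (simp add: field_simps)
      then have "wt x powr ((1 - ?M) / 2) * wt x powr (1 / 2) = wt x powr (- ?M / 2) * wt x"
        using p powr_add[of "wt x" "(1 - ?M) / 2" "1 / 2"] powr_add[of "wt x" "- ?M / 2" 1] by (simp only: powr_one)
      then show ?thesis using p by (simp add: field_simps)
    qed
    finally show ?thesis by (simp add: W_def algebra_simps)
  qed
  have GW: "norm (G x) \<le> W x" if "snd x \<ge> 0" for x using b2[OF that] CW[of x] by linarith
  have cGH: "continuous_on closed_half_space G"
    by (rule continuous_on_subset[OF cG closed_half_space_subset_wt])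
  have c\<phi>H: "continuous_on closed_half_space (\<lambda>x. \<phi> x / wt x)"
    by (intro continuous_intros continuous_on_subset[OF c\<phi> closed_half_space_subset_wt] continuous_on_id) (auto simp: wt_nonzero)
  have \<phi>wt: "\<bar>\<phi> x / wt x\<bar> \<le> (C * kk powr (- 1 / 2)) * wt x powr (- ?M / 2)" if x: "snd x \<ge> 0" for x
  proof -
    have p: "wt x > 0" by (rule wt_pos[OF x])
    have "\<bar>\<phi> x / wt x\<bar> \<le> C * wt x powr ((1 - ?M) / 2) / wt x"
      using b1[OF x] p by (simp add: divide_right_mono)
    also have "\<dots> = C * wt x powr ((1 - ?M) / 2 - 1)" using p by (simp add: powr_diff)
    also have "\<dots> \<le> C * (kk powr ((1 - ?M) / 2 - 1 - (- ?M / 2)) * wt x powr (- ?M / 2))"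
      using wt_powr_le[OF x, of "(1 - ?M) / 2 - 1" "- ?M / 2"] C by (intro mult_left_mono) (auto simp: field_simps)
    also have "(1 - ?M) / 2 - 1 - (- ?M / 2) = - 1 / 2" by (simp add: field_simps)
    finally show ?thesis by simp
  qed
  define V where "V = (\<lambda>x::(real^'m) \<times> real. (C * kk powr (- 1 / 2)) * wt x powr (- ?M / 2))"
  have V2: "integrable ?H (\<lambda>x. (V x)\<^sup>2)"
  proof -
    have "(\<lambda>x. (V x)\<^sup>2) = (\<lambda>x. (C * kk powr (- 1 / 2))\<^sup>2 * wt x powr (- ?M))"
      unfolding V_def by (simp add: power_mult_distrib power2_eq_square[of "wt _ powr _"] flip: powr_add)
    then show ?thesis using integrable_wt_half_space[OF m] by simp
  qed
  have cutV: "\<bar>\<phi>k k x / wt x\<bar> \<le> V x" if x: "snd x \<ge> 0" for k x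
  proof -
    have "\<bar>\<phi>k k x / wt x\<bar> = cut k (wt x) * \<bar>\<phi> x / wt x\<bar>"
      unfolding \<phi>k_def using cut_bounds[of k "wt x"] by (simp add: abs_mult)
    also have "\<dots> \<le> 1 * V x" unfolding V_def using \<phi>wt[OF x] cut_bounds[of k "wt x"] by (intro mult_mono) auto
    finally show ?thesis by simp
  qed
  let ?s = "\<lambda>y::real^'m. sqrt (wt (y, 0))"
  have s0: "?s y > 0" for y using wt_pos[of "(y, 0)"] by simp
  have bd: "\<bar>\<phi> (y, 0) / ?s y\<bar> \<le> C * wt (y, 0) powr (- ?M / 2)" for y
  proof -
    have p: "wt (y, 0) > 0" by (rule wt_pos) simp
    have "\<bar>\<phi> (y, 0) / ?s y\<bar> \<le> C * wt (y, 0) powr ((1 - ?M) / 2) / ?s y"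
      using b1[of "(y, 0)"] s0[of y] by (simp add: divide_right_mono)
    also have "\<dots> = C * wt (y, 0) powr ((1 - ?M) / 2 - 1 / 2)" using p by (simp add: powr_diff powr_half_sqrt)
    also have "(1 - ?M) / 2 - 1 / 2 = - ?M / 2" by (simp add: field_simps)
    finally show ?thesis .
  qed
  have cb: "continuous_on UNIV (\<lambda>y. \<phi> (y, 0) / ?s y)"
    using s0 by (intro continuous_intros continuous_on_compose2[OF c\<phi>, of UNIV "\<lambda>y. (y, 0)"])
      (auto simp: wt_nonzero intro: wt_pos)
  have mb: "f \<in> borel_measurable lebesgue" if "continuous_on UNIV f" for f :: "real^'m \<Rightarrow> real"
    using that by (intro measurable_completion) (simp add: borel_measurable_continuous_onI)
  have U2: "integrable lebesgue (\<lambda>y::real^'m. (C * wt (y, 0) powr (- ?M / 2))\<^sup>2)"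
  proof -
    have "(\<lambda>y::real^'m. (C * wt (y, 0) powr (- ?M / 2))\<^sup>2) = (\<lambda>y. C\<^sup>2 * wt (y, 0) powr (- ?M))"
      by (simp add: power_mult_distrib power2_eq_square[of "_ powr _"] flip: powr_add)
    then show ?thesis by (simp only:) (intro integrable_mult_right integrable_wt_boundary)
  qed
  show ?thesis unfolding admissible_def
  proof (intro conjI exI[of _ \<phi>k] allI)
    show "square_integrable ?H (\<lambda>x. \<phi> x / wt x)"
      by (rule square_integrable_half_space[OF m c\<phi>H]) (use \<phi>wt in simp)
    show "square_integrable ?H G" by (rule square_integrable_half_space[OF m cGH b2])
    show "square_integrable lebesgue (\<lambda>y. \<phi> (y, 0) / ?s y)"
      by (rule square_integrable_boundary[OF cb]) (use bd in simp)
    show "C1_compact (\<phi>k k)" for k by (rule C1c)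
    show "L2_lim ?H (\<lambda>k x. \<phi>k k x / wt x) (\<lambda>x. \<phi> x / wt x)"
    proof (rule L2_lim_dominated[OF _ _ V2])
      show "(\<lambda>x. \<phi>k k x / wt x) \<in> borel_measurable ?H" for k
        by (rule square_integrable_measurable[OF C1_compact_square_integrable(1)[OF C1c]])
      show "(\<lambda>x. \<phi> x / wt x) \<in> borel_measurable ?H" by (rule borel_measurable_half_space[OF c\<phi>H])
      fix x assume "x \<in> space ?H"
      then have x: "snd x \<ge> 0" by (simp add: half_space_def)
      show "norm (\<phi>k k x / wt x) \<le> V x" for k using cutV[OF x] by simp
      show "norm (\<phi> x / wt x) \<le> V x" using \<phi>wt[OF x] by (simp add: V_def)
      show "\<forall>\<^sub>F k in sequentially. \<phi>k k x / wt x = \<phi> x / wt x"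
        using ev[OF x] by eventually_elim (simp add: \<phi>k_def)
    qed
    show "L2_lim ?H (\<lambda>k. gradient (\<phi>k k)) G"
      unfolding grad
    proof (rule L2_lim_dominated[OF _ _ W2])
      show "Gk k \<in> borel_measurable ?H" for k
        by (rule borel_measurable_half_space[OF continuous_on_subset[OF cGk]]) simp
      show "G \<in> borel_measurable ?H" by (rule borel_measurable_half_space[OF cGH])
      fix x assume "x \<in> space ?H"
      then have x: "snd x \<ge> 0" by (simp add: half_space_def)
      show "norm (Gk k x) \<le> W x" for k by (rule GkW[OF x])
      show "norm (G x) \<le> W x" by (rule GW[OF x])
      show "\<forall>\<^sub>F k in sequentially. Gk k x = G x"
        using ev[OF x] by eventually_elim (simp add: Gk_def wt_pos[OF x])
    qed
    show "L2_lim lebesgue (\<lambda>k y. \<phi>k k (y, 0) / ?s y) (\<lambda>y. \<phi> (y, 0) / ?s y)"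
    proof (rule L2_lim_dominated[OF _ _ U2])
      show "(\<lambda>y. \<phi>k k (y, 0) / ?s y) \<in> borel_measurable lebesgue" for k
        by (rule square_integrable_measurable[OF C1_compact_square_integrable(3)[OF C1c]])
      show "(\<lambda>y. \<phi> (y, 0) / ?s y) \<in> borel_measurable lebesgue" by (rule mb[OF cb])
      fix y :: "real^'m"
      show "norm (\<phi> (y, 0) / ?s y) \<le> C * wt (y, 0) powr (- ?M / 2)" using bd by simp
      have "\<bar>\<phi>k k (y, 0) / ?s y\<bar> = cut k (wt (y, 0)) * \<bar>\<phi> (y, 0) / ?s y\<bar>" for k
        unfolding \<phi>k_def using cut_bounds[of k "wt (y, 0)"] by (simp add: abs_mult)
      also have "cut k (wt (y, 0)) * \<bar>\<phi> (y, 0) / ?s y\<bar> \<le> 1 * (C * wt (y, 0) powr (- ?M / 2))" for k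
        using bd[of y] cut_bounds[of k "wt (y, 0)"] by (intro mult_mono) auto
      finally show "norm (\<phi>k k (y, 0) / ?s y) \<le> C * wt (y, 0) powr (- ?M / 2)" for k by simp
      show "\<forall>\<^sub>F k in sequentially. \<phi>k k (y, 0) / ?s y = \<phi> (y, 0) / ?s y"
        using ev[of "(y, 0)"] by (simp add: \<phi>k_def eventually_mono)
    qed
  qed
qed


text \<open>Here \<open>f\<close> and \<open>\<beta>\<close> measure how far \<open>\<phi>\<close>
  is from solving the interior equation and the boundary condition; by symmetry of the form,
  \<open>v\<close> is orthogonal to this failure. All derivatives end on the explicit
  \<open>\<phi>\<close>. The rates in \<open>b3\<close> and \<open>b4\<close> make
  \<open>wt * f\<close> and \<open>sqrt wt * \<beta>\<close> square integrable, to be paired with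
  the weighted \<open>v\<close> and \<open>T\<close>.\<close>

lemma robin_solution_test:
  fixes v \<phi> f :: "(real^'m) \<times> real \<Rightarrow> real"
  assumes m: "CARD('m) \<ge> 2"
    and v: "robin_solution v g T"
    and lap: "lap_on {x. wt x > 0} \<phi> G l"
    and b1: "\<And>x. snd x \<ge> 0 \<Longrightarrow> \<bar>\<phi> x\<bar> \<le> C * wt x powr ((1 - real CARD('m)) / 2)"
    and b2: "\<And>x. snd x \<ge> 0 \<Longrightarrow> norm (G x) \<le> C * wt x powr (- real CARD('m) / 2)"
    and l: "\<And>x. snd x \<ge> 0 \<Longrightarrow> l x = (real CARD('m) + 1) * (real CARD('m) + 3) * \<phi> x / (wt x)\<^sup>2 + f x"
    and b3: "\<And>x. snd x \<ge> 0 \<Longrightarrow> \<bar>f x\<bar> \<le> C * wt x powr (- (real CARD('m) + 3) / 2)"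
    and n: "\<And>y. G (y, 0) \<bullet> (0, 1) = - (real CARD('m) + 1) * D * \<phi> (y, 0) / wt (y, 0) + \<beta> y"
    and b4: "\<And>y. \<bar>\<beta> y\<bar> \<le> C * wt (y, 0) powr (- (real CARD('m) + 1) / 2)"
  shows "(\<integral>x. (v x / wt x) * (wt x * f x) \<partial>lebesgue_on half_space)
    + (\<integral>y. (T y / sqrt (wt (y, 0))) * (sqrt (wt (y, 0)) * \<beta> y) \<partial>lebesgue) = 0"
proof -
  let ?M = "real CARD('m)"
  let ?H = "lebesgue_on half_space :: ((real^'m) \<times> real) measure"
  let ?s = "\<lambda>y::real^'m. sqrt (wt (y, 0))"
  have s0: "?s y > 0" for y using wt_pos[of "(y, 0)"] by simp
  have C: "C \<ge> 0"
  proof -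
    have "0 \<le> C * wt (0::(real^'m) \<times> real) powr (- ?M / 2)" using b2[of 0] norm_ge_zero[of "G 0"] by (simp del: norm_ge_zero)
    moreover have "wt (0::(real^'m) \<times> real) powr (- ?M / 2) > 0" using wt_pos[of "0::(real^'m) \<times> real"] by simp
    ultimately show ?thesis by (simp add: zero_le_mult_iff)
  qed
  have a\<phi>: "admissible \<phi> G (\<lambda>y. \<phi> (y, 0))"
    by (rule decay_admissible[OF m lap_on_has_derivative[OF lap] lap_on_continuous_gradient[OF lap] b1 b2]) auto
  note S = closed_half_space_subset_wt
  have c\<phi>: "continuous_on closed_half_space \<phi>" by (rule continuous_on_subset[OF lap_on_continuous[OF lap] S])
  have cl: "continuous_on closed_half_space l" by (rule continuous_on_subset[OF lap_on_continuous_laplacian[OF lap] S])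
  have cG: "continuous_on closed_half_space G" by (rule continuous_on_subset[OF lap_on_continuous_gradient[OF lap] S])
  have c\<phi>w: "continuous_on closed_half_space (\<lambda>x. \<phi> x / wt x)"
    by (intro continuous_intros c\<phi> continuous_on_id) (auto simp: wt_nonzero)
  have cwf: "continuous_on closed_half_space (\<lambda>x. wt x * f x)"
  proof -
    have "continuous_on closed_half_space (\<lambda>x. wt x * (l x - (?M + 1) * (?M + 3) * \<phi> x / (wt x)\<^sup>2))"
      by (intro continuous_intros c\<phi> cl continuous_on_id) (auto simp: wt_nonzero)
    then show ?thesis by (subst continuous_on_cong[OF refl]) (auto simp: l)
  qed
  have si: "square_integrable ?H (\<lambda>x. \<phi> x / wt x)" "square_integrable lebesgue (\<lambda>y. \<phi> (y, 0) / ?s y)" "square_integrable ?H G"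
    using a\<phi> unfolding admissible_def by auto
  have swf: "square_integrable ?H (\<lambda>x. wt x * f x)"
  proof (rule square_integrable_half_space[OF m cwf])
    fix x :: "(real^'m) \<times> real" assume x: "snd x \<ge> 0"
    have p: "wt x > 0" by (rule wt_pos[OF x])
    have "norm (wt x * f x) \<le> wt x * (C * wt x powr (- (?M + 3) / 2))"
      using b3[OF x] p by (simp add: abs_mult)
    also have "\<dots> = C * wt x powr (- (?M + 3) / 2 + 1)" using p by (simp add: powr_add)
    also have "\<dots> \<le> C * (kk powr (- (?M + 3) / 2 + 1 - (- ?M / 2)) * wt x powr (- ?M / 2))"
      using wt_powr_le[OF x, of "- (?M + 3) / 2 + 1" "- ?M / 2"] C by (intro mult_left_mono) (auto simp: field_simps)
    finally show "norm (wt x * f x) \<le> (C * kk powr (- (?M + 3) / 2 + 1 - (- ?M / 2))) * wt x powr (- ?M / 2)" by simp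
  qed
  have cyn: "continuous_on UNIV (\<lambda>y. h (y, 0))" if "continuous_on closed_half_space h" for h :: "(real^'m) \<times> real \<Rightarrow> real"
    by (rule continuous_on_compose2[OF that]) (auto intro!: continuous_intros)
  have cs: "continuous_on UNIV ?s" by (intro continuous_intros)
  have cG1: "continuous_on closed_half_space (\<lambda>x. G x \<bullet> (0, 1))" by (intro continuous_intros cG)
  have c\<beta>: "continuous_on UNIV (\<lambda>y. ?s y * \<beta> y)"
  proof -
    have *: "\<beta> = (\<lambda>y. G (y, 0) \<bullet> (0, 1) + (?M + 1) * D * (\<phi> (y, 0) / wt (y, 0)))"
      unfolding n by (simp add: fun_eq_iff diff_divide_distrib add_divide_distrib algebra_simps)
    show ?thesis unfolding *
      by (intro continuous_on_mult continuous_on_add continuous_on_const cs cyn[OF c\<phi>w] cyn[OF cG1])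
  qed
  have s\<beta>: "square_integrable lebesgue (\<lambda>y. ?s y * \<beta> y)"
  proof (rule square_integrable_boundary[OF c\<beta>])
    fix y :: "real^'m"
    have p: "wt (y, 0) > 0" by (rule wt_pos) simp
    have "norm (?s y * \<beta> y) \<le> ?s y * (C * wt (y, 0) powr (- (?M + 1) / 2))"
      using b4[of y] s0[of y] by (simp add: abs_mult)
    also have "\<dots> = C * wt (y, 0) powr (1 / 2 + - (?M + 1) / 2)"
      using p by (simp add: powr_add powr_half_sqrt)
    also have "1 / 2 + - (?M + 1) / 2 = - ?M / 2" by (simp add: field_simps)
    finally show "norm (?s y * \<beta> y) \<le> C * wt (y, 0) powr (- ?M / 2)" .
  qed
  have av: "admissible v g T" using v unfolding robin_solution_def by blast
  then have sv: "square_integrable ?H (\<lambda>x. v x / wt x)" "square_integrable ?H g" "square_integrable lebesgue (\<lambda>y. T y / ?s y)"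
    unfolding admissible_def by auto
  obtain \<psi> where \<psi>: "\<And>k. C1_compact (\<psi> k)"
    "L2_lim ?H (\<lambda>k x. \<psi> k x / wt x) (\<lambda>x. v x / wt x)"
    "L2_lim ?H (\<lambda>k. gradient (\<psi> k)) g"
    "L2_lim lebesgue (\<lambda>k y. \<psi> k (y, 0) / ?s y) (\<lambda>y. T y / ?s y)"
    using av unfolding admissible_def by blast
  note s\<psi> = C1_compact_square_integrable[OF \<psi>(1)]
  define a where "a = (?M + 1) * (?M + 3)"
  define b where "b = (?M + 1) * D"
  \<comment> \<open>Green's formula is applied to the compactly supported approximants of
    \<open>v\<close>, not to \<open>v\<close> itself, and integrates by parts onto
    \<open>\<phi>\<close>.\<close>
  have each: "(\<integral>x. G x \<bullet> gradient (\<psi> k) x \<partial>?H)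
      = - (a * (\<integral>x. (\<phi> x / wt x) * (\<psi> k x / wt x) \<partial>?H) + (\<integral>x. (wt x * f x) * (\<psi> k x / wt x) \<partial>?H))
        - (- b * (\<integral>y. (\<phi> (y, 0) / ?s y) * (\<psi> k (y, 0) / ?s y) \<partial>lebesgue) + (\<integral>y. (?s y * \<beta> y) * (\<psi> k (y, 0) / ?s y) \<partial>lebesgue))" for k
  proof -
    have "(\<integral>x. \<psi> k x * l x \<partial>?H) = (\<integral>x. a * ((\<phi> x / wt x) * (\<psi> k x / wt x)) + (wt x * f x) * (\<psi> k x / wt x) \<partial>?H)"
    proof (rule Bochner_Integration.integral_cong[OF refl])
      fix x assume "x \<in> space ?H"
      then have x: "snd x \<ge> 0" by (simp add: half_space_def)
      show "\<psi> k x * l x = a * ((\<phi> x / wt x) * (\<psi> k x / wt x)) + (wt x * f x) * (\<psi> k x / wt x)"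
        unfolding l[OF x] a_def[symmetric] using wt_nonzero[OF x] by (simp add: field_simps power2_eq_square)
    qed
    also have "\<dots> = a * (\<integral>x. (\<phi> x / wt x) * (\<psi> k x / wt x) \<partial>?H) + (\<integral>x. (wt x * f x) * (\<psi> k x / wt x) \<partial>?H)"
    proof -
      have "(\<integral>x. a * ((\<phi> x / wt x) * (\<psi> k x / wt x)) \<partial>?H) = a * (\<integral>x. (\<phi> x / wt x) * (\<psi> k x / wt x) \<partial>?H)"
        by (rule integral_mult_right_zero)
      then show ?thesis
        using Bochner_Integration.integral_add[OF integrable_mult_right[OF square_integrable_inner[OF si(1) s\<psi>(1), unfolded inner_real_def], of a]
          square_integrable_inner[OF swf s\<psi>(1), unfolded inner_real_def]] by (simp only:)
    qed
    finally have 1: "(\<integral>x. \<psi> k x * l x \<partial>?H) = \<dots>" .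
    have "(\<integral>y. \<psi> k (y, 0) * (G (y, 0) \<bullet> (0, 1)) \<partial>lborel) = (\<integral>y. \<psi> k (y, 0) * (G (y, 0) \<bullet> (0, 1)) \<partial>lebesgue)"
    proof (rule integral_completion[symmetric])
      have "continuous_on UNIV (\<lambda>y. \<psi> k (y, 0) * (G (y, 0) \<bullet> (0, 1)))"
        by (intro continuous_on_mult cyn[OF cG1] cyn C1_compact_continuous[OF \<psi>(1)])
      then show "(\<lambda>y. \<psi> k (y, 0) * (G (y, 0) \<bullet> (0, 1))) \<in> borel_measurable lborel"
        by (simp add: borel_measurable_continuous_onI)
    qed
    also have "\<dots> = (\<integral>y. - b * ((\<phi> (y, 0) / ?s y) * (\<psi> k (y, 0) / ?s y)) + (?s y * \<beta> y) * (\<psi> k (y, 0) / ?s y) \<partial>lebesgue)"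
    proof (rule Bochner_Integration.integral_cong[OF refl])
      fix y :: "real^'m"
      have "?s y * ?s y = wt (y, 0)" using s0[of y] by simp
      then have q: "(\<phi> (y, 0) / ?s y) * (\<psi> k (y, 0) / ?s y) = \<phi> (y, 0) * \<psi> k (y, 0) / wt (y, 0)"
        by (simp only: times_divide_times_eq)
      have r: "(?s y * \<beta> y) * (\<psi> k (y, 0) / ?s y) = \<beta> y * \<psi> k (y, 0)" using s0[of y] by simp
      show "\<psi> k (y, 0) * (G (y, 0) \<bullet> (0, 1))
          = - b * ((\<phi> (y, 0) / ?s y) * (\<psi> k (y, 0) / ?s y)) + (?s y * \<beta> y) * (\<psi> k (y, 0) / ?s y)"
        unfolding q r n b_def by (simp add: algebra_simps)
    qed
    also have "\<dots> = - b * (\<integral>y. (\<phi> (y, 0) / ?s y) * (\<psi> k (y, 0) / ?s y) \<partial>lebesgue) + (\<integral>y. (?s y * \<beta> y) * (\<psi> k (y, 0) / ?s y) \<partial>lebesgue)"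
    proof -
      have "(\<integral>y. - b * ((\<phi> (y, 0) / ?s y) * (\<psi> k (y, 0) / ?s y)) \<partial>lebesgue) = - b * (\<integral>y. (\<phi> (y, 0) / ?s y) * (\<psi> k (y, 0) / ?s y) \<partial>lebesgue)"
        by (rule integral_mult_right_zero)
      then show ?thesis
        using Bochner_Integration.integral_add[OF integrable_mult_right[OF square_integrable_inner[OF si(2) s\<psi>(3), unfolded inner_real_def], of "- b"]
          square_integrable_inner[OF s\<beta> s\<psi>(3), unfolded inner_real_def]] by (simp only:)
    qed
    finally have 2: "(\<integral>y. \<psi> k (y, 0) * (G (y, 0) \<bullet> (0, 1)) \<partial>lborel) = \<dots>" .
    show ?thesis
      using green_half_space[OF \<psi>(1) lap S, of k] unfolding 1 2 by (simp only: inner_commute)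
  qed
  have "(\<lambda>k. - (a * (\<integral>x. (\<phi> x / wt x) * (\<psi> k x / wt x) \<partial>?H) + (\<integral>x. (wt x * f x) * (\<psi> k x / wt x) \<partial>?H))
        - (- b * (\<integral>y. (\<phi> (y, 0) / ?s y) * (\<psi> k (y, 0) / ?s y) \<partial>lebesgue) + (\<integral>y. (?s y * \<beta> y) * (\<psi> k (y, 0) / ?s y) \<partial>lebesgue)))
     \<longlonglongrightarrow> - (a * (\<integral>x. (\<phi> x / wt x) * (v x / wt x) \<partial>?H) + (\<integral>x. (wt x * f x) * (v x / wt x) \<partial>?H))
        - (- b * (\<integral>y. (\<phi> (y, 0) / ?s y) * (T y / ?s y) \<partial>lebesgue) + (\<integral>y. (?s y * \<beta> y) * (T y / ?s y) \<partial>lebesgue))"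
    by (intro tendsto_diff tendsto_minus tendsto_add tendsto_mult_left
      L2_lim_inner[OF s\<psi>(1) sv(1) si(1) \<psi>(2), unfolded inner_real_def]
      L2_lim_inner[OF s\<psi>(1) sv(1) swf \<psi>(2), unfolded inner_real_def]
      L2_lim_inner[OF s\<psi>(3) sv(3) si(2) \<psi>(4), unfolded inner_real_def]
      L2_lim_inner[OF s\<psi>(3) sv(3) s\<beta> \<psi>(4), unfolded inner_real_def])
  \<comment> \<open>The same sequence has two limits: one from convergence of the gradients, the
    other from Green's formula term by term. Comparing with the weak equation tested by
    \<open>\<phi>\<close> leaves only the defects \<open>f\<close> and
    \<open>\<beta>\<close>.\<close>
  from LIMSEQ_unique[OF this[folded each] L2_lim_inner[OF s\<psi>(2) sv(2) si(3) \<psi>(3)]]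
  have E2: "(\<integral>x. G x \<bullet> g x \<partial>?H) = - (a * (\<integral>x. (\<phi> x / wt x) * (v x / wt x) \<partial>?H) + (\<integral>x. (wt x * f x) * (v x / wt x) \<partial>?H))
        - (- b * (\<integral>y. (\<phi> (y, 0) / ?s y) * (T y / ?s y) \<partial>lebesgue) + (\<integral>y. (?s y * \<beta> y) * (T y / ?s y) \<partial>lebesgue))"
    by (rule sym)
  have E1: "(\<integral>x. G x \<bullet> g x \<partial>?H) + a * (\<integral>x. (\<phi> x / wt x) * (v x / wt x) \<partial>?H)
      - b * (\<integral>y. (\<phi> (y, 0) / ?s y) * (T y / ?s y) \<partial>lebesgue) = 0"
    using robin_solution_admissible[OF v a\<phi>] unfolding robin_form_def a_def b_def
    by (simp only: inner_commute mult.commute[of "v _ / wt _"] mult.commute[of "T _ / _"])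
  have "(\<integral>x. (wt x * f x) * (v x / wt x) \<partial>?H) + (\<integral>y. (?s y * \<beta> y) * (T y / ?s y) \<partial>lebesgue) = 0"
    using E1 E2 by (simp only: minus_mult_left[symmetric])
  then show ?thesis by (simp only: mult.commute[of "v _ / wt _"] mult.commute[of "T _ / _"])
qed

end

section \<open>Klein coordinates\<close>

text \<open>The Laplacian is written through the quotient's own gradient, as one gets by applying
  the product rule to \<open>f = (f / e) * e\<close> and solving. In this shape \<open>klein\<close>
  and \<open>sig\<close> inherit short formulas.\<close>

lemma lap_on_divide:
  assumes f: "lap_on S f F lf" and e: "lap_on S e E le" and S: "open S" and nz: "\<And>x. x \<in> S \<Longrightarrow> e x \<noteq> 0"
  shows "lap_on S (\<lambda>x. f x / e x) (\<lambda>x. (1 / e x) *\<^sub>R (F x - (f x / e x) *\<^sub>R E x))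
    (\<lambda>x. (lf x - (f x / e x) * le x - 2 * (((1 / e x) *\<^sub>R (F x - (f x / e x) *\<^sub>R E x)) \<bullet> E x)) / e x)"
proof -
  have inv: "lap_on S (\<lambda>x. inverse (e x)) (\<lambda>x. (- 1 / (e x)\<^sup>2) *\<^sub>R E x)
      (\<lambda>x. - 1 / (e x)\<^sup>2 * le x + 2 / (e x) ^ 3 * (E x \<bullet> E x))"
  proof (rule lap_on_chain[OF e])
    fix x assume x: "x \<in> S"
    show "(inverse has_real_derivative - 1 / (e x)\<^sup>2) (at (e x))"
      using nz[OF x] by (auto intro!: derivative_eq_intros simp: power2_eq_square field_simps)
    show "((\<lambda>r. - 1 / r\<^sup>2) has_real_derivative 2 / (e x) ^ 3) (at (e x))"
      using nz[OF x] by (auto intro!: derivative_eq_intros simp: power2_eq_square power3_eq_cube field_simps)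
  next
    show "continuous_on (e ` S) (\<lambda>r. 2 / r ^ 3)"
      using nz by (intro continuous_intros) auto
  qed
  show ?thesis
    by (rule lap_on_cong[OF lap_on_mult[OF f inv] S])
      (auto simp: nz divide_inverse algebra_simps power2_eq_square power3_eq_cube inner_commute)
qed

context exterior_bubble begin

text \<open>\<open>num a / den\<close> is the linear function \<open>a\<cdot>y\<close> of the Klein coordinate \<open>y\<close> (\<open>kvec\<close> below), and
  \<open>rad = |y|\<^sup>2\<close> is expressed through \<open>sig\<close>. The names \<open>G\<dots>\<close> and \<open>l\<dots>\<close> are gradients and Laplacians.\<close>

definition den :: "(real^'m) \<times> real \<Rightarrow> real" where
  "den x = D * (norm x)\<^sup>2 + 2 * kk * snd x + D * kk"

definition num :: "(real^'m) \<times> real \<Rightarrow> (real^'m) \<times> real \<Rightarrow> real" where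
  "num a x = - snd a * (norm x)\<^sup>2 + 2 * sqrt kk * (fst a \<bullet> fst x) + snd a * kk"

lemma den_eq: "den x = D * wt x - 2 * snd x"
  by (simp add: den_def wt_def kk_def algebra_simps power2_eq_square)

lemma norm_square_split: "(norm (x::(real^'m) \<times> real))\<^sup>2 = fst x \<bullet> fst x + (snd x)\<^sup>2"
  unfolding power2_norm_eq_inner by (simp add: inner_prod_def power2_eq_square)

text \<open>After multiplication by \<open>D\<close>, completing the square in \<open>snd x\<close>
  leaves the remainder \<open>kk * (D^2 - kk) = kk\<close>. Positivity on the whole space makes the
  Klein functions smooth across the boundary.\<close>

lemma den_pos: "den x > 0"
proof -
  have "D * den x = D\<^sup>2 * (fst x \<bullet> fst x) + (D * snd x + kk)\<^sup>2 + kk"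
    unfolding den_def norm_square_split kk_def by (simp add: power2_eq_square algebra_simps)
  also have "\<dots> > 0" using kk_pos by (intro add_nonneg_pos add_nonneg_nonneg mult_nonneg_nonneg) auto
  finally show ?thesis using D_gt_1 by (simp add: zero_less_mult_iff)
qed

lemma den_nonzero: "den x \<noteq> 0"
  using den_pos[of x] by simp

lemma den_le: "snd x \<ge> 0 \<Longrightarrow> den x \<le> D * wt x"
  by (simp add: den_eq)

lemma den_ge: "snd x \<ge> 0 \<Longrightarrow> den x \<ge> kk / D * wt x"
proof -
  assume x: "snd x \<ge> 0"
  have "D * den x - kk * wt x = wt x - 2 * D * snd x" by (simp add: den_eq kk_def algebra_simps power2_eq_square)
  also have "\<dots> \<ge> 0" using kk_pos by (simp add: wt_def)
  finally have "kk * wt x \<le> D * den x" by simp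
  then show ?thesis using D_gt_1 by (simp add: field_simps)
qed

definition Gwt :: "(real^'m) \<times> real \<Rightarrow> (real^'m) \<times> real" where
  "Gwt x = 2 *\<^sub>R x + (0, 2 * D)"
definition Gden :: "(real^'m) \<times> real \<Rightarrow> (real^'m) \<times> real" where
  "Gden x = (2 * D) *\<^sub>R x + (0, 2 * kk)"
definition Gnum :: "(real^'m) \<times> real \<Rightarrow> (real^'m) \<times> real \<Rightarrow> (real^'m) \<times> real" where
  "Gnum a x = (- 2 * snd a) *\<^sub>R x + ((2 * sqrt kk) *\<^sub>R fst a, 0)"

lemma lap_wt: "lap_on S (wt :: (real^'m) \<times> real \<Rightarrow> real) Gwt (\<lambda>_. 2 * (real CARD('m) + 1))"
proof -
  have "wt = (\<lambda>x::(real^'m) \<times> real. 1 * (norm x)\<^sup>2 + (0, 2 * D) \<bullet> x + kk)"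
    by (auto simp: wt_def fun_eq_iff inner_prod_def)
  moreover have "Gwt = (\<lambda>x::(real^'m) \<times> real. (2 * 1) *\<^sub>R x + (0, 2 * D))" by (auto simp: Gwt_def)
  ultimately show ?thesis
    using lap_on_quadratic[of S 1 "(0, 2 * D) :: (real^'m) \<times> real" kk] by (simp add: algebra_simps)
qed

lemma lap_den: "lap_on S (den :: (real^'m) \<times> real \<Rightarrow> real) Gden (\<lambda>_. 2 * D * (real CARD('m) + 1))"
proof -
  have "den = (\<lambda>x::(real^'m) \<times> real. D * (norm x)\<^sup>2 + (0, 2 * kk) \<bullet> x + D * kk)"
    by (auto simp: den_def fun_eq_iff inner_prod_def)
  moreover have "Gden = (\<lambda>x::(real^'m) \<times> real. (2 * D) *\<^sub>R x + (0, 2 * kk))" by (auto simp: Gden_def)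
  ultimately show ?thesis
    using lap_on_quadratic[of S D "(0, 2 * kk) :: (real^'m) \<times> real" "D * kk"] by (simp add: algebra_simps)
qed

lemma lap_num: "lap_on S (num a :: (real^'m) \<times> real \<Rightarrow> real) (Gnum a) (\<lambda>_. - 2 * snd a * (real CARD('m) + 1))"
proof -
  have "num a = (\<lambda>x::(real^'m) \<times> real. (- snd a) * (norm x)\<^sup>2 + ((2 * sqrt kk) *\<^sub>R fst a, 0) \<bullet> x + snd a * kk)"
    by (auto simp: num_def fun_eq_iff inner_prod_def)
  moreover have "Gnum a = (\<lambda>x::(real^'m) \<times> real. (2 * - snd a) *\<^sub>R x + ((2 * sqrt kk) *\<^sub>R fst a, 0))" by (auto simp: Gnum_def)
  ultimately show ?thesis
    using lap_on_quadratic[of S "- snd a" "((2 * sqrt kk) *\<^sub>R fst a, 0) :: (real^'m) \<times> real" "snd a * kk"] by (simp add: algebra_simps)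
qed

lemma sqrt_kk_square: "sqrt kk * sqrt kk = kk"
  using kk_pos by simp

text \<open>For quadratics \<open>q = \<alpha>|x|^2 + w.x + \<gamma>\<close> and
  \<open>q' = \<alpha>'|x|^2 + w'.x + \<gamma>'\<close> the gradients have inner product
  \<open>2\<alpha> q' + 2\<alpha>' q\<close> plus the constant
  \<open>w.w' - 2\<alpha>\<gamma>' - 2\<alpha>'\<gamma>\<close>. This constant is a Lorentzian form
  for which \<open>wt\<close>, \<open>den\<close> and \<open>num a\<close> are mutually orthogonal,
  with squares \<open>4\<close>, \<open>- 4 kk\<close> and \<open>4 kk |a|^2\<close>.\<close>

lemma gradient_inner_products:
  "Gwt x \<bullet> Gwt x = 4 * (wt x + 1)"
  "Gwt x \<bullet> Gden x = 2 * den x + 2 * D * wt x"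
  "Gden x \<bullet> Gden x = 4 * D * den x - 4 * kk"
  "Gnum a x \<bullet> Gwt x = 2 * num a x - 2 * snd a * wt x"
  "Gnum a x \<bullet> Gden x = 2 * D * num a x - 2 * snd a * den x"
  "Gnum a x \<bullet> Gnum a x = 4 * kk * (norm a)\<^sup>2 - 4 * snd a * num a x"
proof -
  obtain y t where x: "x = (y, t)" by (cases x)
  obtain b c where a: "a = (b, c)" by (cases a)
  note defs = Gwt_def Gden_def Gnum_def wt_def den_def num_def norm_square_split x a
  show "Gwt x \<bullet> Gwt x = 4 * (wt x + 1)"
    unfolding wt_eq power2_norm_eq_inner Gwt_def
    by (simp add: inner_add_left inner_add_right inner_commute algebra_simps x)
  show "Gwt x \<bullet> Gden x = 2 * den x + 2 * D * wt x"
    unfolding defs by (simp add: inner_add_left inner_add_right kk_def power2_eq_square algebra_simps)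
  show "Gden x \<bullet> Gden x = 4 * D * den x - 4 * kk"
    unfolding defs by (simp add: inner_add_left inner_add_right kk_def power2_eq_square algebra_simps)
  show "Gnum a x \<bullet> Gwt x = 2 * num a x - 2 * snd a * wt x"
    unfolding defs by (simp add: inner_add_left inner_add_right kk_def power2_eq_square algebra_simps)
  show "Gnum a x \<bullet> Gden x = 2 * D * num a x - 2 * snd a * den x"
    unfolding defs by (simp add: inner_add_left inner_add_right kk_def power2_eq_square algebra_simps)
  have "Gnum a x \<bullet> Gnum a x = 4 * (sqrt kk * sqrt kk) * (b \<bullet> b) + 4 * c * c * (y \<bullet> y + t * t) - 8 * sqrt kk * c * (b \<bullet> y)"
    unfolding defs by (simp add: inner_add_left inner_add_right power2_eq_square inner_commute algebra_simps)
  also have "\<dots> = 4 * kk * (norm a)\<^sup>2 - 4 * snd a * num a x"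
    unfolding sqrt_kk_square defs by (simp add: power2_eq_square algebra_simps)
  finally show "Gnum a x \<bullet> Gnum a x = 4 * kk * (norm a)\<^sup>2 - 4 * snd a * num a x" .
qed

definition klein :: "(real^'m) \<times> real \<Rightarrow> (real^'m) \<times> real \<Rightarrow> real" where
  "klein a x = num a x / den x"
text \<open>Since \<open>rad\<close> is \<open>|y|^2\<close>, hence tanh squared of the hyperbolic
  distance to the centre, \<open>sig\<close> is the reciprocal of cosh of that distance, divided by
  \<open>sqrt kk\<close>.\<close>

definition sig :: "(real^'m) \<times> real \<Rightarrow> real" where
  "sig x = wt x / den x"
definition rad :: "(real^'m) \<times> real \<Rightarrow> real" where
  "rad x = 1 - kk * (sig x)\<^sup>2"

definition Gklein :: "(real^'m) \<times> real \<Rightarrow> (real^'m) \<times> real \<Rightarrow> (real^'m) \<times> real" where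
  "Gklein a x = (1 / den x) *\<^sub>R (Gnum a x - klein a x *\<^sub>R Gden x)"
definition Gsig :: "(real^'m) \<times> real \<Rightarrow> (real^'m) \<times> real" where
  "Gsig x = (1 / den x) *\<^sub>R (Gwt x - sig x *\<^sub>R Gden x)"
definition Grad :: "(real^'m) \<times> real \<Rightarrow> (real^'m) \<times> real" where
  "Grad x = (- 2 * kk * sig x) *\<^sub>R Gsig x"
text \<open>The conformal ratio \<open>4 (1 - |y|^2) / wt^2\<close>, rewritten by
  \<open>1 - |y|^2 = kk wt^2 / den^2\<close>. It relates Euclidean gradients to the matrix
  \<open>\<delta>_ij - y_i y_j\<close>.\<close>

definition omega :: "(real^'m) \<times> real \<Rightarrow> real" where
  "omega x = 4 * kk / (den x)\<^sup>2"

lemma klein_num: "num a x = klein a x * den x"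
  and sig_wt: "wt x = sig x * den x"
  using den_nonzero[of x] by (simp_all add: klein_def sig_def)

lemma klein_inner_products:
  "Gklein a x \<bullet> Gwt x = - 2 * wt x * (snd a + D * klein a x) / den x"
  "Gklein a x \<bullet> Gden x = - 2 * D * klein a x - 2 * snd a + 4 * kk * klein a x / den x"
  "Gsig x \<bullet> Gwt x = (2 * wt x + 4 - 2 * D * sig x * wt x) / den x"
  "Gsig x \<bullet> Gden x = 2 - 2 * D * sig x + 4 * kk * sig x / den x"
  using den_nonzero[of x]
  unfolding Gklein_def Gsig_def inner_scaleR_left inner_diff_left gradient_inner_products klein_num sig_wt
    inner_commute[of "Gden x" "Gwt x"]
  by (simp_all add: field_simps)

text \<open>This is the Klein form of the metric: Euclidean products of gradients of the coordinates
  \<open>y_i\<close> are \<open>omega\<close> times \<open>\<delta>_ij - y_i y_j\<close>.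
  Orthogonality of \<open>num a\<close>, \<open>wt\<close> and \<open>den\<close> for the Lorentzian
  form removes all other terms once \<open>num a\<close> and \<open>wt\<close> are replaced by
  multiples of \<open>den\<close>.\<close>

lemma klein_metric:
  "Gklein a x \<bullet> Gklein a x = omega x * ((norm a)\<^sup>2 - (klein a x)\<^sup>2)"
  "Gklein a x \<bullet> Gsig x = omega x * (- klein a x * sig x)"
  "Gsig x \<bullet> Gsig x = omega x * (1 / kk - (sig x)\<^sup>2)"
proof -
  have "Gklein a x \<bullet> Gklein a x = (Gnum a x \<bullet> Gnum a x - 2 * klein a x * (Gnum a x \<bullet> Gden x)
      + (klein a x)\<^sup>2 * (Gden x \<bullet> Gden x)) / (den x)\<^sup>2"
    unfolding Gklein_def
    by (simp add: inner_diff_left inner_diff_right inner_commute power2_eq_square algebra_simps diff_divide_distrib add_divide_distrib)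
  then show "Gklein a x \<bullet> Gklein a x = omega x * ((norm a)\<^sup>2 - (klein a x)\<^sup>2)"
    using den_nonzero[of x] unfolding gradient_inner_products klein_num omega_def
    by (simp add: field_simps power2_eq_square)
  have "Gklein a x \<bullet> Gsig x = (Gnum a x \<bullet> Gwt x - klein a x * (Gwt x \<bullet> Gden x) - sig x * (Gnum a x \<bullet> Gden x)
      + klein a x * sig x * (Gden x \<bullet> Gden x)) / (den x)\<^sup>2"
    unfolding Gklein_def Gsig_def
    by (simp add: inner_diff_left inner_diff_right inner_commute power2_eq_square algebra_simps diff_divide_distrib add_divide_distrib)
  then show "Gklein a x \<bullet> Gsig x = omega x * (- klein a x * sig x)"
    using den_nonzero[of x] unfolding gradient_inner_products klein_num sig_wt omega_def
    by (simp add: field_simps power2_eq_square)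
  have "Gsig x \<bullet> Gsig x = (Gwt x \<bullet> Gwt x - 2 * sig x * (Gwt x \<bullet> Gden x)
      + (sig x)\<^sup>2 * (Gden x \<bullet> Gden x)) / (den x)\<^sup>2"
    unfolding Gsig_def
    by (simp add: inner_diff_left inner_diff_right inner_commute power2_eq_square algebra_simps diff_divide_distrib add_divide_distrib)
  also have "\<dots> = (4 - 4 * kk * (sig x)\<^sup>2) / (den x)\<^sup>2"
    unfolding gradient_inner_products sig_wt by (simp add: field_simps power2_eq_square)
  also have "\<dots> = omega x * (1 / kk - (sig x)\<^sup>2)"
    using kk_pos by (simp add: omega_def right_diff_distrib diff_divide_distrib)
  finally show "Gsig x \<bullet> Gsig x = omega x * (1 / kk - (sig x)\<^sup>2)" .
qed

definition lklein :: "(real^'m) \<times> real \<Rightarrow> (real^'m) \<times> real \<Rightarrow> real" where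
  "lklein a x = (- 2 * snd a * (real CARD('m) + 1) - klein a x * (2 * D * (real CARD('m) + 1)) - 2 * (Gklein a x \<bullet> Gden x)) / den x"
definition lsig :: "(real^'m) \<times> real \<Rightarrow> real" where
  "lsig x = (2 * (real CARD('m) + 1) - sig x * (2 * D * (real CARD('m) + 1)) - 2 * (Gsig x \<bullet> Gden x)) / den x"
definition lrad :: "(real^'m) \<times> real \<Rightarrow> real" where
  "lrad x = - 2 * kk * sig x * lsig x - 2 * kk * (Gsig x \<bullet> Gsig x)"

lemma lap_klein: "open S \<Longrightarrow> lap_on S (klein a) (Gklein a) (lklein a)"
  using lap_on_divide[OF lap_num lap_den _ den_nonzero, of S a]
  unfolding klein_def[abs_def] Gklein_def[abs_def] lklein_def[abs_def] by simp

lemma lap_sig: "open S \<Longrightarrow> lap_on S sig Gsig lsig"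
  using lap_on_divide[OF lap_wt lap_den _ den_nonzero, of S]
  unfolding sig_def[abs_def] Gsig_def[abs_def] lsig_def[abs_def] by simp

lemma lap_rad: "open S \<Longrightarrow> lap_on S rad Grad lrad"
proof -
  assume S: "open S"
  have "lap_on S (\<lambda>x. 1 - kk * (sig x)\<^sup>2) (\<lambda>x. (- 2 * kk * sig x) *\<^sub>R Gsig x)
      (\<lambda>x. - 2 * kk * sig x * lsig x + - 2 * kk * (Gsig x \<bullet> Gsig x))"
    by (rule lap_on_chain[OF lap_sig[OF S], where h="\<lambda>r. 1 - kk * r\<^sup>2" and h'="\<lambda>r. - 2 * kk * r" and h''="\<lambda>_. - 2 * kk"])
      (auto intro!: derivative_eq_intros)
  then show "lap_on S rad Grad lrad"
    unfolding rad_def[abs_def] Grad_def[abs_def] lrad_def[abs_def] by simp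
qed

lemma rad_metric:
  "Gklein a x \<bullet> Grad x = omega x * (2 * klein a x * (1 - rad x))"
  "Grad x \<bullet> Grad x = omega x * (4 * rad x * (1 - rad x))"
  using kk_pos unfolding Grad_def inner_scaleR_left inner_scaleR_right klein_metric rad_def
  by (simp_all add: field_simps power2_eq_square)

text \<open>The conformal weight \<open>wt powr (- (n - 2) / 2)\<close> times
  \<open>den / wt\<close>, which is proportional to cosh of the distance to the centre, the time
  coordinate on the hyperboloid. It corresponds to the constant function
  \<open>f = 1\<close>.\<close>

definition base :: "(real^'m) \<times> real \<Rightarrow> real" where
  "base x = wt x powr (- (real CARD('m) + 1) / 2) * den x"
definition Gbase :: "(real^'m) \<times> real \<Rightarrow> (real^'m) \<times> real" where
  "Gbase x = base x *\<^sub>R ((1 / den x) *\<^sub>R Gden x - ((real CARD('m) + 1) / (2 * wt x)) *\<^sub>R Gwt x)"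
definition lbase :: "(real^'m) \<times> real \<Rightarrow> real" where
  "lbase x = (real CARD('m) + 1) * (real CARD('m) + 3) * base x / (wt x)\<^sup>2"

lemma lap_base: "lap_on {x. wt x > 0} (base :: (real^'m) \<times> real \<Rightarrow> real) Gbase lbase"
proof -
  let ?q = "- (real CARD('m) + 1) / 2"
  have pw: "lap_on {x::(real^'m) \<times> real. wt x > 0} (\<lambda>x. wt x powr ?q) (\<lambda>x. (?q * wt x powr (?q - 1)) *\<^sub>R Gwt x)
      (\<lambda>x. ?q * wt x powr (?q - 1) * (2 * (real CARD('m) + 1)) + ?q * ((?q - 1) * wt x powr (?q - 2)) * (Gwt x \<bullet> Gwt x))"
  proof (rule lap_on_chain[OF lap_wt, where h="\<lambda>r. r powr ?q" and h'="\<lambda>r. ?q * r powr (?q - 1)"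
        and h''="\<lambda>r. ?q * ((?q - 1) * r powr (?q - 2))"])
    fix x :: "(real^'m) \<times> real" assume "x \<in> {x. wt x > 0}"
    then have x: "wt x > 0" by simp
    show "((\<lambda>r. r powr ?q) has_real_derivative ?q * wt x powr (?q - 1)) (at (wt x))"
      by (rule has_real_derivative_powr[OF x])
    have "((\<lambda>r. ?q * r powr (?q - 1)) has_real_derivative ?q * ((?q - 1) * wt x powr (?q - 1 - 1))) (at (wt x))"
      by (rule DERIV_cmult[OF has_real_derivative_powr[OF x]])
    then show "((\<lambda>r. ?q * r powr (?q - 1)) has_real_derivative ?q * ((?q - 1) * wt x powr (?q - 2))) (at (wt x))"
      by (simp add: algebra_simps)
  next
    show "continuous_on (wt ` {x::(real^'m) \<times> real. wt x > 0}) (\<lambda>r. ?q * ((?q - 1) * r powr (?q - 2)))"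
      by (intro continuous_intros) auto
  qed
  show ?thesis
  proof (rule lap_on_cong[OF lap_on_mult[OF pw lap_den] open_wt_pos])
    fix x :: "(real^'m) \<times> real" assume "x \<in> {x. wt x > 0}"
    then have x: "wt x > 0" by simp
    define w where "w = wt x powr ?q"
    have w1: "wt x powr (?q - 1) = w / wt x" and w2: "wt x powr (?q - 2) = w / (wt x)\<^sup>2"
      using x unfolding w_def by (simp_all add: powr_diff powr_numeral)
    have b: "base x = w * den x" by (simp add: base_def w_def)
    show "wt x powr ?q * den x = base x" by (simp add: base_def)
    have dn: "den x \<noteq> 0" by (rule den_nonzero)
    show "wt x powr ?q *\<^sub>R Gden x + den x *\<^sub>R (?q * wt x powr (?q - 1)) *\<^sub>R Gwt x = Gbase x"
    proof -
      have "den x * (?q * (w / wt x)) = - (w * den x * ((real CARD('m) + 1) / (2 * wt x)))" using x by (simp add: field_simps)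
      then show ?thesis
        unfolding Gbase_def w1 b w_def[symmetric] scaleR_diff_right scaleR_scaleR using dn by simp
    qed
    \<comment> \<open>With \<open>q = - \<nu> / 2\<close> the terms in \<open>D\<close> cancel, and
      those of order \<open>1 / W\<close> cancel because \<open>4 q^2 = \<nu>^2\<close>. What
      survives is \<open>4 q (q - 1) = \<nu> (\<nu> + 2)\<close> over \<open>W^2\<close>.\<close>
    have aux: "w' * (2 * D * \<nu>) + e * (q * (w' / W) * (2 * \<nu>) + q * ((q - 1) * (w' / W\<^sup>2)) * (4 * (W + 1)))
        + 2 * (q * (w' / W) * (2 * e + 2 * D * W)) = \<nu> * (\<nu> + 2) * (w' * e) / W\<^sup>2"
      if "W \<noteq> 0" "q = - \<nu> / 2" for w' e q W \<nu> :: real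
      unfolding that(2) using that(1) by (simp add: field_simps power2_eq_square)
    show "wt x powr ?q * (2 * D * (real CARD('m) + 1)) + den x * (?q * wt x powr (?q - 1) * (2 * (real CARD('m) + 1))
        + ?q * ((?q - 1) * wt x powr (?q - 2)) * (Gwt x \<bullet> Gwt x)) + 2 * ((?q * wt x powr (?q - 1)) *\<^sub>R Gwt x \<bullet> Gden x) = lbase x"
      unfolding w1 w2 w_def[symmetric] inner_scaleR_left gradient_inner_products lbase_def b
      using aux[of "wt x" ?q "real CARD('m) + 1" w "den x"] x by (simp add: add.assoc)
  qed
qed

text \<open>The first-order terms cancel, so multiplication by \<open>base\<close> leaves no drift
  in the Klein coordinates and linear functions of \<open>y\<close> become solutions.\<close>

lemma base_klein: "wt x > 0 \<Longrightarrow> base x * lklein a x + 2 * (Gbase x \<bullet> Gklein a x) = 0"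
  unfolding lklein_def Gbase_def inner_scaleR_left inner_diff_left inner_commute[of "Gden x" "Gklein a x"]
    inner_commute[of "Gwt x" "Gklein a x"] klein_inner_products
  using den_nonzero[of x] by (simp add: field_simps)

text \<open>The right-hand factor is \<open>(\<delta>_ij - y_i y_j) d_i d_j\<close> applied to
  \<open>|y|^2\<close>: the trace part gives \<open>2 n\<close> with
  \<open>n = CARD('m) + 1\<close>, the radial part gives \<open>2 |y|^2\<close>.\<close>

lemma base_rad:
  fixes x :: "(real^'m) \<times> real"
  assumes x: "wt x > 0"
  shows "base x * lrad x + 2 * (Gbase x \<bullet> Grad x) = base x * omega x * (2 * (real CARD('m) + 1) - 2 * rad x)"
proof -
  have s: "base x * lsig x + 2 * (Gbase x \<bullet> Gsig x) = base x * (- 4 * (real CARD('m) + 1) / (den x * wt x))"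
    unfolding lsig_def Gbase_def inner_scaleR_left inner_diff_left inner_commute[of "Gden x" "Gsig x"]
      inner_commute[of "Gwt x" "Gsig x"] klein_inner_products
    using den_nonzero[of x] x by (simp add: field_simps)
  have "base x * lrad x + 2 * (Gbase x \<bullet> Grad x)
      = - 2 * kk * sig x * (base x * lsig x + 2 * (Gbase x \<bullet> Gsig x)) - 2 * kk * base x * (Gsig x \<bullet> Gsig x)"
    unfolding lrad_def Grad_def by (simp add: algebra_simps)
  also have "\<dots> = base x * omega x * (2 * (real CARD('m) + 1) - 2 * rad x)"
    unfolding s klein_metric omega_def rad_def using den_nonzero[of x] x kk_pos
    by (simp add: sig_def field_simps power2_eq_square)
  finally show ?thesis .
qed

definition kvec :: "(real^'m) \<times> real \<Rightarrow> (real^'m) \<times> real" where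
  "kvec x = ((2 * sqrt kk / den x) *\<^sub>R fst x, (kk - (norm x)\<^sup>2) / den x)"

lemma inner_kvec: "a \<bullet> kvec x = klein a x"
  using den_nonzero[of x]
  by (cases a) (simp add: kvec_def klein_def num_def field_simps)

text \<open>The equation of the hyperboloid, \<open>den^2 - |den y|^2 = kk wt^2\<close>, divided by
  \<open>den^2\<close>.\<close>

lemma norm_kvec: "(norm (kvec x))\<^sup>2 = rad x"
proof -
  obtain y t where x: "x = (y, t)" by (cases x)
  define Y where "Y = y \<bullet> y"
  have n: "(norm x)\<^sup>2 = Y + t\<^sup>2" by (simp add: norm_square_split x Y_def)
  have "(norm (kvec x))\<^sup>2 = (4 * (sqrt kk * sqrt kk) * Y + (kk - (norm x)\<^sup>2)\<^sup>2) / (den x)\<^sup>2"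
    unfolding norm_square_split[of "kvec x"] unfolding kvec_def Y_def
    by (simp add: x power_divide power2_eq_square add_divide_distrib)
  then have "(den x)\<^sup>2 * (norm (kvec x))\<^sup>2 = 4 * (sqrt kk * sqrt kk) * Y + (kk - (norm x)\<^sup>2)\<^sup>2"
    using den_nonzero[of x] by simp
  also have "\<dots> = (den x)\<^sup>2 - kk * (wt x)\<^sup>2"
    unfolding sqrt_kk_square den_def wt_def unfolding n kk_def by (simp add: x power2_eq_square algebra_simps)
  finally have "(norm (kvec x))\<^sup>2 = ((den x)\<^sup>2 - kk * (wt x)\<^sup>2) / (den x)\<^sup>2"
    using den_nonzero[of x] by (simp add: field_simps)
  then show ?thesis
    using den_nonzero[of x] by (simp add: rad_def sig_def field_simps)
qed

lemma rad_nonneg: "rad x \<ge> 0"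
  using norm_kvec[of x] by (metis zero_le_power2)

lemma rad_le_1: "rad x \<le> 1"
  using kk_pos by (simp add: rad_def)

lemma klein_bound: "\<bar>klein a x\<bar> \<le> norm a"
proof -
  have "(norm (kvec x))\<^sup>2 \<le> 1\<^sup>2" using norm_kvec[of x] rad_le_1[of x] by simp
  then have "norm (kvec x) \<le> 1" by (rule power2_le_imp_le) simp
  then have "norm a * norm (kvec x) \<le> norm a" by (simp add: mult_left_le)
  then show ?thesis using Cauchy_Schwarz_ineq2[of a "kvec x"] by (simp add: inner_kvec)
qed

text \<open>From \<open>den = D wt - 2 x_n\<close> one has \<open>sig >= 1 / D\<close> on the
  half-space, with equality on the boundary, and \<open>1 - kk / D^2 = 1 / D^2\<close>. So the
  half-space lies in the ball of radius \<open>1 / D < 1\<close> about the centre, its boundary on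
  the bounding sphere.\<close>

lemma rad_half_space: "snd x \<ge> 0 \<Longrightarrow> rad x \<le> 1 / D\<^sup>2"
proof -
  assume x: "snd x \<ge> 0"
  have "1 / D \<le> sig x" using den_le[OF x] den_pos[of x] D_gt_1 by (simp add: sig_def field_simps)
  then have "(1 / D)\<^sup>2 \<le> (sig x)\<^sup>2" using D_gt_1 by (intro power_mono) auto
  then have "kk * (1 / D)\<^sup>2 \<le> kk * (sig x)\<^sup>2" using kk_pos by (intro mult_left_mono) auto
  moreover have "1 - kk * (1 / D)\<^sup>2 = 1 / D\<^sup>2" using D_gt_1 by (simp add: kk_def field_simps)
  ultimately show ?thesis by (simp add: rad_def)
qed

lemma rad_boundary: "rad (y, 0) = 1 / D\<^sup>2"
proof -
  have "den (y, 0) = D * wt (y, 0)" by (simp add: den_eq)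
  then have s: "sig (y, 0) = 1 / D" using wt_nonzero[of "(y, 0)"] by (simp add: sig_def)
  show ?thesis using D_gt_1 unfolding rad_def kk_def s by (simp add: field_simps)
qed

section \<open>Monomials in the Klein coordinate as test functions\<close>

definition klein_mono :: "(real^'m) \<times> real \<Rightarrow> nat \<Rightarrow> nat \<Rightarrow> (real^'m) \<times> real \<Rightarrow> real" where
  "klein_mono a p i x = klein a x ^ p * rad x ^ i"
definition Gmono :: "(real^'m) \<times> real \<Rightarrow> nat \<Rightarrow> nat \<Rightarrow> (real^'m) \<times> real \<Rightarrow> (real^'m) \<times> real" where
  "Gmono a p i x = klein a x ^ p *\<^sub>R (real i * rad x ^ (i - 1)) *\<^sub>R Grad x
     + rad x ^ i *\<^sub>R (real p * klein a x ^ (p - 1)) *\<^sub>R Gklein a x"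
definition Gtest :: "(real^'m) \<times> real \<Rightarrow> nat \<Rightarrow> nat \<Rightarrow> (real^'m) \<times> real \<Rightarrow> (real^'m) \<times> real" where
  "Gtest a p i x = base x *\<^sub>R Gmono a p i x + klein_mono a p i x *\<^sub>R Gbase x"

text \<open>The operator \<open>(\<delta>\<^sub>i\<^sub>j - y\<^sub>iy\<^sub>j)\<partial>\<^sub>i\<partial>\<^sub>j\<close> applied to \<open>(a\<cdot>y)\<^sup>p |y|\<^sup>2\<^sup>i\<close>.\<close>

definition Mmono :: "(real^'m) \<times> real \<Rightarrow> nat \<Rightarrow> nat \<Rightarrow> (real^'m) \<times> real \<Rightarrow> real" where
  "Mmono a p i x = real p * (real p - 1) * (norm a)\<^sup>2 * klein_mono a (p - 2) i x
    + 2 * real i * ((real CARD('m) + 1) + 2 * real i - 2 + 2 * real p) * klein_mono a p (i - 1) x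
    - (real p + 2 * real i) * (real p + 2 * real i - 1) * klein_mono a p i x"

text \<open>The product rule yields three kinds of terms: \<open>base\<close> contributes the
  potential, \<open>base_klein\<close> and \<open>base_rad\<close> absorb all first-order terms, and
  \<open>klein_metric\<close> with \<open>rad_metric\<close> turns the products of gradients into
  multiples of \<open>omega\<close>.\<close>

lemma lap_test:
  fixes a :: "(real^'m) \<times> real"
  shows "lap_on {x. wt x > 0} (\<lambda>x. base x * klein_mono a p i x) (Gtest a p i)
    (\<lambda>x. (real CARD('m) + 1) * (real CARD('m) + 3) * (base x * klein_mono a p i x) / (wt x)\<^sup>2
        + base x * omega x * Mmono a p i x)"
proof -
  let ?S = "{x::(real^'m) \<times> real. wt x > 0}"
  note k = lap_on_power[OF lap_klein[OF open_wt_pos, of a], of p] and r = lap_on_power[OF lap_rad[OF open_wt_pos], of i]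
  note L = lap_on_mult[OF lap_base lap_on_mult[OF k r]]
  show ?thesis
  proof (rule lap_on_cong[OF L open_wt_pos])
    fix x :: "(real^'m) \<times> real" assume "x \<in> ?S"
    then have x: "wt x > 0" by simp
    show "base x * (klein a x ^ p * rad x ^ i) = base x * klein_mono a p i x" by (simp add: klein_mono_def)
    show "base x *\<^sub>R (klein a x ^ p *\<^sub>R (real i * rad x ^ (i - 1)) *\<^sub>R Grad x + rad x ^ i *\<^sub>R (real p * klein a x ^ (p - 1)) *\<^sub>R Gklein a x)
        + (klein a x ^ p * rad x ^ i) *\<^sub>R Gbase x = Gtest a p i x"
      by (simp add: Gtest_def Gmono_def klein_mono_def)
    define P s u w lk lr where defs: "P = base x" "s = klein a x" "u = rad x" "w = omega x" "lk = lklein a x" "lr = lrad x"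
    define gk gr where g: "gk = Gbase x \<bullet> Gklein a x" "gr = Gbase x \<bullet> Grad x"
    define N where "N = (norm a)\<^sup>2"
    have e1: "P * lk + 2 * gk = 0" unfolding defs g by (rule base_klein[OF x])
    have e2: "P * lr + 2 * gr = P * w * (2 * (real CARD('m) + 1) - 2 * u)" unfolding defs g by (rule base_rad[OF x])
    have m: "Gklein a x \<bullet> Gklein a x = w * (N - s\<^sup>2)" "Gklein a x \<bullet> Grad x = w * (2 * s * (1 - u))" "Grad x \<bullet> Grad x = w * (4 * u * (1 - u))"
      unfolding defs N_def by (rule klein_metric(1) rad_metric)+
    define c1 c2 d1 d2 where c: "c1 = real i * u ^ (i - 1)" "c2 = real i * real (i - 1) * u ^ (i - 2)"
      "d1 = real p * s ^ (p - 1)" "d2 = real p * real (p - 1) * s ^ (p - 2)"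
    \<comment> \<open>In the exponents \<open>i - 1\<close>, \<open>i - 2\<close>,
      \<open>p - 1\<close>, \<open>p - 2\<close> the subtraction truncates exactly where the
      numerical coefficient is 0. These identities absorb powers of \<open>u\<close> or
      \<open>s\<close> without case distinctions later on.\<close>
    have q1: "c1 * u = real i * u ^ i" unfolding c by (cases i) auto
    have q2: "c2 * u = (real i - 1) * c1"
    proof (cases "i < 2")
      case True
      then have "i = 0 \<or> i = 1" by auto
      then show ?thesis unfolding c by auto
    next
      case False
      then obtain j where "i = Suc (Suc j)" by (metis add_2_eq_Suc le_add_diff_inverse not_less)
      then show ?thesis unfolding c by simp
    qed
    have q3: "d1 * s = real p * s ^ p" unfolding c by (cases p) auto
    have q4: "d2 * s\<^sup>2 = real p * (real p - 1) * s ^ p"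
    proof (cases "p < 2")
      case True
      then have "p = 0 \<or> p = 1" by auto
      then show ?thesis unfolding c by auto
    next
      case False
      then obtain j where "p = Suc (Suc j)" by (metis add_2_eq_Suc le_add_diff_inverse not_less)
      then show ?thesis unfolding c by (simp add: power2_eq_square)
    qed
    have q5: "d2 = real p * (real p - 1) * s ^ (p - 2)" unfolding c by (cases p) auto
    have t1: "c2 * u * (1 - u) = (real i - 1) * (c1 - real i * u ^ i)"
      unfolding q2 right_diff_distrib mult.assoc[of _ c1 u] q1 by simp
    have t2: "d1 * s * (c1 * (1 - u)) = real p * s ^ p * (c1 - real i * u ^ i)"
      unfolding q3 right_diff_distrib[of c1] q1 by simp
    have t3: "c1 * (2 * (real CARD('m) + 1) - 2 * u) = 2 * (real CARD('m) + 1) * c1 - 2 * (real i * u ^ i)"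
      unfolding q1[symmetric] by (simp add: algebra_simps)
    have "P * (s ^ p * (c1 * lr + c2 * (w * (4 * u * (1 - u)))) + u ^ i * (d1 * lk + d2 * (w * (N - s\<^sup>2)))
         + 2 * (d1 * (c1 * (w * (2 * s * (1 - u)))))) + s ^ p * u ^ i * lbase x + 2 * (s ^ p * (c1 * gr) + u ^ i * (d1 * gk))
      = s ^ p * c1 * (P * lr + 2 * gr) + u ^ i * d1 * (P * lk + 2 * gk)
       + P * w * (4 * s ^ p * (c2 * u * (1 - u)) + u ^ i * d2 * N - u ^ i * (d2 * s\<^sup>2) + 4 * (d1 * s * (c1 * (1 - u))))
       + s ^ p * u ^ i * lbase x"
      by (simp add: algebra_simps)
    also have "\<dots> = P * w * (s ^ p * (c1 * (2 * (real CARD('m) + 1) - 2 * u)) + 4 * s ^ p * (c2 * u * (1 - u)) + u ^ i * d2 * N - u ^ i * (d2 * s\<^sup>2) + 4 * (d1 * s * (c1 * (1 - u))))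
       + s ^ p * u ^ i * lbase x"
      unfolding e1 e2 by (simp add: algebra_simps)
    also have "\<dots> = P * w * (d2 * N * u ^ i + 2 * real i * ((real CARD('m) + 1) + 2 * real i - 2 + 2 * real p) * (s ^ p * u ^ (i - 1))
        - (real p + 2 * real i) * (real p + 2 * real i - 1) * (s ^ p * u ^ i)) + s ^ p * u ^ i * lbase x"
      unfolding t1 t2 t3 q4 unfolding c(1) by (simp add: algebra_simps)
    also have "\<dots> = (real CARD('m) + 1) * (real CARD('m) + 3) * (base x * klein_mono a p i x) / (wt x)\<^sup>2 + base x * omega x * Mmono a p i x"
      unfolding Mmono_def klein_mono_def N_def[symmetric] defs[symmetric] lbase_def q5 by (simp add: mult_ac add.commute)
    finally show "base x * (klein a x ^ p * (real i * rad x ^ (i - 1) * lrad x + real i * real (i - 1) * rad x ^ (i - 2) * (Grad x \<bullet> Grad x))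
         + rad x ^ i * (real p * klein a x ^ (p - 1) * lklein a x + real p * real (p - 1) * klein a x ^ (p - 2) * (Gklein a x \<bullet> Gklein a x))
         + 2 * ((real p * klein a x ^ (p - 1)) *\<^sub>R Gklein a x \<bullet> (real i * rad x ^ (i - 1)) *\<^sub>R Grad x))
       + klein a x ^ p * rad x ^ i * lbase x
       + 2 * (Gbase x \<bullet> (klein a x ^ p *\<^sub>R (real i * rad x ^ (i - 1)) *\<^sub>R Grad x + rad x ^ i *\<^sub>R (real p * klein a x ^ (p - 1)) *\<^sub>R Gklein a x))
      = (real CARD('m) + 1) * (real CARD('m) + 3) * (base x * klein_mono a p i x) / (wt x)\<^sup>2 + base x * omega x * Mmono a p i x"
      unfolding inner_scaleR_left inner_scaleR_right inner_add_right m g[symmetric] defs[symmetric] c[symmetric]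
      by (simp only: mult.left_commute[of c1 d1])
  qed
qed

text \<open>Up to a factor depending on \<open>wt\<close> only, the normal derivative acts as the
  Euler field on functions of \<open>y\<close>, so it multiplies a monomial by its degree
  \<open>p + 2 * i\<close>; the \<open>1\<close> comes from \<open>base\<close>. Degree one is the
  degree with no defect.\<close>

lemma boundary_test:
  fixes a :: "(real^'m) \<times> real"
  shows "Gtest a p i (y, 0) \<bullet> (0, 1)
    = - (real CARD('m) + 1) * D * (base (y, 0) * klein_mono a p i (y, 0)) / wt (y, 0)
      + 2 * kk * (1 - (real p + 2 * real i)) * wt (y, 0) powr (- (real CARD('m) + 1) / 2) * klein_mono a p i (y, 0)"
proof -
  let ?x = "(y, 0) :: (real^'m) \<times> real"
  let ?e = "(0, 1) :: (real^'m) \<times> real"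
  have W: "wt ?x \<noteq> 0" by (rule wt_nonzero) simp
  have d: "den ?x = D * wt ?x" by (simp add: den_eq)
  have D0: "D \<noteq> 0" using D_gt_1 by simp
  have g: "Gwt ?x \<bullet> ?e = 2 * D" "Gden ?x \<bullet> ?e = 2 * kk" "Gnum a ?x \<bullet> ?e = 0"
    by (simp_all add: Gwt_def Gden_def Gnum_def)
  have s: "sig ?x = 1 / D" using W D0 by (simp add: sig_def d)
  \<comment> \<open>The boundary is the sphere \<open>|y| = 1 / D\<close> and the normal direction
    is radial in \<open>y\<close>, so every linear function of \<open>y\<close> has the same
    logarithmic normal derivative.\<close>
  have gk: "Gklein a ?x \<bullet> ?e = - 2 * kk / (D * wt ?x) * klein a ?x"
    unfolding Gklein_def inner_scaleR_left inner_diff_left g d by simp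
  have gs: "Gsig ?x \<bullet> ?e = 2 / (D\<^sup>2 * wt ?x)"
    unfolding Gsig_def inner_scaleR_left inner_diff_left g d s using W D0
    by (simp add: field_simps power2_eq_square kk_def)
  have gr: "Grad ?x \<bullet> ?e = - 2 * kk / (D * wt ?x) * (2 * rad ?x)"
    unfolding Grad_def inner_scaleR_left gs s rad_boundary using W D0 by (simp add: field_simps power2_eq_square)
  define w where "w = wt ?x powr (- (real CARD('m) + 1) / 2)"
  have b: "base ?x = w * (D * wt ?x)" by (simp add: base_def d w_def)
  have gb: "Gbase ?x \<bullet> ?e = - (real CARD('m) + 1) * D * base ?x / wt ?x + 2 * kk * w"
    unfolding Gbase_def inner_scaleR_left inner_diff_left g d b using W D0
    by (simp add: field_simps)
  have pw: "real i * rad ?x ^ (i - 1) * rad ?x = real i * rad ?x ^ i" by (cases i) auto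
  have kw: "real p * klein a ?x ^ (p - 1) * klein a ?x = real p * klein a ?x ^ p" by (cases p) auto
  have "Gmono a p i ?x \<bullet> ?e = - 2 * kk / (D * wt ?x) * (2 * klein a ?x ^ p * (real i * rad ?x ^ (i - 1) * rad ?x)
      + rad ?x ^ i * (real p * klein a ?x ^ (p - 1) * klein a ?x))"
    unfolding Gmono_def inner_add_left inner_scaleR_left gk gr by (simp add: algebra_simps)
  also have "\<dots> = - 2 * kk / (D * wt ?x) * ((real p + 2 * real i) * klein_mono a p i ?x)"
    unfolding pw kw klein_mono_def by (simp add: algebra_simps)
  finally have gm: "Gmono a p i ?x \<bullet> ?e = - 2 * kk / (D * wt ?x) * ((real p + 2 * real i) * klein_mono a p i ?x)" .
  show ?thesis
    unfolding Gtest_def inner_add_left inner_scaleR_left gm gb b w_def[symmetric] using W D0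
    by (simp add: field_simps)
qed

section \<open>Moments of a solution\<close>

lemma base_le: "snd x \<ge> 0 \<Longrightarrow> base (x::(real^'m) \<times> real) \<le> D * wt x powr ((1 - real CARD('m)) / 2)"
  and base_pos: "snd x \<ge> 0 \<Longrightarrow> base x > 0"
proof -
  assume x: "snd x \<ge> 0"
  have p: "wt x > 0" by (rule wt_pos[OF x])
  show "base x > 0" using p den_pos[of x] by (simp add: base_def)
  have "base x \<le> wt x powr (- (real CARD('m) + 1) / 2) * (D * wt x)"
    unfolding base_def using den_le[OF x] by (intro mult_left_mono) auto
  also have "\<dots> = D * wt x powr (- (real CARD('m) + 1) / 2 + 1)" using p by (simp add: powr_add)
  also have "- (real CARD('m) + 1) / 2 + 1 = (1 - real CARD('m)) / 2" by (simp add: field_simps)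
  finally show "base x \<le> D * wt x powr ((1 - real CARD('m)) / 2)" .
qed

lemma inverse_den_le: "snd x \<ge> 0 \<Longrightarrow> 1 / den x \<le> D / kk / wt x"
proof -
  assume x: "snd x \<ge> 0"
  have "1 / den x \<le> 1 / (kk / D * wt x)"
    using den_ge[OF x] den_pos[of x] wt_pos[OF x] kk_pos D_gt_1 by (intro divide_left_mono mult_pos_pos) auto
  then show ?thesis by simp
qed

lemma base_omega_le:
  "snd x \<ge> 0 \<Longrightarrow> base x * omega (x::(real^'m) \<times> real) \<le> 4 * D * wt x powr (- (real CARD('m) + 3) / 2)"
  and base_omega_nonneg: "snd x \<ge> 0 \<Longrightarrow> base x * omega x \<ge> 0"
proof -
  assume x: "snd x \<ge> 0"
  have p: "wt x > 0" by (rule wt_pos[OF x])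
  show "base x * omega x \<ge> 0" using base_pos[OF x] kk_pos by (simp add: omega_def)
  have "base x * omega x = wt x powr (- (real CARD('m) + 1) / 2) * (4 * kk) * (1 / den x)"
    using den_nonzero[of x] by (simp add: base_def omega_def power2_eq_square)
  also have "\<dots> \<le> wt x powr (- (real CARD('m) + 1) / 2) * (4 * kk) * (D / kk / wt x)"
    using inverse_den_le[OF x] kk_pos by (intro mult_left_mono) auto
  also have "\<dots> = 4 * D * wt x powr (- (real CARD('m) + 1) / 2 - 1)"
    using p kk_pos by (simp add: powr_diff)
  also have "- (real CARD('m) + 1) / 2 - 1 = - (real CARD('m) + 3) / 2" by (simp add: field_simps)
  finally show "base x * omega x \<le> 4 * D * wt x powr (- (real CARD('m) + 3) / 2)" .
qed

lemma klein_mono_bound: "\<bar>klein_mono a p i x\<bar> \<le> norm a ^ p"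
proof -
  have "\<bar>klein_mono a p i x\<bar> \<le> norm a ^ p * 1 ^ i"
    unfolding klein_mono_def abs_mult power_abs
    using klein_bound[of a x] rad_nonneg[of x] rad_le_1[of x] by (intro mult_mono power_mono) auto
  then show ?thesis by simp
qed

lemma klein_mono_bound_half_space: "snd x \<ge> 0 \<Longrightarrow> \<bar>klein_mono a p i x\<bar> \<le> (1 / D\<^sup>2) ^ i * norm a ^ p"
  unfolding klein_mono_def abs_mult power_abs mult.commute[of "_ ^ i"]
  using klein_bound[of a x] rad_nonneg[of x] rad_half_space[of x] by (intro mult_mono power_mono) auto

lemma Mmono_bound: obtains K where "K \<ge> 0" "\<And>x. \<bar>Mmono (a::(real^'m) \<times> real) p i x\<bar> \<le> K"
proof -
  let ?c1 = "\<bar>real p * (real p - 1) * (norm a)\<^sup>2\<bar>" and ?c2 = "\<bar>2 * real i * ((real CARD('m) + 1) + 2 * real i - 2 + 2 * real p)\<bar>"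
    and ?c3 = "\<bar>(real p + 2 * real i) * (real p + 2 * real i - 1)\<bar>"
  have "\<bar>Mmono a p i x\<bar> \<le> ?c1 * norm a ^ (p - 2) + ?c2 * norm a ^ p + ?c3 * norm a ^ p" for x
  proof -
    have "\<bar>Mmono a p i x\<bar> \<le> \<bar>real p * (real p - 1) * (norm a)\<^sup>2 * klein_mono a (p - 2) i x\<bar>
        + \<bar>2 * real i * ((real CARD('m) + 1) + 2 * real i - 2 + 2 * real p) * klein_mono a p (i - 1) x\<bar>
        + \<bar>(real p + 2 * real i) * (real p + 2 * real i - 1) * klein_mono a p i x\<bar>"
      unfolding Mmono_def by (rule order_trans[OF abs_triangle_ineq4 add_right_mono[OF abs_triangle_ineq]])
    also have "\<dots> \<le> ?c1 * norm a ^ (p - 2) + ?c2 * norm a ^ p + ?c3 * norm a ^ p"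
      unfolding abs_mult[of _ "klein_mono _ _ _ _"] by (intro add_mono mult_left_mono klein_mono_bound) auto
    finally show ?thesis .
  qed
  moreover have "?c1 * norm a ^ (p - 2) + ?c2 * norm a ^ p + ?c3 * norm a ^ p \<ge> 0"
    by (intro add_nonneg_nonneg mult_nonneg_nonneg) auto
  ultimately show thesis using that by blast
qed

lemma sqrt_omega: "sqrt (omega x) = 2 * sqrt kk / den x"
  using den_pos[of x] by (simp add: omega_def real_sqrt_mult real_sqrt_divide)

lemma norm_Gklein: "norm (Gklein a x) \<le> 2 * sqrt kk / den x * norm a"
proof -
  have "norm (Gklein a x) = sqrt (omega x * ((norm a)\<^sup>2 - (klein a x)\<^sup>2))"
    unfolding norm_eq_sqrt_inner klein_metric ..
  also have "\<dots> \<le> sqrt (omega x * (norm a)\<^sup>2)"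
    using kk_pos by (intro real_sqrt_le_mono mult_left_mono) (auto simp: omega_def)
  also have "\<dots> = 2 * sqrt kk / den x * norm a" unfolding real_sqrt_mult sqrt_omega by simp
  finally show ?thesis .
qed

lemma norm_Grad: "norm (Grad x) \<le> 2 * sqrt kk / den x * 2"
proof -
  have "norm (Grad x) = sqrt (omega x * (4 * rad x * (1 - rad x)))"
    unfolding norm_eq_sqrt_inner rad_metric ..
  also have "\<dots> \<le> sqrt (omega x * 2\<^sup>2)"
  proof (intro real_sqrt_le_mono mult_left_mono)
    have "rad x * (1 - rad x) \<le> 1 * 1" using rad_nonneg[of x] rad_le_1[of x] by (intro mult_mono) auto
    then show "4 * rad x * (1 - rad x) \<le> 2\<^sup>2" by simp
  qed (use kk_pos in \<open>simp add: omega_def\<close>)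
  also have "\<dots> = 2 * sqrt kk / den x * 2" unfolding real_sqrt_mult sqrt_omega by simp
  finally show ?thesis .
qed

lemma norm_Gden: "snd x \<ge> 0 \<Longrightarrow> norm (Gden x) \<le> 2 * D * wt x powr (1 / 2)"
proof -
  assume x: "snd x \<ge> 0"
  have "norm (Gden x) = sqrt (4 * D * den x - 4 * kk)" unfolding norm_eq_sqrt_inner gradient_inner_products ..
  also have "\<dots> \<le> sqrt ((2 * D)\<^sup>2 * wt x)"
  proof (rule real_sqrt_le_mono)
    have "4 * D * den x \<le> 4 * D * (D * wt x)" using den_le[OF x] D_gt_1 by (intro mult_left_mono) auto
    then show "4 * D * den x - 4 * kk \<le> (2 * D)\<^sup>2 * wt x" using kk_pos by (simp add: power2_eq_square algebra_simps)
  qed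
  also have "\<dots> = 2 * D * wt x powr (1 / 2)"
    using wt_pos[OF x] D_gt_1 by (simp add: real_sqrt_mult powr_half_sqrt)
  finally show ?thesis .
qed

text \<open>The factor \<open>den\<close> of \<open>base\<close> cancels the \<open>1 / den\<close>
  in the gradients of the Klein functions, while the gradients of \<open>wt\<close> and
  \<open>den\<close> grow like \<open>wt powr (1 / 2)\<close>; the exponent
  \<open>- n / 2 + 1 / 2\<close> is the critical \<open>- (n - 1) / 2\<close>.\<close>

lemma Gtest_bound:
  fixes a :: "(real^'m) \<times> real"
  obtains K where "\<And>x. snd x \<ge> 0 \<Longrightarrow> norm (Gtest a p i x) \<le> K * wt x powr (- real CARD('m) / 2)"
proof -
  let ?M = "real CARD('m)"
  define K1 where "K1 = norm a ^ p * (real i * 2) + real p * norm a ^ (p - 1) * norm a"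
  define C1 where "C1 = 2 * sqrt (1 + 1 / kk)"
  define K where "K = K1 * (2 * sqrt kk) * kk powr (- 1 / 2) + norm a ^ p * (2 * D + D * ((?M + 1) / 2) * C1)"
  have K1: "K1 \<ge> 0" unfolding K1_def by (intro add_nonneg_nonneg mult_nonneg_nonneg) auto
  have "norm (Gtest a p i x) \<le> K * wt x powr (- ?M / 2)" if x: "snd x \<ge> 0" for x
  proof -
    have p: "wt x > 0" by (rule wt_pos[OF x])
    define w where "w = wt x powr (- (?M + 1) / 2)"
    have w0: "w > 0" using p by (simp add: w_def)
    have ws: "w * wt x powr (1 / 2) = wt x powr (- ?M / 2)"
      unfolding w_def powr_add[symmetric] by (simp add: field_simps)
    have wl: "w \<le> kk powr (- 1 / 2) * wt x powr (- ?M / 2)"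
      using wt_powr_le[OF x, of "- (?M + 1) / 2" "- ?M / 2"] by (simp add: w_def diff_divide_distrib add_divide_distrib)
    have b: "base x = w * den x" by (simp add: base_def w_def)
    have "norm (Gmono a p i x) \<le> \<bar>klein a x\<bar> ^ p * ((real i * \<bar>rad x\<bar> ^ (i - 1)) * norm (Grad x))
        + \<bar>rad x\<bar> ^ i * ((real p * \<bar>klein a x\<bar> ^ (p - 1)) * norm (Gklein a x))"
      unfolding Gmono_def by (rule order_trans[OF norm_triangle_ineq]) (simp add: abs_mult power_abs)
    also have "\<dots> \<le> norm a ^ p * ((real i * 1 ^ (i - 1)) * (2 * sqrt kk / den x * 2))
        + 1 ^ i * ((real p * norm a ^ (p - 1)) * (2 * sqrt kk / den x * norm a))"
      using klein_bound[of a x] rad_nonneg[of x] rad_le_1[of x] norm_Grad[of x] norm_Gklein[of a x]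
      by (intro add_mono mult_mono power_mono mult_nonneg_nonneg zero_le_power) auto
    also have "\<dots> = K1 * (2 * sqrt kk / den x)" by (simp add: K1_def algebra_simps add_divide_distrib)
    finally have g: "norm (Gmono a p i x) \<le> K1 * (2 * sqrt kk / den x)" .
    have "norm (base x *\<^sub>R Gmono a p i x) \<le> (w * den x) * (K1 * (2 * sqrt kk / den x))"
      unfolding norm_scaleR b using mult_left_mono[OF g, of "w * den x"] w0 den_pos[of x] by (simp only: abs_of_pos mult_pos_pos less_imp_le)
    also have "\<dots> = K1 * (2 * sqrt kk) * w" using den_nonzero[of x] by simp
    also have "\<dots> \<le> K1 * (2 * sqrt kk) * (kk powr (- 1 / 2) * wt x powr (- ?M / 2))"
      using wl K1 kk_pos by (intro mult_left_mono) auto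
    finally have n1: "norm (base x *\<^sub>R Gmono a p i x) \<le> K1 * (2 * sqrt kk) * kk powr (- 1 / 2) * wt x powr (- ?M / 2)"
      by simp
    have bw: "base x * ((?M + 1) / (2 * wt x)) \<le> w * (D * ((?M + 1) / 2))"
    proof -
      have "den x * ((?M + 1) / (2 * wt x)) \<le> (D * wt x) * ((?M + 1) / (2 * wt x))"
        using den_le[OF x] p by (intro mult_right_mono) auto
      then have "w * (den x * ((?M + 1) / (2 * wt x))) \<le> w * ((D * wt x) * ((?M + 1) / (2 * wt x)))"
        using w0 by (intro mult_left_mono) auto
      then show ?thesis unfolding b using p by (simp add: mult.assoc)
    qed
    have "Gbase x = w *\<^sub>R Gden x - (base x * ((?M + 1) / (2 * wt x))) *\<^sub>R Gwt x"
      unfolding Gbase_def scaleR_diff_right scaleR_scaleR b using den_nonzero[of x] by simp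
    then have "norm (Gbase x) \<le> norm (w *\<^sub>R Gden x) + norm ((base x * ((?M + 1) / (2 * wt x))) *\<^sub>R Gwt x)"
      by (simp only: norm_triangle_ineq4)
    also have "\<dots> \<le> w * (2 * D * wt x powr (1 / 2)) + w * (D * ((?M + 1) / 2)) * (C1 * wt x powr (1 / 2))"
    proof (rule add_mono)
      show "norm (w *\<^sub>R Gden x) \<le> w * (2 * D * wt x powr (1 / 2))"
        using norm_Gden[OF x] w0 by simp
      have "base x * ((?M + 1) / (2 * wt x)) \<ge> 0" using base_pos[OF x] p by simp
      then have "norm ((base x * ((?M + 1) / (2 * wt x))) *\<^sub>R Gwt x) = (base x * ((?M + 1) / (2 * wt x))) * norm (Gwt x)"
        by (simp only: norm_scaleR abs_of_nonneg)
      also have "\<dots> \<le> w * (D * ((?M + 1) / 2)) * (C1 * wt x powr (1 / 2))"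
        unfolding Gwt_def C1_def
        by (rule mult_mono[OF bw norm_wt_gradient[OF x]]) (use w0 D_gt_1 in auto)
      finally show "norm ((base x * ((?M + 1) / (2 * wt x))) *\<^sub>R Gwt x) \<le> w * (D * ((?M + 1) / 2)) * (C1 * wt x powr (1 / 2))" .
    qed
    also have "\<dots> = (2 * D + D * ((?M + 1) / 2) * C1) * (w * wt x powr (1 / 2))" by (simp add: algebra_simps)
    finally have gb: "norm (Gbase x) \<le> (2 * D + D * ((?M + 1) / 2) * C1) * wt x powr (- ?M / 2)" unfolding ws .
    have "norm (klein_mono a p i x *\<^sub>R Gbase x) \<le> norm a ^ p * ((2 * D + D * ((?M + 1) / 2) * C1) * wt x powr (- ?M / 2))"
      unfolding norm_scaleR using klein_mono_bound[of a p i x] gb by (intro mult_mono) auto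
    with n1 show ?thesis unfolding Gtest_def K_def
      by (intro order_trans[OF norm_triangle_ineq]) (simp add: algebra_simps)
  qed
  then show thesis using that by blast
qed

lemma continuous_on_test:
  fixes a :: "(real^'m) \<times> real"
  shows "continuous_on UNIV (klein_mono a p i)"
    and "continuous_on {x. wt x > 0} (\<lambda>x. base x * omega x * klein_mono a p i x)"
proof -
  have k: "continuous_on UNIV (klein a)" by (rule lap_on_continuous[OF lap_klein]) simp
  have r: "continuous_on UNIV rad" by (rule lap_on_continuous[OF lap_rad]) simp
  have d: "continuous_on UNIV den" by (rule lap_on_continuous[OF lap_den])
  show m: "continuous_on UNIV (klein_mono a p i)"
    unfolding klein_mono_def[abs_def] by (intro continuous_intros k r)
  have o: "continuous_on UNIV omega"
    unfolding omega_def[abs_def] by (intro continuous_intros d) (simp add: den_nonzero)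
  show "continuous_on {x. wt x > 0} (\<lambda>x. base x * omega x * klein_mono a p i x)"
    by (intro continuous_intros lap_on_continuous[OF lap_base] continuous_on_subset[OF o] continuous_on_subset[OF m]) auto
qed

text \<open>The weights are split so that both factors are square integrable.\<close>

definition moment_int :: "((real^'m) \<times> real \<Rightarrow> real) \<Rightarrow> (real^'m) \<times> real \<Rightarrow> nat \<Rightarrow> nat \<Rightarrow> real" where
  "moment_int v a p i = (\<integral>x. (v x / wt x) * (wt x * (base x * omega x * klein_mono a p i x)) \<partial>lebesgue_on half_space)"
definition bweight :: "real^'m \<Rightarrow> real" where
  "bweight y = 2 * kk * wt (y, 0) powr (- (real CARD('m) + 1) / 2)"
definition moment_bd :: "(real^'m \<Rightarrow> real) \<Rightarrow> (real^'m) \<times> real \<Rightarrow> nat \<Rightarrow> real" where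
  "moment_bd T a p = (\<integral>y. (T y / sqrt (wt (y, 0))) * (sqrt (wt (y, 0)) * (bweight y * klein a (y, 0) ^ p)) \<partial>lebesgue)"

lemma square_integrable_test:
  fixes a :: "(real^'m) \<times> real"
  assumes m: "CARD('m) \<ge> 2"
  shows "square_integrable (lebesgue_on half_space) (\<lambda>x. wt x * (base x * omega x * klein_mono a p i x))"
proof (rule square_integrable_half_space[OF m])
  let ?M = "real CARD('m)"
  show "continuous_on closed_half_space (\<lambda>x. wt x * (base x * omega x * klein_mono a p i x))"
    by (intro continuous_intros continuous_on_id continuous_on_subset[OF continuous_on_test(2) closed_half_space_subset_wt])
  fix x :: "(real^'m) \<times> real" assume x: "snd x \<ge> 0"
  have p: "wt x > 0" by (rule wt_pos[OF x])
  have "norm (wt x * (base x * omega x * klein_mono a p i x)) = wt x * (base x * omega x * \<bar>klein_mono a p i x\<bar>)"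
    using p base_omega_nonneg[OF x] unfolding real_norm_def abs_mult[of "wt x"] abs_mult[of "base x * omega x"] by simp
  also have "\<dots> \<le> wt x * (4 * D * wt x powr (- (?M + 3) / 2) * norm a ^ p)"
    using p D_gt_1 by (intro mult_left_mono mult_mono[OF base_omega_le[OF x] klein_mono_bound]) auto
  also have "\<dots> = 4 * D * norm a ^ p * wt x powr (- (?M + 3) / 2 + 1)" using p by (simp add: powr_add)
  also have "\<dots> \<le> 4 * D * norm a ^ p * (kk powr (- (?M + 3) / 2 + 1 - (- ?M / 2)) * wt x powr (- ?M / 2))"
    using wt_powr_le[OF x, of "- (?M + 3) / 2 + 1" "- ?M / 2"] D_gt_1 by (intro mult_left_mono) (auto simp: field_simps)
  finally show "norm (wt x * (base x * omega x * klein_mono a p i x))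
     \<le> (4 * D * norm a ^ p * kk powr (- (?M + 3) / 2 + 1 - (- ?M / 2))) * wt x powr (- ?M / 2)" by simp
qed

lemma integrable_moment:
  fixes a :: "(real^'m) \<times> real"
  assumes m: "CARD('m) \<ge> 2" and v: "robin_solution v g T"
  shows "integrable (lebesgue_on half_space) (\<lambda>x. (v x / wt x) * (wt x * (base x * omega x * klein_mono a p i x)))"
  using square_integrable_inner[OF _ square_integrable_test[OF m, of a p i], of "\<lambda>x. v x / wt x"] v
  unfolding robin_solution_def admissible_def inner_real_def by blast

text \<open>The interior defect of the test function \<open>base * klein_mono a p i\<close> is
  \<open>Mmono\<close>, a combination of three monomials. On the boundary \<open>|y|^2\<close> is
  the constant \<open>1 / D^2\<close>, so all powers \<open>i\<close> lead back to the same boundary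
  moment, apart from an explicit factor.\<close>

lemma moment_identity:
  fixes v :: "(real^'m) \<times> real \<Rightarrow> real"
  assumes m: "CARD('m) \<ge> 2" and v: "robin_solution v g T"
  shows "real p * (real p - 1) * (norm a)\<^sup>2 * moment_int v a (p - 2) i
    + 2 * real i * ((real CARD('m) + 1) + 2 * real i - 2 + 2 * real p) * moment_int v a p (i - 1)
    - (real p + 2 * real i) * (real p + 2 * real i - 1) * moment_int v a p i
    = (real p + 2 * real i - 1) * (1 / D\<^sup>2) ^ i * moment_bd T a p"
proof -
  let ?M = "real CARD('m)"
  let ?f = "\<lambda>x::(real^'m) \<times> real. base x * omega x * Mmono a p i x"
  let ?d = "real p + 2 * real i"
  let ?\<beta> = "\<lambda>y::real^'m. 2 * kk * (1 - ?d) * wt (y, 0) powr (- (?M + 1) / 2) * klein_mono a p i (y, 0)"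
  obtain K1 where K1: "K1 \<ge> 0" "\<And>x. \<bar>Mmono a p i x\<bar> \<le> K1" by (rule Mmono_bound[of a p i]) blast
  obtain K2 where K2: "\<And>x. snd x \<ge> 0 \<Longrightarrow> norm (Gtest a p i x) \<le> K2 * wt x powr (- ?M / 2)" by (rule Gtest_bound[of a p i]) blast
  \<comment> \<open>One constant large enough for the four decay bounds required of the test
    function, its gradient and its two defects.\<close>
  define C where "C = max (max (D * norm a ^ p) K2) (max (4 * D * K1) (2 * kk * \<bar>1 - ?d\<bar> * norm a ^ p))"
  have C: "D * norm a ^ p \<le> C" "K2 \<le> C" "4 * D * K1 \<le> C" "2 * kk * \<bar>1 - ?d\<bar> * norm a ^ p \<le> C"
    by (auto simp: C_def)
  have "(\<integral>x. (v x / wt x) * (wt x * ?f x) \<partial>lebesgue_on half_space)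
    + (\<integral>y. (T y / sqrt (wt (y, 0))) * (sqrt (wt (y, 0)) * ?\<beta> y) \<partial>lebesgue) = 0"
  proof (rule robin_solution_test[OF m v lap_test, where C = C])
    fix x :: "(real^'m) \<times> real" assume x: "snd x \<ge> 0"
    have "\<bar>base x * klein_mono a p i x\<bar> \<le> (D * wt x powr ((1 - ?M) / 2)) * norm a ^ p"
      using base_le[OF x] base_pos[OF x] klein_mono_bound[of a p i x] unfolding abs_mult by (intro mult_mono) auto
    also have "\<dots> \<le> C * wt x powr ((1 - ?M) / 2)"
      using mult_right_mono[OF C(1), of "wt x powr ((1 - ?M) / 2)"] by (simp add: mult_ac)
    finally show "\<bar>base x * klein_mono a p i x\<bar> \<le> C * wt x powr ((1 - ?M) / 2)" .
    show "norm (Gtest a p i x) \<le> C * wt x powr (- ?M / 2)"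
      using K2[OF x] mult_right_mono[OF C(2), of "wt x powr (- ?M / 2)"] by simp
    have "\<bar>?f x\<bar> \<le> (4 * D * wt x powr (- (?M + 3) / 2)) * K1"
      using base_omega_le[OF x] base_omega_nonneg[OF x] K1(2)[of x] unfolding abs_mult[of "base x * omega x"]
      by (intro mult_mono) auto
    also have "\<dots> \<le> C * wt x powr (- (?M + 3) / 2)"
      using mult_right_mono[OF C(3), of "wt x powr (- (?M + 3) / 2)"] by (simp add: mult_ac)
    finally show "\<bar>?f x\<bar> \<le> C * wt x powr (- (?M + 3) / 2)" .
  next
    fix y :: "real^'m"
    show "Gtest a p i (y, 0) \<bullet> (0, 1) = - (?M + 1) * D * (base (y, 0) * klein_mono a p i (y, 0)) / wt (y, 0) + ?\<beta> y"
      by (rule boundary_test)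
    have "\<bar>?\<beta> y\<bar> = 2 * kk * \<bar>1 - ?d\<bar> * wt (y, 0) powr (- (?M + 1) / 2) * \<bar>klein_mono a p i (y, 0)\<bar>"
      using kk_pos by (simp add: abs_mult)
    also have "\<dots> \<le> 2 * kk * \<bar>1 - ?d\<bar> * wt (y, 0) powr (- (?M + 1) / 2) * norm a ^ p"
      using kk_pos klein_mono_bound[of a p i "(y, 0)"] by (intro mult_left_mono) auto
    also have "\<dots> \<le> C * wt (y, 0) powr (- (?M + 1) / 2)"
      using mult_right_mono[OF C(4), of "wt (y, 0) powr (- (?M + 1) / 2)"] by (simp add: mult_ac)
    finally show "\<bar>?\<beta> y\<bar> \<le> C * wt (y, 0) powr (- (?M + 1) / 2)" .
  qed simp
  moreover have "(\<integral>x. (v x / wt x) * (wt x * ?f x) \<partial>lebesgue_on half_space)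
     = real p * (real p - 1) * (norm a)\<^sup>2 * moment_int v a (p - 2) i
    + 2 * real i * ((?M + 1) + 2 * real i - 2 + 2 * real p) * moment_int v a p (i - 1)
    - ?d * (?d - 1) * moment_int v a p i"
  proof -
    let ?h = "\<lambda>p i x. (v x / wt x) * (wt x * (base x * omega x * klein_mono a p i x))"
    have "(\<integral>x. (v x / wt x) * (wt x * ?f x) \<partial>lebesgue_on half_space)
      = (\<integral>x. real p * (real p - 1) * (norm a)\<^sup>2 * ?h (p - 2) i x
        + 2 * real i * ((?M + 1) + 2 * real i - 2 + 2 * real p) * ?h p (i - 1) x - ?d * (?d - 1) * ?h p i x \<partial>lebesgue_on half_space)"
      by (rule Bochner_Integration.integral_cong[OF refl]) (simp only: Mmono_def distrib_left right_diff_distrib mult_ac)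
    also have "\<dots> = (\<integral>x. real p * (real p - 1) * (norm a)\<^sup>2 * ?h (p - 2) i x
        + 2 * real i * ((?M + 1) + 2 * real i - 2 + 2 * real p) * ?h p (i - 1) x \<partial>lebesgue_on half_space)
        - (\<integral>x. ?d * (?d - 1) * ?h p i x \<partial>lebesgue_on half_space)"
      by (intro Bochner_Integration.integral_diff Bochner_Integration.integrable_add integrable_mult_right integrable_moment[OF m v])
    also have "(\<integral>x. real p * (real p - 1) * (norm a)\<^sup>2 * ?h (p - 2) i x
        + 2 * real i * ((?M + 1) + 2 * real i - 2 + 2 * real p) * ?h p (i - 1) x \<partial>lebesgue_on half_space)
      = (\<integral>x. real p * (real p - 1) * (norm a)\<^sup>2 * ?h (p - 2) i x \<partial>lebesgue_on half_space)
        + (\<integral>x. 2 * real i * ((?M + 1) + 2 * real i - 2 + 2 * real p) * ?h p (i - 1) x \<partial>lebesgue_on half_space)"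
      by (intro Bochner_Integration.integral_add integrable_mult_right integrable_moment[OF m v])
    finally show ?thesis unfolding integral_mult_right_zero moment_int_def .
  qed
  moreover have "(\<integral>y. (T y / sqrt (wt (y, 0))) * (sqrt (wt (y, 0)) * ?\<beta> y) \<partial>lebesgue)
     = (1 - ?d) * (1 / D\<^sup>2) ^ i * moment_bd T a p"
    unfolding moment_bd_def bweight_def klein_mono_def rad_boundary integral_mult_right_zero[symmetric]
    by (rule Bochner_Integration.integral_cong[OF refl]) (simp only: mult_ac)
  ultimately show ?thesis by (simp add: left_diff_distrib algebra_simps)
qed

lemma moment_int_tendsto_0:
  fixes v :: "(real^'m) \<times> real \<Rightarrow> real"
  assumes m: "CARD('m) \<ge> 2" and v: "robin_solution v g T"
  shows "moment_int v a p \<longlonglongrightarrow> 0"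
proof -
  let ?H = "lebesgue_on half_space :: ((real^'m) \<times> real) measure"
  let ?h = "\<lambda>x. (v x / wt x) * (wt x * (base x * omega x * klein_mono a 0 0 x))"
  have i0: "integrable ?H ?h" by (rule integrable_moment[OF m v])
  define I where "I = (\<integral>x. norm a ^ p * norm (?h x) \<partial>?H)"
  have b: "norm (moment_int v a p i) \<le> (1 / D\<^sup>2) ^ i * I" for i
  proof -
    have "norm (moment_int v a p i) \<le> (\<integral>x. norm ((v x / wt x) * (wt x * (base x * omega x * klein_mono a p i x))) \<partial>?H)"
      unfolding moment_int_def by (rule integral_norm_bound)
    also have "\<dots> \<le> (\<integral>x. (1 / D\<^sup>2) ^ i * (norm a ^ p * norm (?h x)) \<partial>?H)"
    proof (rule integral_mono)
      show "integrable ?H (\<lambda>x. norm ((v x / wt x) * (wt x * (base x * omega x * klein_mono a p i x))))"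
        by (intro integrable_norm integrable_moment[OF m v])
      show "integrable ?H (\<lambda>x. (1 / D\<^sup>2) ^ i * (norm a ^ p * norm (?h x)))"
        by (intro integrable_mult_right integrable_norm i0)
      fix x assume "x \<in> space ?H"
      then have x: "snd x \<ge> 0" by (simp add: half_space_def)
      have "norm ((v x / wt x) * (wt x * (base x * omega x * klein_mono a p i x))) = norm (?h x) * \<bar>klein_mono a p i x\<bar>"
        by (simp add: klein_mono_def abs_mult mult_ac)
      also have "\<dots> \<le> norm (?h x) * ((1 / D\<^sup>2) ^ i * norm a ^ p)"
        by (intro mult_left_mono klein_mono_bound_half_space[OF x]) simp
      finally show "norm ((v x / wt x) * (wt x * (base x * omega x * klein_mono a p i x))) \<le> (1 / D\<^sup>2) ^ i * (norm a ^ p * norm (?h x))"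
        by (simp only: mult_ac)
    qed
    finally show ?thesis unfolding I_def integral_mult_right_zero .
  qed
  have "1 / D\<^sup>2 < 1" using D_gt_1 by (simp add: field_simps)
  then have "(\<lambda>i. (1 / D\<^sup>2) ^ i) \<longlonglongrightarrow> 0" by (intro LIMSEQ_power_zero) simp
  then have "(\<lambda>i. (1 / D\<^sup>2) ^ i * I) \<longlonglongrightarrow> 0 * I" by (intro tendsto_mult tendsto_const)
  then show ?thesis by (intro Lim_null_comparison[OF always_eventually[rule_format, OF b]]) simp
qed

lemma moment_bd_scale: "moment_bd T (c *\<^sub>R a) p = c ^ p * moment_bd T a p"
proof -
  have "klein (c *\<^sub>R a) x = c * klein a x" for x by (simp add: inner_kvec[symmetric])
  then show ?thesis
    unfolding moment_bd_def integral_mult_right_zero[symmetric]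
    by (intro Bochner_Integration.integral_cong) (simp_all add: power_mult_distrib mult_ac)
qed

text \<open>The recursion is normalised to unit vectors, where the coefficient \<open>|a|^2\<close>
  is 1; homogeneity of the boundary moment in \<open>a\<close> gives the other directions.\<close>

lemma moment_bd_zero:
  fixes v :: "(real^'m) \<times> real \<Rightarrow> real"
  assumes m: "CARD('m) \<ge> 2" and v: "robin_solution v g T" and lin: "\<And>a. moment_bd T a 1 = 0"
  shows "moment_bd T a p = 0"
proof -
  have unit: "moment_bd T b p = 0" if b: "norm b = 1" for b p
  proof (rule moment_recursion[where A = "moment_int v b" and N = "real CARD('m) + 1" and \<theta> = "1 / D\<^sup>2"])
    show "moment_bd T b 1 = 0" by (rule lin)
    show "moment_int v b p \<longlonglongrightarrow> 0" for p by (rule moment_int_tendsto_0[OF m v])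
  qed (use m b moment_identity[OF m v, of _ b] in auto)
  show ?thesis
  proof (cases "a = 0")
    \<comment> \<open>The zero vector is \<open>0\<close> times a basis vector. For
      \<open>p = 0\<close> the factor \<open>0 ^ 0\<close> is 1, so the vanishing in the unit case
      is what counts.\<close>
    case True
    obtain b :: "(real^'m) \<times> real" where b: "b \<in> Basis" using nonempty_Basis by blast
    have "moment_bd T (0 *\<^sub>R b) p = 0 ^ p * moment_bd T b p" by (rule moment_bd_scale)
    then show ?thesis using True unit[of b p] b by simp
  next
    case False
    then have "moment_bd T (norm a *\<^sub>R ((1 / norm a) *\<^sub>R a)) p = norm a ^ p * 0"
      unfolding moment_bd_scale[of _ "norm a"] by (subst unit) simp_all
    then show ?thesis using False by simp
  qed
qed

text \<open>For \<open>p = 1\<close> and \<open>i = 0\<close> both defects vanish: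
  \<open>Mmono a 1 0 = 0\<close>, and the boundary factor \<open>1 - (p + 2 * i)\<close> is
  0.\<close>

lemma robin_solution_klein:
  fixes a :: "(real^'m) \<times> real"
  assumes m: "CARD('m) \<ge> 2"
  shows "robin_solution (\<lambda>x. base x * klein a x) (Gtest a 1 0) (\<lambda>y. base (y, 0) * klein a (y, 0))"
proof -
  let ?M = "real CARD('m)"
  let ?z = "\<lambda>x::(real^'m) \<times> real. base x * klein a x"
  have mo: "klein_mono a 1 0 x = klein a x" for x by (simp add: klein_mono_def)
  have M0: "Mmono a 1 0 x = 0" for x by (simp add: Mmono_def)
  have lap: "lap_on {x. wt x > 0} ?z (Gtest a 1 0) (\<lambda>x. (?M + 1) * (?M + 3) * ?z x / (wt x)\<^sup>2)"
    using lap_test[of a 1 0] by (simp only: mo M0 mult_zero_right add_0_right)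
  have bd: "Gtest a 1 0 (y, 0) \<bullet> (0, 1) = - (?M + 1) * D * ?z (y, 0) / wt (y, 0)" for y
    using boundary_test[of a 1 0 y] by (simp only: mo) simp
  obtain K2 where K2: "\<And>x. snd x \<ge> 0 \<Longrightarrow> norm (Gtest a 1 0 x) \<le> K2 * wt x powr (- ?M / 2)" by (rule Gtest_bound[of a 1 0]) blast
  define C where "C = max (D * norm a) K2"
  have C: "D * norm a \<le> C" "K2 \<le> C" by (auto simp: C_def)
  have adm: "admissible ?z (Gtest a 1 0) (\<lambda>y. ?z (y, 0))"
  proof (rule decay_admissible[OF m lap_on_has_derivative[OF lap] lap_on_continuous_gradient[OF lap], where C = C])
    fix x :: "(real^'m) \<times> real" assume x: "snd x \<ge> 0"
    have "\<bar>?z x\<bar> \<le> (D * wt x powr ((1 - ?M) / 2)) * norm a"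
      using base_le[OF x] base_pos[OF x] klein_bound[of a x] unfolding abs_mult by (intro mult_mono) auto
    also have "\<dots> \<le> C * wt x powr ((1 - ?M) / 2)"
      using mult_right_mono[OF C(1), of "wt x powr ((1 - ?M) / 2)"] by (simp add: mult_ac)
    finally show "\<bar>?z x\<bar> \<le> C * wt x powr ((1 - ?M) / 2)" .
    show "norm (Gtest a 1 0 x) \<le> C * wt x powr (- ?M / 2)"
      using K2[OF x] mult_right_mono[OF C(2), of "wt x powr (- ?M / 2)"] by simp
  qed simp
  show ?thesis
    unfolding robin_solution_def
  proof (intro conjI allI impI adm)
    fix \<psi> :: "(real^'m) \<times> real \<Rightarrow> real" assume \<psi>: "C1_compact \<psi>"
    let ?H = "lebesgue_on half_space :: ((real^'m) \<times> real) measure"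
    have 1: "(\<integral>x. \<psi> x * ((?M + 1) * (?M + 3) * ?z x / (wt x)\<^sup>2) \<partial>?H)
      = (?M + 1) * (?M + 3) * (\<integral>x. (?z x / wt x) * (\<psi> x / wt x) \<partial>?H)"
      unfolding integral_mult_right_zero[symmetric]
      by (rule Bochner_Integration.integral_cong[OF refl]) (simp add: power2_eq_square)
    have "(\<integral>y. \<psi> (y, 0) * (Gtest a 1 0 (y, 0) \<bullet> (0, 1)) \<partial>lborel) = (\<integral>y. \<psi> (y, 0) * (Gtest a 1 0 (y, 0) \<bullet> (0, 1)) \<partial>lebesgue)"
    proof (rule integral_completion[symmetric])
      have "continuous_on UNIV (\<lambda>y. \<psi> (y, 0) * (Gtest a 1 0 (y, 0) \<bullet> (0, 1)))"
        by (intro continuous_on_mult continuous_on_inner continuous_on_const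
            continuous_on_compose2[OF C1_compact_continuous[OF \<psi>, of UNIV]]
            continuous_on_compose2[OF lap_on_continuous_gradient[OF lap]] continuous_on_Pair continuous_on_id) (auto intro: wt_pos)
      then show "(\<lambda>y. \<psi> (y, 0) * (Gtest a 1 0 (y, 0) \<bullet> (0, 1))) \<in> borel_measurable lborel"
        by (simp add: borel_measurable_continuous_onI)
    qed
    also have "\<dots> = - ((?M + 1) * D) * (\<integral>y. (?z (y, 0) / sqrt (wt (y, 0))) * (\<psi> (y, 0) / sqrt (wt (y, 0))) \<partial>lebesgue)"
      unfolding integral_mult_right_zero[symmetric]
    proof (rule Bochner_Integration.integral_cong[OF refl])
      fix y :: "real^'m"
      have "sqrt (wt (y, 0)) * sqrt (wt (y, 0)) = wt (y, 0)" using wt_pos[of "(y, 0)"] by simp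
      then have q: "(?z (y, 0) / sqrt (wt (y, 0))) * (\<psi> (y, 0) / sqrt (wt (y, 0))) = ?z (y, 0) * \<psi> (y, 0) / wt (y, 0)"
        by (simp only: times_divide_times_eq)
      show "\<psi> (y, 0) * (Gtest a 1 0 (y, 0) \<bullet> (0, 1))
          = - ((?M + 1) * D) * ((?z (y, 0) / sqrt (wt (y, 0))) * (\<psi> (y, 0) / sqrt (wt (y, 0))))"
        unfolding q bd by (simp add: algebra_simps)
    qed
    finally have 2: "(\<integral>y. \<psi> (y, 0) * (Gtest a 1 0 (y, 0) \<bullet> (0, 1)) \<partial>lborel) = \<dots>" .
    have "(\<integral>x. gradient \<psi> x \<bullet> Gtest a 1 0 x \<partial>?H)
      = - ((?M + 1) * (?M + 3) * (\<integral>x. (?z x / wt x) * (\<psi> x / wt x) \<partial>?H))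
       - (- ((?M + 1) * D) * (\<integral>y. (?z (y, 0) / sqrt (wt (y, 0))) * (\<psi> (y, 0) / sqrt (wt (y, 0))) \<partial>lebesgue))"
      using green_half_space[OF \<psi> lap closed_half_space_subset_wt] unfolding 1 2 .
    moreover have "r + b * X - c * Y = 0" if "r = - (b * X) - (- c * Y)" for r b c X Y :: real
      using that by simp
    ultimately show "robin_form ?z (Gtest a 1 0) (\<lambda>y. ?z (y, 0)) \<psi> (gradient \<psi>) (\<lambda>y. \<psi> (y, 0)) = 0"
      unfolding robin_form_def inner_commute[of "Gtest _ _ _ _"] by blast
  qed
qed

end

section \<open>Vanishing moments\<close>

text \<open>The known moments are those of powers of a single linear form. Exponentials are power
  series in one linear form and are closed under products, so they give a Stone-Weierstrass algebra
  without having to polarise mixed monomials.\<close>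

inductive_set exp_sums :: "('a::euclidean_space \<Rightarrow> real) set" where
  exp_sums_exp: "(\<lambda>z. c * exp (a \<bullet> z)) \<in> exp_sums"
| exp_sums_add: "f \<in> exp_sums \<Longrightarrow> g \<in> exp_sums \<Longrightarrow> (\<lambda>z. f z + g z) \<in> exp_sums"

lemma exp_sums_mult:
  assumes "f \<in> exp_sums" "g \<in> exp_sums"
  shows "(\<lambda>z. f z * g z) \<in> exp_sums"
  using assms(1)
proof induction
  case (exp_sums_exp c a)
  show ?case using assms(2)
  proof induction
    case (exp_sums_exp d b)
    have "(\<lambda>z. c * exp (a \<bullet> z) * (d * exp (b \<bullet> z))) = (\<lambda>z. (c * d) * exp ((a + b) \<bullet> z))"
      by (simp add: fun_eq_iff inner_add_left exp_add)
    then show ?case using exp_sums.exp_sums_exp by metis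
  next
    case (exp_sums_add f g)
    then show ?case using exp_sums.exp_sums_add by (simp add: distrib_left)
  qed
next
  case (exp_sums_add f1 f2)
  then show ?case using exp_sums.exp_sums_add by (simp add: distrib_right)
qed

lemma continuous_on_exp_sums: "f \<in> exp_sums \<Longrightarrow> continuous_on S f"
  by (induction rule: exp_sums.induct) (auto intro!: continuous_intros)

lemma exp_sums_dense:
  fixes f :: "'a::euclidean_space \<Rightarrow> real"
  assumes S: "compact S" and f: "continuous_on S f" and e: "e > 0"
  obtains g where "g \<in> exp_sums" "\<And>x. x \<in> S \<Longrightarrow> \<bar>f x - g x\<bar> < e"
proof -
  interpret function_ring_on exp_sums S
  proof
    show "(\<lambda>_::'a. c) \<in> exp_sums" for c
      using exp_sums_exp[of c "0::'a"] by simp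
    \<comment> \<open>The exponential in the direction \<open>x - y\<close> separates the two
      points.\<close>
    fix x y :: 'a assume "x \<noteq> y"
    then have "(x - y) \<bullet> (x - y) \<noteq> 0" by simp
    then have "(x - y) \<bullet> x \<noteq> (x - y) \<bullet> y" by (simp add: inner_diff_right)
    then show "\<exists>f\<in>exp_sums. f x \<noteq> f y"
      using exp_sums_exp[of 1 "x - y"] by (intro bexI[of _ "\<lambda>z. 1 * exp ((x - y) \<bullet> z)"]) auto
  qed (use S in \<open>auto intro: continuous_on_exp_sums exp_sums_add exp_sums_mult\<close>)
  show thesis using Stone_Weierstrass_basic[OF f e] that by blast
qed

text \<open>The exponential series is integrated term by term; as \<open>|a.k| <= |a|\<close>, all
  partial sums are dominated by \<open>|w| * exp |a|\<close>.\<close>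

lemma integral_exp_0:
  fixes w :: "'b \<Rightarrow> real" and k :: "'b \<Rightarrow> 'a::euclidean_space"
  assumes w: "integrable M w" and k: "k \<in> borel_measurable M" "\<And>y. norm (k y) \<le> 1"
    and mom: "\<And>a p. (\<integral>y. w y * (a \<bullet> k y) ^ p \<partial>M) = 0"
  shows "(\<integral>y. w y * exp (a \<bullet> k y) \<partial>M) = 0"
proof -
  have ak: "\<bar>a \<bullet> k y\<bar> \<le> norm a" for y
    using Cauchy_Schwarz_ineq2[of a "k y"] mult_left_le[OF k(2)[of y] norm_ge_zero[of a]] by linarith
  have ip: "integrable M (\<lambda>y. w y * (a \<bullet> k y) ^ p)" for p
  proof (rule Bochner_Integration.integrable_bound[of M "\<lambda>y. norm a ^ p * w y"])
    show "AE y in M. norm (w y * (a \<bullet> k y) ^ p) \<le> norm (norm a ^ p * w y)"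
    proof (rule AE_I2)
      fix y
      have "\<bar>a \<bullet> k y\<bar> ^ p \<le> norm a ^ p" by (intro power_mono ak) simp
      then have "\<bar>w y\<bar> * \<bar>a \<bullet> k y\<bar> ^ p \<le> \<bar>w y\<bar> * norm a ^ p" by (rule mult_left_mono) simp
      then show "norm (w y * (a \<bullet> k y) ^ p) \<le> norm (norm a ^ p * w y)"
        by (simp add: abs_mult power_abs mult.commute)
    qed
  qed (use w k in auto)
  let ?s = "\<lambda>n y. \<Sum>p<n. w y * (a \<bullet> k y) ^ p / fact p"
  have "(\<lambda>n. \<integral>y. ?s n y \<partial>M) \<longlonglongrightarrow> (\<integral>y. w y * exp (a \<bullet> k y) \<partial>M)"
  proof (rule integral_dominated_convergence[where w="\<lambda>y. \<bar>w y\<bar> * exp (norm a)"])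
    show "AE y in M. (\<lambda>n. ?s n y) \<longlonglongrightarrow> w y * exp (a \<bullet> k y)"
    proof (rule AE_I2)
      fix y
      have "(\<lambda>p. (a \<bullet> k y) ^ p /\<^sub>R fact p) sums exp (a \<bullet> k y)" by (rule exp_converges)
      from sums_mult[OF this, of "w y"] show "(\<lambda>n. ?s n y) \<longlonglongrightarrow> w y * exp (a \<bullet> k y)"
        by (simp add: sums_def divide_inverse mult_ac)
    qed
    show "AE y in M. norm (?s n y) \<le> \<bar>w y\<bar> * exp (norm a)" for n
    proof (rule AE_I2)
      fix y
      have "norm (?s n y) \<le> (\<Sum>p<n. \<bar>w y\<bar> * (norm a ^ p /\<^sub>R fact p))"
      proof (rule sum_norm_le)
        fix p
        have "\<bar>a \<bullet> k y\<bar> ^ p \<le> norm a ^ p" by (intro power_mono ak) simp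
        then have "\<bar>w y\<bar> * \<bar>a \<bullet> k y\<bar> ^ p / fact p \<le> \<bar>w y\<bar> * norm a ^ p / fact p"
          by (intro divide_right_mono mult_left_mono) auto
        then show "norm (w y * (a \<bullet> k y) ^ p / fact p) \<le> \<bar>w y\<bar> * (norm a ^ p /\<^sub>R fact p)"
          by (simp add: abs_mult power_abs divide_inverse mult_ac)
      qed
      also have "\<dots> = \<bar>w y\<bar> * (\<Sum>p<n. norm a ^ p /\<^sub>R fact p)" by (simp only: sum_distrib_left)
      also have "\<dots> \<le> \<bar>w y\<bar> * exp (norm a)"
      proof (rule mult_left_mono)
        have s: "(\<lambda>p. norm a ^ p /\<^sub>R fact p) sums exp (norm a)" by (rule exp_converges)
        show "(\<Sum>p<n. norm a ^ p /\<^sub>R fact p) \<le> exp (norm a)"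
          using sum_le_suminf[OF sums_summable[OF s], of "{..<n}"] sums_unique[OF s] by simp
      qed simp
      finally show "norm (?s n y) \<le> \<bar>w y\<bar> * exp (norm a)" .
    qed
    show "integrable M (\<lambda>y. \<bar>w y\<bar> * exp (norm a))" using w by auto
    show "?s n \<in> borel_measurable M" for n using w k by auto
    show "(\<lambda>y. w y * exp (a \<bullet> k y)) \<in> borel_measurable M" using w k by auto
  qed
  moreover have "(\<integral>y. ?s n y \<partial>M) = 0" for n
  proof -
    have "(\<integral>y. ?s n y \<partial>M) = (\<Sum>p<n. \<integral>y. w y * (a \<bullet> k y) ^ p / fact p \<partial>M)"
      by (rule Bochner_Integration.integral_sum) (intro integrable_divide ip)
    also have "\<dots> = 0" by (simp only: integral_divide_zero mom) simp
    finally show ?thesis .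
  qed
  ultimately show ?thesis by (simp add: tendsto_const_iff)
qed

lemma integral_continuous_0:
  fixes w :: "'b \<Rightarrow> real" and k :: "'b \<Rightarrow> 'a::euclidean_space"
  assumes w: "integrable M w" and k: "k \<in> borel_measurable M" "\<And>y. norm (k y) \<le> 1"
    and mom: "\<And>a p. (\<integral>y. w y * (a \<bullet> k y) ^ p \<partial>M) = 0"
    and f: "continuous_on UNIV f"
  shows "(\<integral>y. w y * f (k y) \<partial>M) = 0"
proof -
  have ic: "integrable M (\<lambda>y. w y * h (k y))" if h: "continuous_on UNIV h" for h
  proof -
    have "compact (h ` cball 0 1)" by (intro compact_continuous_image continuous_on_subset[OF h]) auto
    then obtain C where C: "\<forall>z\<in>h ` cball 0 1. norm z \<le> C" using compact_imp_bounded bounded_iff by metis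
    have m: "(\<lambda>y. h (k y)) \<in> borel_measurable M"
      using measurable_compose[OF k(1) borel_measurable_continuous_onI[OF h]] .
    show ?thesis
    proof (rule Bochner_Integration.integrable_bound[of M "\<lambda>y. C * w y"])
      show "AE y in M. norm (w y * h (k y)) \<le> norm (C * w y)"
      proof (rule AE_I2)
        fix y
        have "\<bar>h (k y)\<bar> \<le> \<bar>C\<bar>" using C k(2)[of y] by force
        then have "\<bar>w y\<bar> * \<bar>h (k y)\<bar> \<le> \<bar>w y\<bar> * \<bar>C\<bar>" by (rule mult_left_mono) simp
        then show "norm (w y * h (k y)) \<le> norm (C * w y)" by (simp add: abs_mult mult.commute)
      qed
    qed (use w m in auto)
  qed
  have es: "(\<integral>y. w y * g (k y) \<partial>M) = 0" if "g \<in> exp_sums" for g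
    using that
  proof induction
    case (exp_sums_exp c a)
    have "(\<integral>y. w y * (c * exp (a \<bullet> k y)) \<partial>M) = (\<integral>y. c * (w y * exp (a \<bullet> k y)) \<partial>M)" by (simp only: mult.left_commute)
    then show ?case using integral_exp_0[OF w k mom] by simp
  next
    case (exp_sums_add f g)
    then show ?case
      using Bochner_Integration.integral_add[OF ic[OF continuous_on_exp_sums[OF exp_sums_add(1)]]
          ic[OF continuous_on_exp_sums[OF exp_sums_add(2)]]] by (simp add: distrib_left)
  qed
  define I where "I = (\<integral>y. \<bar>w y\<bar> \<partial>M)"
  have I: "I \<ge> 0" unfolding I_def by (intro integral_nonneg_AE) simp
  have "\<bar>\<integral>y. w y * f (k y) \<partial>M\<bar> \<le> e" if e: "e > 0" for e :: real
  proof -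
    define d where "d = e / (I + 1)"
    have d: "d > 0" using e I by (simp add: d_def)
    obtain g where g: "g \<in> exp_sums" "\<And>x. x \<in> cball 0 1 \<Longrightarrow> \<bar>f x - g x\<bar> < d"
      by (rule exp_sums_dense[OF compact_cball continuous_on_subset[OF f] d, of 0 1]) auto
    have gc: "continuous_on UNIV g" by (rule continuous_on_exp_sums[OF g(1)])
    have "(\<integral>y. w y * f (k y) \<partial>M) = (\<integral>y. w y * f (k y) - w y * g (k y) \<partial>M)"
      using Bochner_Integration.integral_diff[OF ic[OF f] ic[OF gc]] es[OF g(1)] by simp
    also have "\<bar>\<dots>\<bar> \<le> (\<integral>y. \<bar>w y * f (k y) - w y * g (k y)\<bar> \<partial>M)"
      using integral_norm_bound[of M "\<lambda>y. w y * f (k y) - w y * g (k y)"] by simp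
    also have "\<dots> \<le> (\<integral>y. d * \<bar>w y\<bar> \<partial>M)"
    proof (rule integral_mono)
      show "integrable M (\<lambda>y. \<bar>w y * f (k y) - w y * g (k y)\<bar>)"
        by (intro integrable_abs Bochner_Integration.integrable_diff ic f gc)
      show "integrable M (\<lambda>y. d * \<bar>w y\<bar>)" using w by auto
      fix y
      have "\<bar>f (k y) - g (k y)\<bar> \<le> d" using g(2)[of "k y"] k(2)[of y] by simp
      then have "\<bar>w y\<bar> * \<bar>f (k y) - g (k y)\<bar> \<le> \<bar>w y\<bar> * d" by (rule mult_left_mono) simp
      then show "\<bar>w y * f (k y) - w y * g (k y)\<bar> \<le> d * \<bar>w y\<bar>"
        by (simp add: abs_mult[symmetric] right_diff_distrib mult.commute)
    qed
    also have "\<dots> = d * I" by (simp add: I_def)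
    also have "\<dots> \<le> e" using e I by (simp add: d_def field_simps)
    finally show ?thesis .
  qed
  then have "\<bar>\<integral>y. w y * f (k y) \<partial>M\<bar> \<le> 0" by (rule field_le_epsilon) simp
  then show ?thesis by simp
qed

lemma AE_0_if_moments_0:
  fixes w :: "'b::euclidean_space \<Rightarrow> real" and k :: "'b \<Rightarrow> 'a::euclidean_space"
  assumes w: "integrable lebesgue w" and k: "continuous_on UNIV k" "inj k" "\<And>y. norm (k y) \<le> 1"
    and mom: "\<And>a p. (\<integral>y. w y * (a \<bullet> k y) ^ p \<partial>lebesgue) = 0"
  shows "AE y in lebesgue. w y = 0"
proof (rule AE_eq_0_if_box_integrals_0[OF w])
  have km: "k \<in> borel_measurable lebesgue"
    using k(1) by (intro measurable_completion) (simp add: borel_measurable_continuous_onI)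
  have wm: "w \<in> borel_measurable lebesgue" using w by auto
  have comp: "(\<integral>y. indicator C y * w y \<partial>lebesgue) = 0" if C: "compact C" "C \<noteq> {}" for C
  proof -
    define K where "K = k ` C"
    have K: "closed K" "K \<noteq> {}"
      unfolding K_def using C by (auto intro!: compact_imp_closed compact_continuous_image continuous_on_subset[OF k(1)])
    \<comment> \<open>Continuous cutoffs equal to 1 on the closed set \<open>K\<close> and
      eventually 0 at each point off it.\<close>
    define f where "f = (\<lambda>(n::nat) z. max 0 (1 - real n * infdist z K))"
    have f: "continuous_on UNIV (f n)" for n unfolding f_def by (intro continuous_intros)
    have "(\<lambda>n. \<integral>y. w y * f n (k y) \<partial>lebesgue) \<longlonglongrightarrow> (\<integral>y. indicator C y * w y \<partial>lebesgue)"
    proof (rule integral_dominated_convergence[where w="\<lambda>y. \<bar>w y\<bar>"])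
      show "AE y in lebesgue. (\<lambda>n. w y * f n (k y)) \<longlonglongrightarrow> indicator C y * w y"
      proof (intro AE_I2 tendsto_eventually)
        fix y
        show "\<forall>\<^sub>F n in sequentially. w y * f n (k y) = indicator C y * w y"
        proof (cases "y \<in> C")
          case True
          then show ?thesis using K by (simp add: f_def K_def)
        next
          case False
          then have "k y \<notin> K" using k(2) by (auto simp: K_def inj_def)
          then have "infdist (k y) K > 0" using K infdist_pos_not_in_closed by blast
          then obtain N :: nat where N: "1 < real N * infdist (k y) K"
            using reals_Archimedean3 by blast
          show ?thesis using eventually_ge_at_top[of N]
          proof eventually_elim
            case (elim n)
            have "real N * infdist (k y) K \<le> real n * infdist (k y) K"
              using elim by (intro mult_right_mono infdist_nonneg) simp
            then show ?case using N False by (simp add: f_def)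
          qed
        qed
      qed
      show "AE y in lebesgue. norm (w y * f n (k y)) \<le> \<bar>w y\<bar>" for n
      proof (rule AE_I2)
        fix y
        have "0 \<le> f n (k y)" "f n (k y) \<le> 1" by (auto simp: f_def infdist_nonneg)
        then show "norm (w y * f n (k y)) \<le> \<bar>w y\<bar>" by (simp add: abs_mult mult_left_le)
      qed
      show "(\<lambda>y. w y * f n (k y)) \<in> borel_measurable lebesgue" for n
        using measurable_compose[OF km borel_measurable_continuous_onI[OF f]] wm by simp
      show "(\<lambda>y. indicator C y * w y) \<in> borel_measurable lebesgue"
        using wm compact_imp_closed[OF C(1)] by (intro borel_measurable_times borel_measurable_indicator) auto
    qed (use w in auto)
    moreover have "(\<integral>y. w y * f n (k y) \<partial>lebesgue) = 0" for n
      by (rule integral_continuous_0[OF w km k(3) mom f])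
    ultimately show ?thesis by (simp add: tendsto_const_iff)
  qed
  fix a b :: 'b
  show "(\<integral>y. indicator (box a b) y * w y \<partial>lebesgue) = 0"
  proof (cases "box a b = {}")
    case False
    then have ne: "cbox a b \<noteq> {}" using box_subset_cbox by blast
    have "AE y in lebesgue. y \<notin> cbox a b - box a b"
      using negligible_frontier_interval[of a b] by (intro AE_not_in) (simp add: negligible_iff_null_sets)
    then have "(\<integral>y. indicator (box a b) y * w y \<partial>lebesgue) = (\<integral>y. indicator (cbox a b) y * w y \<partial>lebesgue)"
    proof (intro integral_cong_AE borel_measurable_times borel_measurable_indicator wm)
      show "AE y in lebesgue. indicator (box a b) y * w y = indicator (cbox a b) y * w y"
        using \<open>AE y in lebesgue. y \<notin> cbox a b - box a b\<close>
      proof eventually_elim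
        case (elim y)
        then show ?case using box_subset_cbox[of a b] by (auto simp: indicator_def)
      qed
    qed auto
    also have "\<dots> = 0" by (rule comp[OF compact_cbox ne])
    finally show ?thesis .
  qed simp
qed

context exterior_bubble begin

text \<open>On the boundary the last Klein coordinate is a strictly monotone function of
  \<open>|y|\<close>; once the norms agree, so do the denominators, and the tangential part
  determines \<open>y\<close>.\<close>

lemma inj_kvec_boundary: "inj (\<lambda>y::real^'m. kvec (y, 0))"
proof (rule injI)
  fix y z :: "real^'m" assume e: "kvec (y, 0) = kvec (z, 0)"
  have d: "den (y, 0) = D * ((norm y)\<^sup>2 + kk)" for y :: "real^'m" by (simp add: den_eq wt_boundary)
  have pos: "(norm y)\<^sup>2 + kk > 0" for y :: "real^'m" using kk_pos by (intro add_nonneg_pos) auto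
  have s: "(kk - (norm y)\<^sup>2) / ((norm y)\<^sup>2 + kk) = (kk - (norm z)\<^sup>2) / ((norm z)\<^sup>2 + kk)"
  proof -
    have "snd (kvec (y, 0)) = snd (kvec (z, 0))" by (simp only: e)
    then have "D * ((kk - (norm y)\<^sup>2) / (D * ((norm y)\<^sup>2 + kk))) = D * ((kk - (norm z)\<^sup>2) / (D * ((norm z)\<^sup>2 + kk)))"
      by (simp only: kvec_def d snd_conv norm_Pair norm_zero) simp
    then show ?thesis using D_gt_1 by simp
  qed
  have "(kk - (norm y)\<^sup>2) * ((norm z)\<^sup>2 + kk) = (kk - (norm z)\<^sup>2) * ((norm y)\<^sup>2 + kk)"
    using s pos[of y] pos[of z] by (simp add: field_simps)
  then have "2 * kk * ((norm z)\<^sup>2 - (norm y)\<^sup>2) = 0" by (simp add: algebra_simps)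
  then have n: "(norm z)\<^sup>2 = (norm y)\<^sup>2" using kk_pos by simp
  have "fst (kvec (y, 0)) = fst (kvec (z, 0))" by (simp only: e)
  then have "(2 * sqrt kk / den (y, 0)) *\<^sub>R y = (2 * sqrt kk / den (y, 0)) *\<^sub>R z"
    by (simp add: kvec_def d n)
  then show "y = z" using kk_pos den_nonzero[of "(y, 0)"] by simp
qed

lemma bweight_pos: "bweight y > 0"
  using wt_pos[of "(y, 0)"] kk_pos by (simp add: bweight_def)

lemma square_integrable_bweight:
  "square_integrable lebesgue (\<lambda>y::real^'m. sqrt (wt (y, 0)) * bweight y)"
proof (rule square_integrable_boundary)
  let ?M = "real CARD('m)"
  have "continuous_on UNIV (\<lambda>y::real^'m. wt (y, 0) powr (- (?M + 1) / 2))"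
    by (intro continuous_intros) (simp add: wt_nonzero)
  then show "continuous_on UNIV (\<lambda>y::real^'m. sqrt (wt (y, 0)) * bweight y)"
    unfolding bweight_def by (intro continuous_on_mult continuous_on_const continuous_on_real_sqrt continuous_on_wt
      continuous_on_Pair continuous_on_id)
  fix y :: "real^'m"
  have p: "wt (y, 0) > 0" by (rule wt_pos) simp
  have "norm (sqrt (wt (y, 0)) * bweight y) = 2 * kk * wt (y, 0) powr (1 / 2 + - (?M + 1) / 2)"
    using p kk_pos by (simp add: bweight_def powr_add powr_half_sqrt abs_mult)
  also have "1 / 2 + - (?M + 1) / 2 = - ?M / 2" by (simp add: field_simps)
  finally show "norm (sqrt (wt (y, 0)) * bweight y) \<le> 2 * kk * wt (y, 0) powr (- ?M / 2)" by simp
qed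

lemma trace_zero_if_moments_zero:
  fixes T :: "real^'m \<Rightarrow> real"
  assumes T: "square_integrable lebesgue (\<lambda>y. T y / sqrt (wt (y, 0)))"
    and mom: "\<And>a p. moment_bd T a p = 0"
  shows "AE y in lebesgue. T y = 0"
proof -
  let ?w = "\<lambda>y. (T y / sqrt (wt (y, 0))) * (sqrt (wt (y, 0)) * bweight y)"
  have "AE y in lebesgue. ?w y = 0"
  proof (rule AE_0_if_moments_0[where k = "\<lambda>y. kvec (y, 0)"])
    show "integrable lebesgue ?w"
      using square_integrable_inner[OF T square_integrable_bweight] by (simp only: inner_real_def)
    show "continuous_on UNIV (\<lambda>y::real^'m. kvec (y, 0))"
    proof -
      have i: "continuous_on UNIV (\<lambda>y::real^'m. (y, 0::real))" by (intro continuous_intros)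
      have d: "continuous_on UNIV (\<lambda>y::real^'m. den (y, 0))"
        by (rule continuous_on_compose2[OF lap_on_continuous[OF lap_den, of UNIV] i]) simp
      show ?thesis
        unfolding kvec_def
        by (intro continuous_on_Pair continuous_on_scaleR continuous_on_divide continuous_on_diff continuous_on_power
          continuous_on_norm continuous_on_const continuous_on_fst i d) (auto simp: den_nonzero)
    qed
    show "inj (\<lambda>y::real^'m. kvec (y, 0))" by (rule inj_kvec_boundary)
    show "norm (kvec (y, 0)) \<le> 1" for y :: "real^'m"
    proof -
      have "(norm (kvec (y, 0)))\<^sup>2 \<le> 1\<^sup>2" unfolding norm_kvec using rad_le_1[of "(y, 0)"] by simp
      then show ?thesis by (rule power2_le_imp_le) simp
    qed
    show "(\<integral>y. ?w y * (a \<bullet> kvec (y, 0)) ^ p \<partial>lebesgue) = 0" for a p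
      using mom[of a p] unfolding moment_bd_def inner_kvec by (simp only: mult.assoc)
  qed
  then show ?thesis
  proof eventually_elim
    case (elim y)
    then show ?case using bweight_pos[of y] wt_pos[of "(y, 0)"] by simp
  qed
qed

end

section \<open>Uniqueness of weak gradients\<close>

definition C1_fun :: "('a::euclidean_space \<Rightarrow> real) \<Rightarrow> bool" where
  "C1_fun f \<longleftrightarrow> (\<exists>G. (\<forall>x. (f has_derivative (\<lambda>h. G x \<bullet> h)) (at x)) \<and> continuous_on UNIV G)"

lemma C1_fun_continuous: "C1_fun f \<Longrightarrow> continuous_on S f"
  unfolding C1_fun_def using has_derivative_continuous by (blast intro: continuous_at_imp_continuous_on)

lemma C1_fun_mult:
  assumes "C1_fun f" "C1_fun g"
  shows "C1_fun (\<lambda>x. f x * g x)"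
proof -
  obtain F where F: "\<And>x. (f has_derivative (\<lambda>h. F x \<bullet> h)) (at x)" "continuous_on UNIV F"
    using assms(1) unfolding C1_fun_def by blast
  obtain G where G: "\<And>x. (g has_derivative (\<lambda>h. G x \<bullet> h)) (at x)" "continuous_on UNIV G"
    using assms(2) unfolding C1_fun_def by blast
  show ?thesis unfolding C1_fun_def
  proof (intro exI conjI allI)
    show "((\<lambda>x. f x * g x) has_derivative (\<lambda>h. (f x *\<^sub>R G x + g x *\<^sub>R F x) \<bullet> h)) (at x)" for x
      using has_derivative_mult[OF F(1) G(1), of x] by (simp add: inner_add_left mult.commute)
    show "continuous_on UNIV (\<lambda>x. f x *\<^sub>R G x + g x *\<^sub>R F x)"
      by (intro continuous_intros F G C1_fun_continuous assms)
  qed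
qed

lemma C1_fun_chain:
  assumes f: "C1_fun f" and h: "\<And>x. (h has_real_derivative h' (f x)) (at (f x))" and h': "continuous_on (range f) h'"
  shows "C1_fun (\<lambda>x. h (f x))"
proof -
  obtain F where F: "\<And>x. (f has_derivative (\<lambda>h. F x \<bullet> h)) (at x)" "continuous_on UNIV F"
    using f unfolding C1_fun_def by blast
  show ?thesis unfolding C1_fun_def
  proof (intro exI conjI allI)
    show "((\<lambda>x. h (f x)) has_derivative (\<lambda>k. (h' (f x) *\<^sub>R F x) \<bullet> k)) (at x)" for x
      using has_derivative_compose[OF F(1) h[unfolded has_field_derivative_def], of x] by simp
    show "continuous_on UNIV (\<lambda>x. h' (f x) *\<^sub>R F x)"
      by (intro continuous_on_scaleR F continuous_on_compose2[OF h'] C1_fun_continuous f) auto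
  qed
qed

lemma C1_fun_prod:
  fixes f :: "'i \<Rightarrow> 'a::euclidean_space \<Rightarrow> real"
  assumes "finite A" "\<And>i. i \<in> A \<Longrightarrow> C1_fun (f i)"
  shows "C1_fun (\<lambda>x. \<Prod>i\<in>A. f i x)"
  using assms
proof (induction A rule: finite_induct)
  case empty
  have "C1_fun (\<lambda>_::'a. 1)" unfolding C1_fun_def
  proof (intro exI conjI allI)
    show "((\<lambda>_::'a. 1::real) has_derivative (\<lambda>h. 0 \<bullet> h)) (at x)" for x
      by (simp only: inner_zero_left has_derivative_const)
  qed simp
  then show ?case by simp
next
  case (insert i A)
  then show ?case using C1_fun_mult[of "f i" "\<lambda>x. \<Prod>i\<in>A. f i x"] by simp
qed

lemma C1_fun_quadratic:
  fixes b :: "'a::euclidean_space"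
  shows "C1_fun (\<lambda>x. (x \<bullet> b - r) * (s - x \<bullet> b))"
  unfolding C1_fun_def
proof (intro exI conjI allI)
  fix x :: 'a
  show "((\<lambda>x. (x \<bullet> b - r) * (s - x \<bullet> b)) has_derivative (\<lambda>h. ((r + s - 2 * (x \<bullet> b)) *\<^sub>R b) \<bullet> h)) (at x)"
    by (auto intro!: derivative_eq_intros simp: fun_eq_iff algebra_simps inner_commute)
  show "continuous_on UNIV (\<lambda>x. (r + s - 2 * (x \<bullet> b)) *\<^sub>R b)" by (intro continuous_intros)
qed

text \<open>The product \<open>q\<close> of squared positive parts is C1 and positive exactly on the
  open box; \<open>j q / (1 + j q)\<close> keeps the support, stays between 0 and 1, and tends to 1
  wherever \<open>q > 0\<close>.\<close>

lemma box_bump_functions: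
  fixes a c :: "'a::euclidean_space"
  assumes ne: "box a c \<noteq> {}"
  obtains \<phi> :: "nat \<Rightarrow> 'a \<Rightarrow> real" where "\<And>j. C1_compact (\<phi> j)" "\<And>j. closure {x. \<phi> j x \<noteq> 0} \<subseteq> cbox a c"
    "\<And>j x. \<bar>\<phi> j x\<bar> \<le> 1" "\<And>x. (\<lambda>j. \<phi> j x) \<longlonglongrightarrow> indicator (box a c) x"
proof -
  have lt: "a \<bullet> b < c \<bullet> b" if "b \<in> Basis" for b using ne that by (auto simp: box_ne_empty)
  define q where "q = (\<lambda>x::'a. \<Prod>b\<in>Basis. (max 0 ((x \<bullet> b - a \<bullet> b) * (c \<bullet> b - x \<bullet> b)))\<^sup>2)"
  have q0: "q x \<ge> 0" for x unfolding q_def by (intro prod_nonneg) simp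
  have qC: "C1_fun q"
    unfolding q_def
    by (intro C1_fun_prod C1_fun_chain[OF C1_fun_quadratic pos_part_square_derivative]) (auto intro!: continuous_intros)
  have q_in: "q x > 0" if "x \<in> box a c" for x
    unfolding q_def using that by (intro prod_pos) (auto simp: mem_box max_def)
  have q_out: "q x = 0" if nx: "x \<notin> box a c" for x
  proof -
    obtain b where b: "b \<in> Basis" "\<not> (a \<bullet> b < x \<bullet> b \<and> x \<bullet> b < c \<bullet> b)" using nx unfolding mem_box by blast
    have "(x \<bullet> b - a \<bullet> b) * (c \<bullet> b - x \<bullet> b) \<le> 0" using b(2) lt[OF b(1)] by (auto simp: mult_le_0_iff)
    then show ?thesis unfolding q_def using b(1) by (intro prod_zero) (auto intro!: bexI[of _ b])
  qed
  define \<phi> where "\<phi> = (\<lambda>(j::nat) x. real j * q x / (1 + real j * q x))"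
  have den: "1 + real j * q x > 0" for j x using q0[of x] by (intro add_pos_nonneg) auto
  have \<phi>C: "C1_fun (\<phi> j)" for j
    unfolding \<phi>_def
  proof (rule C1_fun_chain[OF qC, where h = "\<lambda>r. real j * r / (1 + real j * r)" and h' = "\<lambda>r. real j / (1 + real j * r)\<^sup>2"])
    show "((\<lambda>r. real j * r / (1 + real j * r)) has_real_derivative real j / (1 + real j * q x)\<^sup>2) (at (q x))" for x
      using den[of j x] by (auto intro!: derivative_eq_intros simp: power2_eq_square field_simps)
    show "continuous_on (range q) (\<lambda>r. real j / (1 + real j * r)\<^sup>2)"
      using den[of j] by (intro continuous_intros) (auto dest: less_imp_neq[symmetric])
  qed
  have supp: "{x. \<phi> j x \<noteq> 0} \<subseteq> cbox a c" for j
    using q_out box_subset_cbox[of a c] by (auto simp: \<phi>_def)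
  show thesis
  proof (rule that[of \<phi>])
    fix j
    obtain G where G: "\<And>x. (\<phi> j has_derivative (\<lambda>h. G x \<bullet> h)) (at x)" "continuous_on UNIV G"
      using \<phi>C[of j] unfolding C1_fun_def by blast
    obtain B where "\<And>x. x \<in> cbox a c \<Longrightarrow> norm x \<le> B" using bounded_cbox[of a c] bounded_iff by metis
    then show "C1_compact (\<phi> j)" using supp[of j] by (intro C1_compactI[OF G, of B]) auto
    show "closure {x. \<phi> j x \<noteq> 0} \<subseteq> cbox a c" by (intro closure_minimal supp closed_cbox)
    show "\<bar>\<phi> j x\<bar> \<le> 1" for x
    proof -
      have "real j * q x \<ge> 0" using q0[of x] by simp
      then show ?thesis by (simp add: \<phi>_def abs_if divide_simps)
    qed
  next
    fix x
    show "(\<lambda>j. \<phi> j x) \<longlonglongrightarrow> indicator (box a c) x"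
    proof (cases "x \<in> box a c")
      case True
      have e: "\<phi> j x = 1 - 1 / (1 + real j * q x)" for j using den[of j x] by (simp add: \<phi>_def field_simps)
      have "filterlim (\<lambda>j. 1 + real j * q x) at_top sequentially"
        using q_in[OF True]
        by (intro filterlim_tendsto_add_at_top[OF tendsto_const] filterlim_at_top_mult_tendsto_pos[OF tendsto_const] filterlim_real_sequentially)
      then have "(\<lambda>j. 1 / (1 + real j * q x)) \<longlonglongrightarrow> 0"
        by (intro tendsto_divide_0[OF tendsto_const] filterlim_at_top_imp_at_infinity)
      then have "(\<lambda>j. 1 - 1 / (1 + real j * q x)) \<longlonglongrightarrow> 1 - 0" by (intro tendsto_diff tendsto_const)
      then show ?thesis using True by (simp add: e)
    next
      case False
      then show ?thesis using q_out by (simp add: \<phi>_def)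
    qed
  qed
qed

lemma square_integrable_component:
  fixes g :: "'b \<Rightarrow> 'a::euclidean_space"
  assumes g: "square_integrable M g"
  shows "square_integrable M (\<lambda>x. g x \<bullet> b)"
proof (rule square_integrable_bound)
  show "integrable M (\<lambda>x. (norm b)\<^sup>2 * (norm (g x))\<^sup>2)"
    using square_integrable_integrable[OF g] by (rule integrable_mult_right)
  show "(\<lambda>x. g x \<bullet> b) \<in> borel_measurable M" using square_integrable_measurable[OF g] by simp
  show "AE x in M. (norm (g x \<bullet> b))\<^sup>2 \<le> (norm b)\<^sup>2 * (norm (g x))\<^sup>2"
  proof (rule AE_I2)
    fix x
    have "norm (g x \<bullet> b) \<le> norm b * norm (g x)" using Cauchy_Schwarz_ineq2[of "g x" b] by (simp add: mult.commute)
    then have "(norm (g x \<bullet> b))\<^sup>2 \<le> (norm b * norm (g x))\<^sup>2" by (rule power_mono) simp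
    then show "(norm (g x \<bullet> b))\<^sup>2 \<le> (norm b)\<^sup>2 * (norm (g x))\<^sup>2" by (simp add: power_mult_distrib)
  qed
qed

lemma square_integrable_indicator_half_space:
  assumes "bounded (A :: ((real^'m) \<times> real) set)" "A \<in> sets borel"
  shows "square_integrable (lebesgue_on half_space) (indicator A :: _ \<Rightarrow> real)"
proof -
  have "emeasure lborel A < \<infinity>" using emeasure_bounded_finite[OF assms(1)] by simp
  then have "integrable lborel (indicator A :: _ \<Rightarrow> real)" using assms(2) by (intro integrable_real_indicator) auto
  then have "integrable lebesgue (indicator A :: _ \<Rightarrow> real)"
    by (subst integrable_completion) (use assms(2) in auto)
  then have "integrable lebesgue (\<lambda>x. indicator half_space x *\<^sub>R (indicator A x :: real))"
    by (intro integrable_mult_indicator) auto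
  then have "integrable (lebesgue_on half_space) (indicator A :: _ \<Rightarrow> real)"
    unfolding integral_half_space .
  moreover have "(\<lambda>x. (norm (indicator A x :: real))\<^sup>2) = indicator A" by (auto simp: indicator_def)
  ultimately show ?thesis unfolding square_integrable_def by auto
qed

text \<open>Bump functions approximate the indicators of boxes with closure in the open half-space.
  This gives vanishing almost everywhere in each such box, and countably many of them exhaust the
  half-space.\<close>

lemma weak_zero_imp_AE_zero:
  fixes h :: "(real^'m) \<times> real \<Rightarrow> real"
  assumes h: "square_integrable (lebesgue_on half_space) h"
    and z: "\<And>\<phi>. C1_compact \<phi> \<Longrightarrow> closure {x. \<phi> x \<noteq> 0} \<subseteq> half_space \<Longrightarrow> (\<integral>x. h x * \<phi> x \<partial>lebesgue_on half_space) = 0"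
  shows "AE x in lebesgue_on half_space. h x = 0"
proof -
  let ?H = "lebesgue_on half_space :: ((real^'m) \<times> real) measure"
  have ib: "integrable ?H (\<lambda>x. h x * indicator (box a c) x)" for a c
    using square_integrable_inner[OF h square_integrable_indicator_half_space[OF bounded_box[of a c]]] by simp
  have small: "(\<integral>x. h x * indicator (box a c) x \<partial>?H) = 0" if ac: "cbox a c \<subseteq> half_space" for a c
  proof (cases "box a c = {}")
    case False
    obtain \<phi> :: "nat \<Rightarrow> (real^'m) \<times> real \<Rightarrow> real" where \<phi>: "\<And>j. C1_compact (\<phi> j)" "\<And>j. closure {x. \<phi> j x \<noteq> 0} \<subseteq> cbox a c"
      "\<And>j x. \<bar>\<phi> j x\<bar> \<le> 1" "\<And>x. (\<lambda>j. \<phi> j x) \<longlonglongrightarrow> indicator (box a c) x"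
      by (rule box_bump_functions[OF False]) blast
    have "(\<lambda>j. \<integral>x. h x * \<phi> j x \<partial>?H) \<longlonglongrightarrow> (\<integral>x. h x * indicator (box a c) x \<partial>?H)"
    proof (rule integral_dominated_convergence[where w = "\<lambda>x. \<bar>h x * indicator (cbox a c) x\<bar>"])
      show "integrable ?H (\<lambda>x. \<bar>h x * indicator (cbox a c) x\<bar>)"
        using square_integrable_inner[OF h square_integrable_indicator_half_space[OF bounded_cbox[of a c]]]
        by (intro integrable_abs) simp
      show "(\<lambda>x. h x * indicator (box a c) x) \<in> borel_measurable ?H" using ib by auto
      show "(\<lambda>x. h x * \<phi> j x) \<in> borel_measurable ?H" for j
        using square_integrable_measurable[OF h] square_integrable_measurable[OF C1_compact_square_integrable_half_space(1)[OF \<phi>(1)]]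
        by simp
      show "AE x in ?H. (\<lambda>j. h x * \<phi> j x) \<longlonglongrightarrow> h x * indicator (box a c) x"
        by (intro AE_I2 tendsto_mult tendsto_const \<phi>(4))
      show "AE x in ?H. norm (h x * \<phi> j x) \<le> \<bar>h x * indicator (cbox a c) x\<bar>" for j
      proof (rule AE_I2)
        fix x
        have "\<phi> j x = 0" if "x \<notin> cbox a c" using \<phi>(2)[of j] closure_subset[of "{x. \<phi> j x \<noteq> 0}"] that by auto
        then have "\<bar>\<phi> j x\<bar> \<le> indicator (cbox a c) x" using \<phi>(3)[of j x] by (cases "x \<in> cbox a c") auto
        then have "\<bar>h x\<bar> * \<bar>\<phi> j x\<bar> \<le> \<bar>h x\<bar> * indicator (cbox a c) x" by (rule mult_left_mono) simp
        then show "norm (h x * \<phi> j x) \<le> \<bar>h x * indicator (cbox a c) x\<bar>" by (simp add: abs_mult)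
      qed
    qed
    moreover have "(\<integral>x. h x * \<phi> j x \<partial>?H) = 0" for j using z[OF \<phi>(1)] \<phi>(2) ac by blast
    ultimately show ?thesis by (simp add: tendsto_const_iff)
  qed simp
  have loc: "AE x in lebesgue. x \<in> box a c \<longrightarrow> h x = 0" if ac: "cbox a c \<subseteq> half_space" for a c
  proof -
    have conv: "(\<integral>x. indicator half_space x *\<^sub>R (h x * indicator B x) \<partial>lebesgue) = (\<integral>x. h x * indicator B x \<partial>?H)" for B
      unfolding integral_half_space ..
    have bh: "box a c \<subseteq> half_space" using ac box_subset_cbox by blast
    have "AE x in lebesgue. indicator half_space x *\<^sub>R (h x * indicator (box a c) x) = 0"
    proof (rule AE_eq_0_if_box_integrals_0)
      show "integrable lebesgue (\<lambda>x. indicator half_space x *\<^sub>R (h x * indicator (box a c) x))"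
        using ib[of a c] unfolding integral_half_space .
      fix a' c' :: "(real^'m) \<times> real"
      \<comment> \<open>Intersecting with an arbitrary box yields a box inside the fixed one, so its
        closure is again contained in the half-space and \<open>small\<close> applies.\<close>
      obtain a2 c2 where i: "box a' c' \<inter> box a c = box a2 c2" using box_Int_box[of a' c' a c] by blast
      have "(\<integral>x. indicator (box a' c') x * (indicator half_space x *\<^sub>R (h x * indicator (box a c) x)) \<partial>lebesgue)
          = (\<integral>x. indicator half_space x *\<^sub>R (h x * indicator (box a2 c2) x) \<partial>lebesgue)"
        unfolding i[symmetric] by (rule Bochner_Integration.integral_cong[OF refl]) (auto simp: indicator_def)
      also have "\<dots> = 0"
      proof (cases "box a2 c2 = {}")
        case False
        then have "cbox a2 c2 = closure (box a2 c2)" by (simp add: closure_box)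
        also have "\<dots> \<subseteq> closure (box a c)" using i by (intro closure_mono) auto
        also have "\<dots> \<subseteq> cbox a c" by (intro closure_minimal box_subset_cbox closed_cbox)
        finally have "cbox a2 c2 \<subseteq> half_space" using ac by blast
        then show ?thesis unfolding conv by (rule small)
      qed simp
      finally show "(\<integral>x. indicator (box a' c') x * (indicator half_space x *\<^sub>R (h x * indicator (box a c) x)) \<partial>lebesgue) = 0" .
    qed
    then show ?thesis
    proof eventually_elim
      case (elim x)
      then show ?case using bh by (auto simp: indicator_def split: if_splits)
    qed
  qed
  \<comment> \<open>Boxes that grow tangentially and upwards while their bottom, at height
    \<open>1 / (n + 1)\<close>, sinks to the boundary without touching it.\<close>
  define a where "a = (\<lambda>n::nat. (- real n *\<^sub>R One, 1 / real (Suc n)) :: (real^'m) \<times> real)"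
  define c where "c = (\<lambda>n::nat. (real n *\<^sub>R One, real n) :: (real^'m) \<times> real)"
  have sub: "cbox (a n) (c n) \<subseteq> half_space" for n
  proof
    fix x assume "x \<in> cbox (a n) (c n)"
    moreover have "(0, 1) \<in> (Basis :: ((real^'m) \<times> real) set)" by (simp add: Basis_prod_def)
    ultimately have "a n \<bullet> (0, 1) \<le> x \<bullet> (0, 1)" unfolding mem_box by blast
    then have "1 / real (Suc n) \<le> snd x" by (simp add: a_def inner_prod_def)
    moreover have "1 / real (Suc n) > 0" by simp
    ultimately show "x \<in> half_space" unfolding half_space_def by (simp only: mem_Collect_eq)
  qed
  have "AE x in lebesgue. \<forall>n. x \<in> box (a n) (c n) \<longrightarrow> h x = 0"
    unfolding AE_all_countable using loc[OF sub] by blast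
  then have "AE x in lebesgue. x \<in> half_space \<longrightarrow> h x = 0"
  proof eventually_elim
    case (elim x)
    show ?case
    proof
      assume x: "x \<in> half_space"
      obtain y t where xy: "x = (y, t)" by (cases x)
      have t: "t > 0" using x by (simp add: half_space_def xy)
      obtain N1 :: nat where N1: "norm x < real N1" using reals_Archimedean2 by blast
      obtain N2 :: nat where N2: "1 / t < real N2" using reals_Archimedean2 by blast
      define N where "N = max N1 N2"
      have N: "norm x < real N" "1 / t < real (Suc N)" using N1 N2 by (auto simp: N_def)
      have "norm y \<le> norm x" "\<bar>t\<bar> \<le> norm x" using norm_fst_le[of y t] norm_snd_le[of t y] by (auto simp: xy)
      then have yN: "\<bar>y \<bullet> u\<bar> < real N" if "u \<in> Basis" for u using Basis_le_norm[OF that, of y] N(1) by linarith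
      have tN: "t < real N" using \<open>\<bar>t\<bar> \<le> norm x\<close> N(1) by linarith
      have t1: "1 / real (Suc N) < t" using N(2) t by (simp add: field_simps)
      have "x \<in> box (a N) (c N)"
        unfolding mem_box
      proof
        fix i :: "(real^'m) \<times> real" assume "i \<in> Basis"
        then consider u where "u \<in> Basis" "i = (u, 0)" | "i = (0, 1)" by (auto simp: Basis_prod_def)
        then show "a N \<bullet> i < x \<bullet> i \<and> x \<bullet> i < c N \<bullet> i"
        proof cases
          case 1
          have "One \<bullet> u = (1::real)" using 1(1) by simp
          then show ?thesis using yN[OF 1(1)] by (simp add: 1(2) a_def c_def xy abs_less_iff)
        next
          case 2
          then show ?thesis using tN t1 by (simp add: a_def c_def xy)
        qed
      qed
      then show "h x = 0" using elim by blast
    qed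
  qed
  then show ?thesis by (subst AE_restrict_space_iff) auto
qed

text \<open>The trace comes with a weak gradient of its own, possibly another representative than
  the one in the weak equation; this lemma identifies the two.\<close>

lemma H1_gradient_unique:
  fixes v :: "(real^'m) \<times> real \<Rightarrow> real"
  assumes g: "H1_gradient half_space v g" and g': "H1_gradient half_space v g'"
  shows "AE x in lebesgue_on half_space. g x = g' x"
proof -
  let ?H = "lebesgue_on half_space :: ((real^'m) \<times> real) measure"
  have sg: "square_integrable ?H g" "square_integrable ?H g'" using g g' unfolding H1_gradient_def by auto
  have "AE x in ?H. (g x - g' x) \<bullet> b = 0" if b: "b \<in> Basis" for b
  proof (rule weak_zero_imp_AE_zero)
    show "square_integrable ?H (\<lambda>x. (g x - g' x) \<bullet> b)"
      by (intro square_integrable_component square_integrable_diff sg)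
    fix \<phi> :: "(real^'m) \<times> real \<Rightarrow> real" assume \<phi>: "C1_compact \<phi>" "closure {x. \<phi> x \<noteq> 0} \<subseteq> half_space"
    have e: "(\<integral>x. (g x \<bullet> b) * \<phi> x \<partial>?H) = (\<integral>x. (g' x \<bullet> b) * \<phi> x \<partial>?H)"
    proof -
      have "(\<integral>x. v x * partial \<phi> b x \<partial>?H) = - (\<integral>x. (g x \<bullet> b) * \<phi> x \<partial>?H)"
        using g \<phi> b unfolding H1_gradient_def by blast
      moreover have "(\<integral>x. v x * partial \<phi> b x \<partial>?H) = - (\<integral>x. (g' x \<bullet> b) * \<phi> x \<partial>?H)"
        using g' \<phi> b unfolding H1_gradient_def by blast
      ultimately show ?thesis by simp
    qed
    have "(\<integral>x. ((g x - g' x) \<bullet> b) * \<phi> x \<partial>?H) = (\<integral>x. (g x \<bullet> b) * \<phi> x - (g' x \<bullet> b) * \<phi> x \<partial>?H)"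
      by (simp only: inner_diff_left left_diff_distrib)
    also have "\<dots> = (\<integral>x. (g x \<bullet> b) * \<phi> x \<partial>?H) - (\<integral>x. (g' x \<bullet> b) * \<phi> x \<partial>?H)"
      using square_integrable_inner[OF square_integrable_component[OF sg(1)] C1_compact_square_integrable_half_space(1)[OF \<phi>(1)], of b]
        square_integrable_inner[OF square_integrable_component[OF sg(2)] C1_compact_square_integrable_half_space(1)[OF \<phi>(1)], of b]
      by (intro Bochner_Integration.integral_diff) (simp_all only: inner_real_def)
    finally show "(\<integral>x. ((g x - g' x) \<bullet> b) * \<phi> x \<partial>?H) = 0" using e by simp
  qed
  then have "AE x in ?H. \<forall>b\<in>Basis. (g x - g' x) \<bullet> b = 0"
    by (intro AE_finite_allI) auto
  then show ?thesis
  proof eventually_elim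
    case (elim x)
    then show ?case using euclidean_all_zero_iff[of "g x - g' x"] by simp
  qed
qed

section \<open>Classification\<close>

context exterior_bubble begin

lemma integrable_moment_bd:
  assumes T: "square_integrable lebesgue (\<lambda>y::real^'m. T y / sqrt (wt (y, 0)))"
  shows "integrable lebesgue (\<lambda>y. (T y / sqrt (wt (y, 0))) * (sqrt (wt (y, 0)) * (bweight y * klein a (y, 0) ^ p)))"
proof -
  have c: "continuous_on UNIV (\<lambda>y::real^'m. klein a (y, 0) ^ p)"
    by (intro continuous_on_power continuous_on_compose2[OF lap_on_continuous[OF lap_klein[OF open_UNIV]]] continuous_intros) auto
  have "square_integrable lebesgue (\<lambda>y. klein a (y, 0) ^ p * (sqrt (wt (y, 0)) * bweight y))"
  proof (rule square_integrable_bounded_mult[OF square_integrable_bweight])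
    show "(\<lambda>y::real^'m. klein a (y, 0) ^ p) \<in> borel_measurable lebesgue"
      using c by (intro measurable_completion) (simp add: borel_measurable_continuous_onI)
    show "AE y::real^'m in lebesgue. \<bar>klein a (y, 0) ^ p\<bar> \<le> norm a ^ p"
      unfolding power_abs by (intro AE_I2 power_mono klein_bound) simp
  qed
  from square_integrable_inner[OF T this] show ?thesis
    unfolding inner_real_def by (simp only: mult_ac)
qed

lemma moment_bd_diff:
  assumes T: "square_integrable lebesgue (\<lambda>y::real^'m. T y / sqrt (wt (y, 0)))"
    and U: "square_integrable lebesgue (\<lambda>y::real^'m. U y / sqrt (wt (y, 0)))"
  shows "moment_bd (\<lambda>y. T y - U y) a p = moment_bd T a p - moment_bd U a p"
  unfolding moment_bd_def diff_divide_distrib left_diff_distrib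
  by (rule Bochner_Integration.integral_diff[OF integrable_moment_bd[OF T] integrable_moment_bd[OF U]])

lemma moment_bd_expand:
  assumes T: "square_integrable lebesgue (\<lambda>y::real^'m. T y / sqrt (wt (y, 0)))"
  shows "moment_bd T a 1 = (\<Sum>b\<in>Basis. (a \<bullet> b) * moment_bd T b 1)"
proof -
  have k: "klein a x = (\<Sum>b\<in>Basis. (a \<bullet> b) * klein b x)" for x :: "(real^'m) \<times> real"
    unfolding inner_kvec[symmetric] by (subst (1) euclidean_inner) (simp add: inner_commute)
  have "moment_bd T a 1 = (\<integral>y. (\<Sum>b\<in>Basis. (a \<bullet> b) * ((T y / sqrt (wt (y, 0))) * (sqrt (wt (y, 0)) * (bweight y * klein b (y, 0) ^ 1)))) \<partial>lebesgue)"
    unfolding moment_bd_def power_one_right k[of "(_, 0)"] sum_distrib_left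
    by (simp only: mult_ac)
  also have "\<dots> = (\<Sum>b\<in>Basis. (a \<bullet> b) * moment_bd T b 1)"
    unfolding moment_bd_def integral_mult_right_zero[symmetric]
    by (rule Bochner_Integration.integral_sum) (intro integrable_mult_right integrable_moment_bd T)
  finally show ?thesis .
qed

text \<open>The Gram matrix of the linear functions of \<open>y\<close> on the boundary, for the
  positive weight \<open>base * bweight\<close>.\<close>

definition gram :: "(real^'m) \<times> real \<Rightarrow> (real^'m) \<times> real \<Rightarrow> real" where
  "gram c a = moment_bd (\<lambda>y. base (y, 0) * klein c (y, 0)) a 1"

lemma square_integrable_klein_trace:
  fixes c :: "(real^'m) \<times> real"
  assumes "CARD('m) \<ge> 2"
  shows "square_integrable lebesgue (\<lambda>y::real^'m. base (y, 0) * klein c (y, 0) / sqrt (wt (y, 0)))"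
  using robin_solution_klein[OF assms, of c] unfolding robin_solution_def admissible_def by blast

lemma gram_eq:
  fixes a c :: "(real^'m) \<times> real"
  shows "gram c a = (\<integral>y. base (y, 0) * bweight y * (klein c (y, 0) * klein a (y, 0)) \<partial>lebesgue)"
  unfolding gram_def moment_bd_def power_one_right
proof (rule Bochner_Integration.integral_cong[OF refl])
  fix y :: "real^'m"
  have "sqrt (wt (y, 0)) > 0" using wt_pos[of "(y, 0)"] by simp
  then show "base (y, 0) * klein c (y, 0) / sqrt (wt (y, 0)) * (sqrt (wt (y, 0)) * (bweight y * klein a (y, 0)))
      = base (y, 0) * bweight y * (klein c (y, 0) * klein a (y, 0))" by simp
qed

lemma gram_sym: "gram c a = gram a c"
  unfolding gram_eq by (simp only: mult.commute)

lemma gram_expand: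
  assumes "CARD('m) \<ge> 2"
  shows "gram (c :: (real^'m) \<times> real) a = (\<Sum>b\<in>Basis. (a \<bullet> b) * gram c b)"
  unfolding gram_def by (rule moment_bd_expand[OF square_integrable_klein_trace[OF assms]])

text \<open>A linear function of \<open>y\<close> with zero norm vanishes almost everywhere on the
  boundary. Its nonvanishing set is open and negligible, hence empty, so \<open>num c\<close> is
  zero at every boundary point.\<close>

lemma gram_definite:
  fixes c :: "(real^'m) \<times> real"
  assumes m: "CARD('m) \<ge> 2" and z: "gram c c = 0"
  shows "c = 0"
proof -
  let ?f = "\<lambda>y::real^'m. base (y, 0) * bweight y * (klein c (y, 0) * klein c (y, 0))"
  have b: "base (y, 0) > 0" for y :: "real^'m" by (rule base_pos) simp
  have f0: "?f y \<ge> 0" for y using b[of y] bweight_pos[of y] by simp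
  have "integrable lebesgue ?f"
  proof -
    have e: "base (y, 0) * klein c (y, 0) / sqrt (wt (y, 0)) * (sqrt (wt (y, 0)) * (bweight y * klein c (y, 0) ^ 1)) = ?f y" for y :: "real^'m"
      using wt_pos[of "(y, 0)"] by simp
    show ?thesis using integrable_moment_bd[OF square_integrable_klein_trace[OF m, of c], of c 1] unfolding e .
  qed
  then have "AE y in lebesgue. ?f y = 0"
    using z f0 unfolding gram_eq by (subst (asm) integral_nonneg_eq_0_iff_AE) auto
  then have ae: "AE y::real^'m in lebesgue. klein c (y, 0) = 0"
  proof eventually_elim
    case (elim y)
    then show ?case using b[of y] bweight_pos[of y] by simp
  qed
  let ?S = "{y::real^'m. klein c (y, 0) \<noteq> 0}"
  have "continuous_on UNIV (\<lambda>y::real^'m. klein c (y, 0))"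
    by (intro continuous_on_compose2[OF lap_on_continuous[OF lap_klein[OF open_UNIV]]] continuous_intros) auto
  then have op: "open ?S" by (intro open_Collect_neq continuous_on_const)
  then have "?S \<in> sets lebesgue" by simp
  moreover have "emeasure lebesgue ?S = 0" using ae by (subst (asm) AE_iff_measurable[OF \<open>?S \<in> sets lebesgue\<close>]) auto
  ultimately have "negligible ?S" by (simp add: negligible_iff_null_sets null_sets_def)
  then have "?S = {}" using op open_not_negligible by blast
  then have num0: "num c (y, 0) = 0" for y :: "real^'m" using klein_num[of c "(y, 0)"] by auto
  \<comment> \<open>The origin tests the last component, as \<open>num c 0 = snd c * kk\<close>; the
    point \<open>fst c\<close> then tests the tangential ones.\<close>
  have "snd c = 0" using num0[of 0] kk_pos by (simp add: num_def)
  moreover have "fst c = 0" using num0[of "fst c"] kk_pos \<open>snd c = 0\<close> by (simp add: num_def)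
  ultimately show ?thesis by (simp add: prod_eq_iff)
qed

text \<open>Nondegeneracy of the Gram matrix permits subtracting a linear solution that matches the
  first boundary moments of \<open>v\<close>, the only ones that the recursion leaves free. The
  difference has zero trace, and then it is zero.\<close>

lemma robin_solution_classification:
  fixes v :: "(real^'m) \<times> real \<Rightarrow> real"
  assumes m: "CARD('m) \<ge> 2" and v: "robin_solution v g T"
  obtains c where "AE x in lebesgue_on half_space. v x = base x * klein c x"
proof -
  have sT: "square_integrable lebesgue (\<lambda>y. T y / sqrt (wt (y, 0)))"
    using v unfolding robin_solution_def admissible_def by blast
  define \<Gamma> where "\<Gamma> = (\<lambda>c::(real^'m) \<times> real. \<Sum>b\<in>Basis. gram c b *\<^sub>R b)"
  have gl: "gram (r *\<^sub>R c + s *\<^sub>R d) a = r * gram c a + s * gram d a" for r s and c d a :: "(real^'m) \<times> real"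
  proof -
    have "gram a (r *\<^sub>R c + s *\<^sub>R d) = r * gram a c + s * gram a d"
      unfolding gram_expand[OF m, of a "r *\<^sub>R c + s *\<^sub>R d"] gram_expand[OF m, of a c] gram_expand[OF m, of a d]
        inner_add_left inner_scaleR_left distrib_right sum.distrib sum_distrib_left
      by (simp only: mult.assoc)
    then show ?thesis by (simp only: gram_sym[of a])
  qed
  have lin: "linear \<Gamma>"
  proof (rule linearI)
    show "\<Gamma> (c + d) = \<Gamma> c + \<Gamma> d" for c d
      unfolding \<Gamma>_def using gl[of 1 c 1 d] by (simp add: scaleR_add_left sum.distrib)
    show "\<Gamma> (r *\<^sub>R c) = r *\<^sub>R \<Gamma> c" for r c
      unfolding \<Gamma>_def using gl[of r c 0 0] by (simp add: scaleR_sum_right)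
  qed
  have \<Gamma>b: "\<Gamma> c \<bullet> b = gram c b" if "b \<in> Basis" for b c
    unfolding \<Gamma>_def using that by (simp add: inner_sum_left inner_Basis if_distrib cong: if_cong)
  have "inj \<Gamma>"
  proof (rule linear_injective_0[OF lin, THEN iffD2], intro allI impI)
    fix c assume "\<Gamma> c = 0"
    then have "gram c b = 0" if "b \<in> Basis" for b using \<Gamma>b[OF that, of c] by simp
    then have "gram c c = 0" using gram_expand[OF m, of c c] by simp
    then show "c = 0" by (rule gram_definite[OF m])
  qed
  \<comment> \<open>In finite dimension injectivity gives surjectivity, so the prescribed first
    moments are attained by some \<open>c\<close>.\<close>
  with lin have "surj \<Gamma>" by (rule linear_injective_imp_surjective) (rule refl)
  then obtain c where c: "(\<Sum>b\<in>Basis. moment_bd T b 1 *\<^sub>R b) = \<Gamma> c" by (rule surjE)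
  have gc: "gram c b = moment_bd T b 1" if "b \<in> Basis" for b
    unfolding \<Gamma>b[OF that, of c, symmetric] c[symmetric]
    using that by (simp add: inner_sum_left inner_Basis if_distrib cong: if_cong)
  let ?U = "\<lambda>y. base (y, 0) * klein c (y, 0)"
  have diff: "robin_solution (\<lambda>x. v x - base x * klein c x) (\<lambda>x. g x - Gtest c 1 0 x) (\<lambda>y. T y - ?U y)"
    by (rule robin_solution_diff[OF v robin_solution_klein[OF m]])
  have "moment_bd (\<lambda>y. T y - ?U y) a 1 = 0" for a
  proof -
    have "moment_bd (\<lambda>y. T y - ?U y) a 1 = moment_bd T a 1 - gram c a"
      unfolding gram_def by (rule moment_bd_diff[OF sT square_integrable_klein_trace[OF m]])
    also have "\<dots> = 0"
      unfolding moment_bd_expand[OF sT, of a] gram_expand[OF m, of c a]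
      by (simp add: sum_subtractf[symmetric] gc del: sum_subtractf)
    finally show ?thesis .
  qed
  then have "moment_bd (\<lambda>y. T y - ?U y) a p = 0" for a p by (rule moment_bd_zero[OF m diff])
  moreover have "square_integrable lebesgue (\<lambda>y. (T y - ?U y) / sqrt (wt (y, 0)))"
    using diff unfolding robin_solution_def admissible_def by blast
  ultimately have "AE y in lebesgue. T y - ?U y = 0" by (intro trace_zero_if_moments_zero)
  then have "AE x in lebesgue_on half_space. v x - base x * klein c x = 0"
    by (rule robin_solution_zero_trace[OF diff])
  then have "AE x in lebesgue_on half_space. v x = base x * klein c x" by eventually_elim simp
  then show thesis by (rule that)
qed

text \<open>On the half-space and its boundary the weights \<open>1 / wt\<close> and
  \<open>1 / sqrt wt\<close> are bounded, so unweighted convergence implies the weighted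
  one.\<close>

lemma is_trace_admissible:
  fixes v :: "(real^'m) \<times> real \<Rightarrow> real"
  assumes g: "H1_gradient half_space v g" and T: "is_trace v T"
  shows "admissible v g T"
proof -
  let ?H = "lebesgue_on half_space :: ((real^'m) \<times> real) measure"
  obtain g' \<phi> where g': "H1_gradient half_space v g'" and \<phi>: "\<And>k::nat. C1_compact (\<phi> k)"
    "(\<lambda>k. \<integral>x. (\<phi> k x - v x)\<^sup>2 \<partial>?H) \<longlonglongrightarrow> 0"
    "(\<lambda>k. \<integral>x. (norm (gradient (\<phi> k) x - g' x))\<^sup>2 \<partial>?H) \<longlonglongrightarrow> 0"
    "(\<lambda>k. \<integral>y. (\<phi> k (y, 0) - T y)\<^sup>2 \<partial>lebesgue) \<longlonglongrightarrow> 0"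
    using T unfolding is_trace_def by blast
  have sT: "square_integrable lebesgue T" using T unfolding is_trace_def by blast
  have sv: "square_integrable ?H v" and sg: "square_integrable ?H g" using g unfolding H1_gradient_def by auto
  have sg': "square_integrable ?H g'" using g' unfolding H1_gradient_def by auto
  note m1 = inverse_wt_measurable and b1 = inverse_wt_bounded and m2 = inverse_wt_boundary_measurable
    and b2 = inverse_wt_boundary_bounded
  note s\<phi> = C1_compact_square_integrable_half_space[OF \<phi>(1)]
  show ?thesis
    unfolding admissible_def
  proof (intro conjI exI[of _ \<phi>] allI \<phi>(1) sg)
    show "square_integrable ?H (\<lambda>x. v x / wt x)"
      using square_integrable_bounded_mult[OF sv m1 b1] by simp
    show "square_integrable lebesgue (\<lambda>y. T y / sqrt (wt (y, 0)))"
      using square_integrable_bounded_mult[OF sT m2 b2] by simp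
    have "L2_lim ?H \<phi> v" using \<phi>(2) by (simp add: L2_lim_def)
    from L2_lim_bounded_mult[OF s\<phi>(1) sv this m1 b1] show "L2_lim ?H (\<lambda>k x. \<phi> k x / wt x) (\<lambda>x. v x / wt x)" by simp
    have "L2_lim lebesgue (\<lambda>k y. \<phi> k (y, 0)) T" using \<phi>(4) by (simp add: L2_lim_def)
    from L2_lim_bounded_mult[OF s\<phi>(2) sT this m2 b2]
    show "L2_lim lebesgue (\<lambda>k y. \<phi> k (y, 0) / sqrt (wt (y, 0))) (\<lambda>y. T y / sqrt (wt (y, 0)))" by simp
    have "(\<integral>x. (norm (gradient (\<phi> k) x - g' x))\<^sup>2 \<partial>?H) = (\<integral>x. (norm (gradient (\<phi> k) x - g x))\<^sup>2 \<partial>?H)" for k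
    proof (rule integral_cong_AE)
      show "(\<lambda>x. (norm (gradient (\<phi> k) x - g' x))\<^sup>2) \<in> borel_measurable ?H"
        "(\<lambda>x. (norm (gradient (\<phi> k) x - g x))\<^sup>2) \<in> borel_measurable ?H"
        using square_integrable_measurable[OF sg] square_integrable_measurable[OF sg']
          square_integrable_measurable[OF C1_compact_square_integrable(2)[OF \<phi>(1)]] by simp_all
      show "AE x in ?H. (norm (gradient (\<phi> k) x - g' x))\<^sup>2 = (norm (gradient (\<phi> k) x - g x))\<^sup>2"
        using H1_gradient_unique[OF g g'] by eventually_elim simp
    qed
    then show "L2_lim ?H (\<lambda>k. gradient (\<phi> k)) g" using \<phi>(3) by (simp add: L2_lim_def)
  qed
qed

end

lemma exterior_bubble_wt: "rho n K H x = exterior_bubble.wt (frakD n K H) x" if "frakD n K H > 1"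
proof -
  interpret exterior_bubble "frakD n K H" by standard (rule that)
  show ?thesis
    unfolding rho_def wt_def kk_def norm_square_split power2_norm_eq_inner
    by (simp add: power2_eq_square algebra_simps)
qed

section \<open>Translation between the bubble and the normalised problem\<close>

context
  fixes n :: nat and K H :: real
  assumes n3: "n \<ge> 3" and K: "K < 0" and D: "frakD n K H > 1"
begin

interpretation exterior_bubble "frakD n K H"
  by standard (rule D)

definition bubble_const :: real where
  "bubble_const = alpha n / \<bar>K\<bar> powr ((real n - 2) / 4)"

lemma bubble_const_pos: "bubble_const > 0"
  using n3 K by (simp add: bubble_const_def alpha_def)

lemma rho_pos: "snd x \<ge> 0 \<Longrightarrow> rho n K H x > 0"
  unfolding exterior_bubble_wt[OF D] by (rule wt_pos)

lemma bubble_powr: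
  assumes x: "snd x \<ge> 0" and r: "r > 0"
  shows "bubble n K H x powr (r / (real n - 2)) = (4 * real n * (real n - 1) / \<bar>K\<bar>) powr (r / 4) / rho n K H x powr (r / 2)"
proof -
  let ?q = "r / (real n - 2)"
  have n2: "real n - 2 > 0" using n3 by simp
  have p: "rho n K H x > 0" by (rule rho_pos[OF x])
  have "\<delta> / m * (r / \<delta>) = r / m" if "\<delta> > 0" for \<delta> m :: real using that by simp
  from this[OF n2] have 1: "(y powr ((real n - 2) / 4)) powr ?q = y powr (r / 4)"
    and 2: "(y powr ((real n - 2) / 2)) powr ?q = y powr (r / 2)" for y :: real
    by (simp_all only: powr_powr)
  have "bubble n K H x powr ?q = (alpha n powr ?q / (\<bar>K\<bar> powr ((real n - 2) / 4)) powr ?q) * (1 / (rho n K H x powr ((real n - 2) / 2)) powr ?q)"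
    unfolding bubble_def by (simp add: powr_mult powr_divide alpha_def)
  also have "\<dots> = (4 * real n * (real n - 1)) powr (r / 4) / \<bar>K\<bar> powr (r / 4) * (1 / rho n K H x powr (r / 2))"
    unfolding alpha_def 1 2 ..
  also have "(4 * real n * (real n - 1)) powr (r / 4) / \<bar>K\<bar> powr (r / 4) = (4 * real n * (real n - 1) / \<bar>K\<bar>) powr (r / 4)"
    by (rule powr_divide[symmetric])
  finally show ?thesis by simp
qed

lemma bubble_powr_4: "snd x \<ge> 0 \<Longrightarrow> bubble n K H x powr (4 / (real n - 2)) = 4 * real n * (real n - 1) / \<bar>K\<bar> / (rho n K H x)\<^sup>2"
  using bubble_powr[of x 4] rho_pos[of x] n3 K by (simp add: powr_numeral)

text \<open>\<open>frakD\<close> is precisely half of \<open>H * sqrt (4 n (n - 1) / |K|)\<close>,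
  the constant produced by this power of the bubble.\<close>

lemma bubble_powr_2: "snd x \<ge> 0 \<Longrightarrow> H * bubble n K H x powr (2 / (real n - 2)) = 2 * frakD n K H / rho n K H x"
proof -
  assume x: "snd x \<ge> 0"
  define X where "X = 4 * real n * (real n - 1) / \<bar>K\<bar>"
  have "X \<ge> 0" using n3 by (simp add: X_def)
  then have "X powr (2 / 4) = sqrt X" using powr_half_sqrt[of X] by simp
  then have "bubble n K H x powr (2 / (real n - 2)) = sqrt X / rho n K H x"
    using bubble_powr[OF x, of 2] rho_pos[OF x] by (simp add: X_def[symmetric])
  also have "X = 4 * (real n * (real n - 1)) / \<bar>K\<bar>" by (simp add: X_def)
  also have "sqrt (4 * (real n * (real n - 1)) / \<bar>K\<bar>) = 2 * sqrt (real n * (real n - 1)) / sqrt \<bar>K\<bar>"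
    by (simp add: real_sqrt_mult real_sqrt_divide)
  finally show ?thesis by (simp add: frakD_def)
qed

lemma bubble_has_derivative:
  fixes x :: "(real^'m) \<times> real"
  assumes x: "snd x \<ge> 0"
  shows "(bubble n K H has_derivative
    (\<lambda>h. ((bubble_const * (2 - real n) / 2 * rho n K H x powr (- real n / 2)) *\<^sub>R Gwt x) \<bullet> h)) (at x)"
proof -
  let ?q = "- ((real n - 2) / 2)"
  have p: "wt x > 0" by (rule wt_pos[OF x])
  have q1: "?q - 1 = - real n / 2" by (simp add: field_simps)
  have d: "((\<lambda>r. bubble_const * r powr ?q) has_derivative (*) (bubble_const * (?q * wt x powr (?q - 1)))) (at (wt x))"
    using DERIV_cmult[OF has_real_derivative_powr[OF p]] unfolding has_field_derivative_def .
  have "((\<lambda>x::(real^'m) \<times> real. bubble_const * wt x powr ?q) has_derivative (\<lambda>h. bubble_const * (?q * wt x powr (?q - 1)) * (Gwt x \<bullet> h))) (at x)"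
    using has_derivative_compose[OF wt_has_derivative[of x] d] by (simp add: Gwt_def)
  moreover have "bubble n K H = (\<lambda>x::(real^'m) \<times> real. bubble_const * wt x powr ?q)"
    unfolding bubble_def bubble_const_def exterior_bubble_wt[OF D]
    by (simp only: powr_minus_divide)
  moreover have "bubble_const * (?q * wt x powr (?q - 1)) = bubble_const * (2 - real n) / 2 * rho n K H x powr (- real n / 2)"
    unfolding q1 exterior_bubble_wt[OF D] by (simp add: field_simps)
  ultimately show ?thesis by (simp only: inner_scaleR_left)
qed

lemma z_tan_eq:
  fixes x :: "(real^'m) \<times> real"
  assumes x: "snd x \<ge> 0"
  shows "z_tan n K H i x = bubble_const * ((2 - real n) * fst x $ i / rho n K H x powr (real n / 2))"
proof -
  have e: "Gwt x \<bullet> e_tan i = 2 * fst x $ i"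
    by (simp add: Gwt_def e_tan_def inner_prod_def inner_axis)
  have q: "t / rho n K H x powr (real n / 2) = t * rho n K H x powr (- real n / 2)" for t
    by (simp only: powr_minus_divide minus_divide_left[symmetric] times_divide_eq_right mult_1_right)
  have aux: "b * N / 2 * w * (2 * t) = b * (N * t * w)" for b N w t :: real by simp
  show ?thesis
    unfolding z_tan_def partial_eqI[OF bubble_has_derivative[OF x]] inner_scaleR_left e q by (rule aux)
qed

lemma z_last_eq:
  fixes x :: "(real^'m) \<times> real"
  assumes x: "snd x \<ge> 0"
  shows "z_last n K H x = bubble_const * ((real n - 2) / 2)
    * (((norm x)\<^sup>2 + 1 - (frakD n K H)\<^sup>2) / rho n K H x powr (real n / 2))"
proof -
  let ?D = "frakD n K H"
  define r where "r = rho n K H x"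
  define w where "w = r powr (- real n / 2)"
  have r: "r > 0" unfolding r_def by (rule rho_pos[OF x])
  have rw: "r = wt x" by (simp add: r_def exterior_bubble_wt[OF D])
  have b: "bubble n K H x = bubble_const * (w * r)"
  proof -
    have "1 / r powr ((real n - 2) / 2) = r powr (- ((real n - 2) / 2))" by (simp only: powr_minus_divide)
    also have "- ((real n - 2) / 2) = - real n / 2 + 1" by (simp add: field_simps)
    also have "r powr (- real n / 2 + 1) = w * r"
      using r by (simp only: powr_add[of r "- real n / 2" 1] powr_one w_def)
    finally show ?thesis by (simp add: bubble_def bubble_const_def r_def)
  qed
  \<comment> \<open>The centre of the spheres \<open>rho = const\<close> is \<open>- D e_n\<close>,
    so the dilation field about it is half the gradient of \<open>rho\<close>, and the radial term
    becomes \<open>|Gwt|^2 / 2 = 2 * (r + 1)\<close>.\<close>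
  have e: "x + ?D *\<^sub>R e_last = (1 / 2) *\<^sub>R Gwt x"
    by (simp add: e_last_def Gwt_def prod_eq_iff scaleR_add_right)
  have g1: "Gwt x \<bullet> (x + ?D *\<^sub>R e_last) = 2 * (r + 1)"
    unfolding e inner_scaleR_right gradient_inner_products rw by simp
  have g2: "Gwt x \<bullet> e_last = 2 * snd x + 2 * ?D"
    by (simp add: Gwt_def e_last_def inner_prod_def)
  have aux: "N / 2 * (b * (w * r)) - b * N / 2 * w * (2 * (r + 1)) + d * (b * N / 2 * w * e)
      = N / 2 * (b * w) * (r - 2 * (r + 1) + d * e)" for N b d e :: real
    by (simp add: algebra_simps)
  have "z_last n K H x = (2 - real n) / 2 * (bubble_const * w) * (r - 2 * (r + 1) + ?D * (2 * snd x + 2 * ?D))"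
    unfolding z_last_def gradient_eqI[OF bubble_has_derivative[OF x]] partial_eqI[OF bubble_has_derivative[OF x]]
      inner_scaleR_left g1 g2 b r_def[symmetric] w_def[symmetric]
    by (rule aux)
  also have "r - 2 * (r + 1) + ?D * (2 * snd x + 2 * ?D) = - ((norm x)\<^sup>2 + 1 - ?D\<^sup>2)"
    unfolding rw wt_def kk_def by (simp add: algebra_simps power2_eq_square)
  finally have z: "z_last n K H x = (2 - real n) / 2 * (bubble_const * w) * - ((norm x)\<^sup>2 + 1 - ?D\<^sup>2)" .
  have q: "q / r powr (real n / 2) = q * w" for q
    by (simp only: w_def powr_minus_divide minus_divide_left[symmetric] times_divide_eq_right mult_1_right)
  have "(2 - N) / 2 * (b * w) * - q = b * ((N - 2) / 2) * (q * w)" for N b q :: real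
    by (simp add: field_simps)
  then show ?thesis unfolding z r_def[symmetric] q .
qed

text \<open>The weak equation is \<open>a = 4 (n - 1) / (n - 2)\<close> times the normalised one:
  the powers of the bubble turn the potential into \<open>a * n * (n + 2) / wt^2\<close> and the
  boundary coefficient into \<open>a * n * D / wt\<close>.\<close>

lemma weak_robin_solution_imp:
  fixes v :: "(real^'m) \<times> real \<Rightarrow> real"
  assumes dim: "n = CARD('m) + 1"
    and sol: "weak_robin_solution
        (4 * (real n - 1) / (real n - 2))
        (\<lambda>x. (real n + 2) / (real n - 2) * \<bar>K\<bar> * bubble n K H x powr (4 / (real n - 2)))
        (2 / (real n - 2))
        (\<lambda>y. real n / (real n - 2) * H * bubble n K H (y, 0) powr (2 / (real n - 2))) v"
  obtains g T where "robin_solution v g T"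
proof -
  let ?H = "lebesgue_on half_space :: ((real^'m) \<times> real) measure"
  define a where "a = 4 * (real n - 1) / (real n - 2)"
  let ?p = "\<lambda>x. (real n + 2) / (real n - 2) * \<bar>K\<bar> * bubble n K H x powr (4 / (real n - 2))"
  let ?q = "\<lambda>y. real n / (real n - 2) * H * bubble n K H (y, 0) powr (2 / (real n - 2))"
  have n2: "real n - 2 > 0" "real n - 1 > 0" using n3 by auto
  have M: "real CARD('m) + 1 = real n" "real CARD('m) + 3 = real n + 2" using dim by auto
  have a0: "a \<noteq> 0" using n2 by (simp add: a_def)
  have ab: "a / (2 / (real n - 2)) = 2 * (real n - 1)" using n2 by (simp add: a_def)
  obtain g T where gT: "H1_gradient half_space v g" "is_trace v T"
    and w: "\<And>\<psi>. C1_compact \<psi> \<Longrightarrow> a * (\<integral>x. g x \<bullet> gradient \<psi> x \<partial>?H) + (\<integral>x. ?p x * v x * \<psi> x \<partial>?H)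
         - a / (2 / (real n - 2)) * (\<integral>y. ?q y * T y * \<psi> (y, 0) \<partial>lebesgue) = 0"
    using sol unfolding weak_robin_solution_def a_def by blast
  have "robin_form v g T \<psi> (gradient \<psi>) (\<lambda>y. \<psi> (y, 0)) = 0" if \<psi>: "C1_compact \<psi>" for \<psi>
  proof -
    have 1: "(\<integral>x. ?p x * v x * \<psi> x \<partial>?H) = a * (real n * (real n + 2)) * (\<integral>x. (v x / wt x) * (\<psi> x / wt x) \<partial>?H)"
      unfolding integral_mult_right_zero[symmetric]
    proof (rule Bochner_Integration.integral_cong[OF refl])
      fix x assume "x \<in> space ?H"
      then have x: "snd x \<ge> 0" by (simp add: half_space_def)
      show "?p x * v x * \<psi> x = a * (real n * (real n + 2)) * ((v x / wt x) * (\<psi> x / wt x))"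
        unfolding bubble_powr_4[OF x] exterior_bubble_wt[OF D] a_def
        using n2 K by (simp add: power2_eq_square)
    qed
    have 2: "a / (2 / (real n - 2)) * (\<integral>y. ?q y * T y * \<psi> (y, 0) \<partial>lebesgue)
        = a * (real n * frakD n K H) * (\<integral>y. (T y / sqrt (wt (y, 0))) * (\<psi> (y, 0) / sqrt (wt (y, 0))) \<partial>lebesgue)"
      unfolding integral_mult_right_zero[symmetric] ab
    proof (rule Bochner_Integration.integral_cong[OF refl])
      fix y :: "real^'m"
      have "sqrt (wt (y, 0)) * sqrt (wt (y, 0)) = wt (y, 0)" using wt_pos[of "(y, 0)"] by simp
      then have s: "(T y / sqrt (wt (y, 0))) * (\<psi> (y, 0) / sqrt (wt (y, 0))) = T y * \<psi> (y, 0) / wt (y, 0)"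
        by (simp only: times_divide_times_eq)
      have b: "H * bubble n K H (y, 0) powr (2 / (real n - 2)) = 2 * frakD n K H / wt (y, 0)"
        using bubble_powr_2[of "(y, 0)"] by (simp add: exterior_bubble_wt[OF D])
      have "2 * (real n - 1) * (?q y * T y * \<psi> (y, 0))
        = 2 * (real n - 1) * (real n / (real n - 2)) * (H * bubble n K H (y, 0) powr (2 / (real n - 2))) * T y * \<psi> (y, 0)"
        by (simp only: mult_ac)
      also have "\<dots> = a * (real n * frakD n K H) * (T y * \<psi> (y, 0) / wt (y, 0))"
        unfolding b a_def by simp
      finally show "2 * (real n - 1) * (?q y * T y * \<psi> (y, 0))
        = a * (real n * frakD n K H) * ((T y / sqrt (wt (y, 0))) * (\<psi> (y, 0) / sqrt (wt (y, 0))))" unfolding s .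
    qed
    have "a * (r + b * c * X - b * d * Y) = 0" if "a * r + a * (b * c) * X - a * (b * d) * Y = 0" for r b c d X Y :: real
      using that by (simp add: algebra_simps)
    then have "a * robin_form v g T \<psi> (gradient \<psi>) (\<lambda>y. \<psi> (y, 0)) = 0"
      using w[OF \<psi>] unfolding 1 2 robin_form_def M by blast
    with a0 show ?thesis by simp
  qed
  then have "robin_solution v g T"
    unfolding robin_solution_def using is_trace_admissible[OF gT] by blast
  then show thesis by (rule that)
qed

lemma solution_classification:
  fixes v :: "(real^'m) \<times> real \<Rightarrow> real"
  assumes dim: "n = CARD('m) + 1"
    and sol: "weak_robin_solution
        (4 * (real n - 1) / (real n - 2))
        (\<lambda>x. (real n + 2) / (real n - 2) * \<bar>K\<bar> * bubble n K H x powr (4 / (real n - 2)))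
        (2 / (real n - 2))
        (\<lambda>y. real n / (real n - 2) * H * bubble n K H (y, 0) powr (2 / (real n - 2))) v"
  shows "\<exists>(c :: 'm \<Rightarrow> real) (d :: real). AE x in lebesgue_on half_space.
            v x = (\<Sum>i\<in>UNIV. c i * z_tan n K H i x) + d * z_last n K H x"
proof -
  obtain g T where r: "robin_solution v g T" by (rule weak_robin_solution_imp[OF dim sol])
  have m: "CARD('m) \<ge> 2" using dim n3 by simp
  obtain a where a: "AE x in lebesgue_on half_space. v x = base x * klein a x"
    by (rule robin_solution_classification[OF m r])
  \<comment> \<open>Here \<open>base * klein a\<close> is \<open>wt powr (- n / 2) * num a\<close>,
    and \<open>num a\<close> splits into \<open>2 sqrt kk\<close> times the tangential product and
    \<open>- snd a * (|x|^2 + 1 - D^2)\<close>, because \<open>kk = D^2 - 1\<close>. Dividing by the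
    constants in the closed forms of \<open>z_tan\<close> and \<open>z_last\<close> yields the
    coefficients.\<close>
  define c where "c = (\<lambda>i. 2 * sqrt kk * fst a $ i / (bubble_const * (2 - real n)))"
  define d where "d = - snd a / (bubble_const * ((real n - 2) / 2))"
  have M: "real CARD('m) + 1 = real n" using dim by simp
  have nz: "bubble_const \<noteq> 0" "2 - real n \<noteq> 0" "real n - 2 \<noteq> 0" using bubble_const_pos n3 by auto
  have e: "base x * klein a x = (\<Sum>i\<in>UNIV. c i * z_tan n K H i x) + d * z_last n K H x" if x: "snd x \<ge> 0" for x
  proof -
    define w where "w = wt x powr (- real n / 2)"
    have wr: "t / rho n K H x powr (real n / 2) = t * w" for t
      by (simp only: w_def exterior_bubble_wt[OF D] powr_minus_divide minus_divide_left[symmetric] times_divide_eq_right mult_1_right)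
    have "base x * klein a x = w * num a x"
      unfolding klein_num base_def M w_def[symmetric] by simp
    also have "\<dots> = w * (2 * sqrt kk * (fst a \<bullet> fst x)) - w * snd a * ((norm x)\<^sup>2 + 1 - (frakD n K H)\<^sup>2)"
      unfolding num_def kk_def by (simp add: algebra_simps)
    also have "w * (2 * sqrt kk * (fst a \<bullet> fst x)) = (\<Sum>i\<in>UNIV. c i * z_tan n K H i x)"
      unfolding inner_vec_def sum_distrib_left
    proof (rule sum.cong[OF refl])
      fix i :: 'm
      define B where "B = bubble_const * (2 - real n)"
      have B: "B \<noteq> 0" using nz by (simp add: B_def)
      have "z_tan n K H i x = B * (fst x $ i * w)"
        unfolding z_tan_eq[OF x] wr B_def by (simp only: mult.assoc)
      then show "w * (2 * sqrt kk * (fst a $ i \<bullet> fst x $ i)) = c i * z_tan n K H i x"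
        unfolding c_def B_def[symmetric] inner_real_def using B by simp
    qed
    also have "w * snd a * ((norm x)\<^sup>2 + 1 - (frakD n K H)\<^sup>2) = - (d * z_last n K H x)"
    proof -
      define B where "B = bubble_const * ((real n - 2) / 2)"
      have "B \<noteq> 0" using nz by (simp add: B_def)
      then show ?thesis unfolding z_last_eq[OF x] wr d_def B_def[symmetric] by simp
    qed
    finally show ?thesis by simp
  qed
  have "AE x in lebesgue_on half_space. v x = (\<Sum>i\<in>UNIV. c i * z_tan n K H i x) + d * z_last n K H x"
    using a AE_space
  proof eventually_elim
    case (elim x)
    then show ?case using e[of x] by (simp add: half_space_def)
  qed
  then show ?thesis by blast
qed

end

theorem theorem2p1:
  fixes n :: nat and K H :: real and v :: "(real^'m) \<times> real \<Rightarrow> real"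
  assumes dim: "n = CARD('m) + 1" and n3: "n \<ge> 3"
    and K: "K < 0" and H: "H > 0" and D: "frakD n K H > 1"
    and v: "v \<in> H1 half_space"
    and sol: "weak_robin_solution
        (4 * (real n - 1) / (real n - 2))
        (\<lambda>x. (real n + 2) / (real n - 2) * \<bar>K\<bar> * bubble n K H x powr (4 / (real n - 2)))
        (2 / (real n - 2))
        (\<lambda>y. real n / (real n - 2) * H * bubble n K H (y, 0) powr (2 / (real n - 2)))
        v"
  shows "(\<forall>i::'m. \<forall>x\<in>half_space. z_tan n K H i x
            = alpha n / \<bar>K\<bar> powr ((real n - 2) / 4)
              * ((2 - real n) * fst x $ i / rho n K H x powr (real n / 2)))
       \<and> (\<forall>x\<in>half_space. z_last n K H (x :: (real^'m) \<times> real)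
            = alpha n / \<bar>K\<bar> powr ((real n - 2) / 4) * ((real n - 2) / 2)
              * (((norm x)\<^sup>2 + 1 - (frakD n K H)\<^sup>2) / rho n K H x powr (real n / 2)))
       \<and> (\<exists>(c :: 'm \<Rightarrow> real) (d :: real). AE x in lebesgue_on half_space.
            v x = (\<Sum>i\<in>UNIV. c i * z_tan n K H i x) + d * z_last n K H x)"
proof (intro conjI allI ballI)
  fix i :: 'm and x :: "(real^'m) \<times> real" assume "x \<in> half_space"
  then have "snd x \<ge> 0" by (simp add: half_space_def)
  from z_tan_eq[OF n3 K D this] show "z_tan n K H i x
      = alpha n / \<bar>K\<bar> powr ((real n - 2) / 4) * ((2 - real n) * fst x $ i / rho n K H x powr (real n / 2))"
    unfolding bubble_const_def[OF n3 K D] .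
next
  fix x :: "(real^'m) \<times> real" assume "x \<in> half_space"
  then have "snd x \<ge> 0" by (simp add: half_space_def)
  from z_last_eq[OF n3 K D this] show "z_last n K H x
      = alpha n / \<bar>K\<bar> powr ((real n - 2) / 4) * ((real n - 2) / 2)
        * (((norm x)\<^sup>2 + 1 - (frakD n K H)\<^sup>2) / rho n K H x powr (real n / 2))"
    unfolding bubble_const_def[OF n3 K D] .
next
  show "\<exists>(c :: 'm \<Rightarrow> real) (d :: real). AE x in lebesgue_on half_space.
            v x = (\<Sum>i\<in>UNIV. c i * z_tan n K H i x) + d * z_last n K H x"
    by (rule solution_classification[OF n3 K D dim sol])
qed

end
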